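(* Let $k\ge 1$, let $\Phi,\xi:\mathbb{R}\to\mathbb{R}$ be convex smooth functions with $\Phi(-x)=\Phi(x)$, $\xi(-x)=\xi(x)$, $\Phi(0)=\xi(0)=0$, with $\Phi$ of moderate growth (so that all expectations involved are well defined), let $h\in\mathbb{R}$, and let $0=q_0\le q_1\le\ldots\le q_k\le q_{k+1}=1$. Let $\vec m=(m_0,\ldots,m_k)$ and $\vec n=(n_0,\ldots,n_k)$ satisfy $$0=m_0\le m_1\le\ldots\le m_k=1,\qquad 0=n_0\le n_1\le\ldots\le n_k=1.$$ If $n_j\le m_j$ for all $0\le j\le k$, or $n_j\ge m_j$ for all $0\le j\le k$, then $$\mathcal{P}_k(\vec n)-\mathcal{P}_k(\vec m)\ \ge\ \nabla\mathcal{P}_k(\vec m)\cdot(\vec n-\vec m)=\sum_{0\le j\le k}\frac{\partial \mathcal{P}_k}{\partial m_j}(\vec m)\,(n_j-m_j),$$ where $\mathcal{P}_k(\vec m)=\mathcal{P}_k(\vec m,\vec q)$ is the discrete Parisi functional defined in the context, with $\vec q=(q_0,\ldots,q_{k+1})$ the same fixed vector throughout.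
   Context: Definition of $\mathcal{P}_k$. Let $(z_l)_{0\le l\le k}$ be independent centered Gaussian random variables with variances $\mathbb{E}z_l^2=\xi'(q_{l+1})-\xi'(q_l)$. Set $\Phi_{k+1}(x)=\Phi(x)$ and, recursively for $l=k,k-1,\ldots,0$, $$\Phi_l(x)=\frac{1}{m_l}\log\mathbb{E}_l\exp\big(m_l\Phi_{l+1}(x+z_l)\big),$$ where $\mathbb{E}_l$ denotes expectation with respect to $(z_i)_{i\ge l}$; when $m_l=0$ this is understood as $\Phi_l(x)=\mathbb{E}_l\Phi_{l+1}(x+z_l)$. Then $\mathcal{P}_k(\vec m)=\mathcal{P}_k(\vec m,\vec q)=\Phi_0(h)$. The partial derivatives $\partial\mathcal{P}_k/\partial m_j$ are those of $\Phi_0(h)$ regarded, via this recursion, as a function of the variables $m_0,\ldots,m_k$ with $\vec q$ and $h$ fixed. "Moderate growth" of $\Phi$ means only that all the expectations (integrals) appearing are well defined. *)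

theory Defs
  imports "HOL-Probability.Probability"
begin

definition smooth :: "(real \<Rightarrow> real) \<Rightarrow> bool" where
  "smooth f \<longleftrightarrow> (\<forall>n x. (deriv ^^ n) f differentiable (at x))"

(* The centered Gaussian law with variance v \<ge> 0.  It is defined by scaling a standard Gaussian
   because normal_density with standard deviation 0 is the zero function, whereas v = 0 must
   give the point mass at 0 (consecutive q's may coincide). *)
definition centered_gaussian :: "real \<Rightarrow> real measure" where
  "centered_gaussian v =
     distr (density lborel (\<lambda>g. ennreal (std_normal_density g))) borel (\<lambda>g. sqrt v * g)"

definition z_law :: "(real \<Rightarrow> real) \<Rightarrow> (nat \<Rightarrow> real) \<Rightarrow> nat \<Rightarrow> real measure" where
  "z_law \<xi> q l = centered_gaussian (deriv \<xi> (q (Suc l)) - deriv \<xi> (q l))"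

(* f (x + z) is deterministic apart from z, so at level l of the recursion the expectation over
   (z_i) with i \<ge> l is the expectation over the law of z_l alone. *)
definition log_exp_mean :: "real \<Rightarrow> real measure \<Rightarrow> (real \<Rightarrow> real) \<Rightarrow> real \<Rightarrow> real" where
  "log_exp_mean c \<mu> f x =
     (if c = 0 then (\<integral>z. f (x + z) \<partial>\<mu>)
      else 1 / c * ln (\<integral>z. exp (c * f (x + z)) \<partial>\<mu>))"

(* A vector (m_0, ..., m_k) is a function on nat of which only the values at 0, ..., k matter;
   similarly (q_0, ..., q_{k+1}). *)
function parisi_level ::
  "nat \<Rightarrow> (real \<Rightarrow> real) \<Rightarrow> (real \<Rightarrow> real) \<Rightarrow> (nat \<Rightarrow> real) \<Rightarrow> (nat \<Rightarrow> real) \<Rightarrow> nat \<Rightarrow> real \<Rightarrow> real"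
where
  "parisi_level k \<Phi> \<xi> q m l =
     (if l \<le> k then log_exp_mean (m l) (z_law \<xi> q l) (parisi_level k \<Phi> \<xi> q m (Suc l)) else \<Phi>)"
  by pat_completeness auto
termination
  by (relation "Wellfounded.measure (\<lambda>(k, \<Phi>, \<xi>, q, m, l). Suc k - l)") auto

declare parisi_level.simps [simp del]

lemma parisi_level_top: "parisi_level k \<Phi> \<xi> q m (Suc k) = \<Phi>"
  by (simp add: parisi_level.simps)

lemma parisi_level_step:
  "l \<le> k \<Longrightarrow>
    parisi_level k \<Phi> \<xi> q m l =
      log_exp_mean (m l) (z_law \<xi> q l) (parisi_level k \<Phi> \<xi> q m (Suc l))"
  by (simp add: parisi_level.simps [of k \<Phi> \<xi> q m l])

definition parisi ::
  "nat \<Rightarrow> (real \<Rightarrow> real) \<Rightarrow> (real \<Rightarrow> real) \<Rightarrow> (nat \<Rightarrow> real) \<Rightarrow> real \<Rightarrow> (nat \<Rightarrow> real) \<Rightarrow> real"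
where
  "parisi k \<Phi> \<xi> q h m = parisi_level k \<Phi> \<xi> q m 0 h"

(* All integrals in the recursion for the vector m are finite.  The Bochner integral and ln are
   total, so without this the recursion would silently use default values. *)
definition parisi_well_defined ::
  "nat \<Rightarrow> (real \<Rightarrow> real) \<Rightarrow> (real \<Rightarrow> real) \<Rightarrow> (nat \<Rightarrow> real) \<Rightarrow> (nat \<Rightarrow> real) \<Rightarrow> bool"
where
  "parisi_well_defined k \<Phi> \<xi> q m \<longleftrightarrow>
     (\<forall>l\<le>k. \<forall>x. if m l = 0
        then integrable (z_law \<xi> q l) (\<lambda>z. parisi_level k \<Phi> \<xi> q m (Suc l) (x + z))
        else integrable (z_law \<xi> q l) (\<lambda>z. exp (m l * parisi_level k \<Phi> \<xi> q m (Suc l) (x + z))))"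

definition parisi_well_defined_near ::
  "nat \<Rightarrow> (real \<Rightarrow> real) \<Rightarrow> (real \<Rightarrow> real) \<Rightarrow> (nat \<Rightarrow> real) \<Rightarrow> (nat \<Rightarrow> real) \<Rightarrow> bool"
where
  "parisi_well_defined_near k \<Phi> \<xi> q m \<longleftrightarrow>
     (\<exists>\<epsilon>>0. \<forall>m'. (\<forall>l\<le>k. \<bar>m' l - m l\<bar> < \<epsilon>) \<longrightarrow> parisi_well_defined k \<Phi> \<xi> q m')"

definition partial_deriv :: "((nat \<Rightarrow> real) \<Rightarrow> real) \<Rightarrow> nat \<Rightarrow> (nat \<Rightarrow> real) \<Rightarrow> real" where
  "partial_deriv F j m = deriv (\<lambda>s. F (m(j := s))) (m j)"

end

theory Submission
  imports Defs "HOL-Real_Asymp.Real_Asymp"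
begin

text \<open>The level map \<open>(c, f, x) \<mapsto> 1/c log E exp (c f (x + s g))\<close> is jointly convex for \<open>c \<ge> 0\<close>: if
  \<open>F ((1-t) x + t y) \<le> (1-t) f0 x + t f1 y\<close> for all \<open>x\<close>, \<open>y\<close> and \<open>F\<close> is convex, the same inequality
  holds for the images, with exponents \<open>c0\<close>, \<open>c1\<close> and \<open>(1-t) c0 + t c1\<close>. For small \<open>s\<close> the map is, up to
  \<open>O(s^4)\<close>, the supremum over \<open>a\<close> of \<open>E f (x + c s^2 a + s g) - c s^2 a^2 / 2\<close>, in which \<open>c\<close> and \<open>x\<close> enter
  only through the affine argument of \<open>f\<close> and an affine penalty; the semigroup property then gives
  the claim for all \<open>s\<close>. Hence \<open>P (m + t (n - m)) \<le> (1-t) P m + t P n\<close> for small \<open>t\<close>, and it remains to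
  differentiate at \<open>t = 0\<close>. The recursion is differentiated level by level along lines, the
  derivative being linear in the direction; domination comes from the slightly larger parameter
  vector \<open>m + \<epsilon>\<close>, whose levels dominate those of all nearby vectors because they are nonnegative.\<close>

section \<open>Exponential means\<close>

text \<open>Two obstacles shape the proof. First, the drift that is optimal over a long Gaussian
  step is random; a constant one is optimal, up to order \<open>s ^ 4\<close>, only over a short
  step. A step of variance \<open>s\<^sup>2\<close> is therefore cut into \<open>n\<close> equal
  ones, and the accumulated error is of order \<open>1 / n\<close> provided that one constant serves
  all intermediate functions. This requires Lipschitz and semiconcavity bounds, which moderate
  growth of \<open>\<Phi>\<close> does not supply. They are created separately on the two sides of
  the inequality: the left function is approximated from below by tame functions, the right ones are
  replaced by Lipschitz minorants. Secondly, \<open>m 0 = 0\<close> while a partial derivative is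
  two-sided. Exponents of both signs occur near 0, and the division by the exponent must be removed
  before differentiating. Integrability is known only for vectors near \<open>m\<close> and for
  \<open>n\<close>; hence the chord inequality is used for small \<open>t\<close> only, and all
  dominations concern differences from the base point \<open>t = 0\<close>.\<close>

definition lmean :: "real \<Rightarrow> 'a measure \<Rightarrow> ('a \<Rightarrow> real) \<Rightarrow> real" where
  "lmean c M u = (if c = 0 then (\<integral>z. u z \<partial>M) else 1 / c * ln (\<integral>z. exp (c * u z) \<partial>M))"

text \<open>Meant for \<open>u\<close> and \<open>- u\<close> together: the linear terms have
  opposite signs and cancel to first order in the product of the two bounds. This is how
  \<open>lmean_semiconcave\<close> avoids second derivatives.\<close>

lemma exp_le_add_exp_sq: "exp u \<le> u + exp (u\<^sup>2)" for u :: real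
proof -
  have sq: "1 + u\<^sup>2 \<le> exp (u\<^sup>2)" by (rule exp_ge_add_one_self)
  consider "u > 1" | "u < -1" | "0 \<le> u" "u \<le> 1" | "-1 \<le> u" "u < 0" by linarith
  then show ?thesis
  proof cases
    case 1
    then have "u \<le> u\<^sup>2" by (simp add: power2_eq_square)
    then have "exp u \<le> exp (u\<^sup>2)" by simp
    then show ?thesis using 1 by linarith
  next
    case 2
    then have "- u \<le> u\<^sup>2" using mult_right_mono_neg[of u "-1" u] by (simp add: power2_eq_square)
    moreover have "exp u \<le> 1" using 2 by simp
    ultimately show ?thesis using sq by linarith
  next
    case 3
    then show ?thesis using exp_bound[of u] sq by linarith
  next
    case 4
    define v where "v = - u"
    have v: "0 \<le> v" "v \<le> 1" using 4 by (auto simp: v_def)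
    have l: "1 + v + v\<^sup>2 / 2 \<le> exp v" using v by (intro exp_lower_Taylor_quadratic)
    have "1 \<le> (1 - v + v\<^sup>2) * (1 + v + v\<^sup>2 / 2)"
    proof -
      have "(1 - v + v\<^sup>2) * (1 + v + v\<^sup>2 / 2) = 1 + v^2/2 + v^3/2 + v^4/2"
        by (simp add: field_simps power2_eq_square power3_eq_cube power4_eq_xxxx)
      then show ?thesis using v by simp
    qed
    also have "\<dots> \<le> (1 - v + v\<^sup>2) * exp v"
      using v l by (intro mult_left_mono) auto
    finally have "exp (- v) \<le> 1 - v + v\<^sup>2"
      by (simp add: exp_minus field_simps)
    then show ?thesis using sq unfolding v_def power2_minus minus_minus by linarith
  qed
qed

context prob_space
begin

lemma integral_exp_pos:
  assumes "integrable M (\<lambda>z. exp (u z :: real))"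
  shows "0 < (\<integral>z. exp (u z) \<partial>M)"
proof -
  have "(\<integral>z. 0 \<partial>M) < (\<integral>z. exp (u z) \<partial>M)"
    using assms by (intro integral_less_AE_space) (auto simp: emeasure_space_1)
  then show ?thesis by simp
qed

text \<open>Jensen's inequality, from the tangent of \<open>exp\<close> at the mean.\<close>

lemma exp_integral_le:
  assumes "integrable M u" "integrable M (\<lambda>z. exp (u z :: real))"
  shows "exp (\<integral>z. u z \<partial>M) \<le> (\<integral>z. exp (u z) \<partial>M)"
proof -
  define m where "m = (\<integral>z. u z \<partial>M)"
  have "(\<integral>z. exp m * (1 + (u z - m)) \<partial>M) \<le> (\<integral>z. exp (u z) \<partial>M)"
  proof (rule integral_mono)
    fix z
    have "exp m * (1 + (u z - m)) \<le> exp m * exp (u z - m)"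
      by (intro mult_left_mono exp_ge_add_one_self) auto
    then show "exp m * (1 + (u z - m)) \<le> exp (u z)" by (simp flip: exp_add)
  qed (use assms in auto)
  moreover have "(\<integral>z. exp m * (1 + (u z - m)) \<partial>M) = exp m"
    using assms by (simp add: m_def prob_space)
  ultimately show ?thesis by (simp add: m_def)
qed

lemma integral_le_lmean:
  assumes "c > 0" "integrable M u" "integrable M (\<lambda>z. exp (c * u z))"
  shows "(\<integral>z. u z \<partial>M) \<le> lmean c M u"
proof -
  have "exp (c * (\<integral>z. u z \<partial>M)) \<le> (\<integral>z. exp (c * u z) \<partial>M)"
    using exp_integral_le[of "\<lambda>z. c * u z"] assms by simp
  then have "c * (\<integral>z. u z \<partial>M) \<le> ln (\<integral>z. exp (c * u z) \<partial>M)"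
    by (meson exp_gt_zero less_le_trans ln_ge_iff)
  then show ?thesis using assms(1) by (simp add: lmean_def field_simps)
qed

lemma exp_lmean:
  assumes "c \<noteq> 0" "integrable M (\<lambda>z. exp (c * u z))"
  shows "exp (c * lmean c M u) = (\<integral>z. exp (c * u z) \<partial>M)"
  using assms integral_exp_pos[OF assms(2)] by (simp add: lmean_def)

lemma lmean_le_iff:
  assumes "c > 0" "integrable M (\<lambda>z. exp (c * u z))"
  shows "lmean c M u \<le> b \<longleftrightarrow> (\<integral>z. exp (c * u z) \<partial>M) \<le> exp (c * b)"
  using assms by (simp flip: exp_lmean)

lemma lmean_mono_fun:
  assumes "c \<ge> 0" "integrable M (\<lambda>z. exp (c * u z))" "integrable M (\<lambda>z. exp (c * v z))"
    "c = 0 \<Longrightarrow> integrable M u" "c = 0 \<Longrightarrow> integrable M v" "\<And>z. u z \<le> v z"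
  shows "lmean c M u \<le> lmean c M v"
proof (cases "c = 0")
  case True
  then show ?thesis using assms by (auto simp: lmean_def intro!: integral_mono)
next
  case False
  then show ?thesis using assms by (auto simp: lmean_le_iff exp_lmean intro!: integral_mono)
qed

lemma lmean_add_const:
  assumes "integrable M (\<lambda>z. exp (c * u z))" "c = 0 \<Longrightarrow> integrable M u"
  shows "lmean c M (\<lambda>z. u z + b) = lmean c M u + b"
proof (cases "c = 0")
  case False
  have "lmean c M (\<lambda>z. u z + b) = 1 / c * ln ((\<integral>z. exp (c * u z) \<partial>M) * exp (c * b))"
    using False by (simp add: lmean_def distrib_left exp_add)
  also have "\<dots> = lmean c M u + b"
    using False integral_exp_pos[OF assms(1)] by (simp add: lmean_def ln_mult field_simps)
  finally show ?thesis .
qed (use assms in \<open>simp add: lmean_def prob_space\<close>)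

text \<open>Hoelder's inequality. Dividing the exponentials at \<open>x\<close> and \<open>y\<close>
  by their means \<open>exp (c * a)\<close> and \<open>exp (c * b)\<close> reduces it to convexity
  of \<open>exp\<close>, because the normalised integrals are 1.\<close>

lemma lmean_convex:
  assumes c: "c > 0" and cvx: "\<And>z. convex_on UNIV (\<lambda>x. F x z)"
    and int: "\<And>x::real. integrable M (\<lambda>z. exp (c * F x z))"
  shows "convex_on UNIV (\<lambda>x. lmean c M (F x))"
proof (rule convex_onI)
  fix t x y :: real
  assume t: "0 < t" "t < 1"
  define w where "w = (1 - t) *\<^sub>R x + t *\<^sub>R y"
  define a b where "a = lmean c M (F x)" and "b = lmean c M (F y)"
  define B where "B = exp (c * ((1 - t) * a + t * b))"
  have A: "(\<integral>z. exp (c * F x z) \<partial>M) = exp (c * a)" "(\<integral>z. exp (c * F y z) \<partial>M) = exp (c * b)"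
    using c int by (simp_all add: a_def b_def exp_lmean)
  have "(\<integral>z. exp (c * F w z) \<partial>M) \<le>
      (\<integral>z. B * ((1 - t) * (exp (c * F x z) / exp (c * a)) + t * (exp (c * F y z) / exp (c * b))) \<partial>M)"
  proof (rule integral_mono)
    fix z
    have "F w z \<le> (1 - t) * F x z + t * F y z"
      using convex_onD[OF cvx[of z], of t x y] t by (simp add: w_def)
    then have "exp (c * F w z) \<le> exp (c * ((1 - t) * F x z + t * F y z))"
      using c by simp
    also have "\<dots> = B * exp ((1 - t) *\<^sub>R (c * F x z - c * a) + t *\<^sub>R (c * F y z - c * b))"
      by (simp add: B_def algebra_simps flip: exp_add)
    also have "\<dots> \<le> B * ((1 - t) * exp (c * F x z - c * a) + t * exp (c * F y z - c * b))"
      using convex_onD[OF exp_convex, of t "c * F x z - c * a" "c * F y z - c * b"] t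
      by (intro mult_left_mono) (auto simp: B_def)
    finally show "exp (c * F w z) \<le> B * ((1 - t) * (exp (c * F x z) / exp (c * a)) + t * (exp (c * F y z) / exp (c * b)))"
      by (simp add: exp_diff)
  qed (use int in auto)
  also have "\<dots> = B"
    using int by (simp add: A)
  finally show "lmean c M (F ((1 - t) *\<^sub>R x + t *\<^sub>R y)) \<le> (1 - t) * lmean c M (F x) + t * lmean c M (F y)"
    using c int by (simp add: lmean_le_iff B_def a_def b_def w_def)
qed auto

text \<open>Being monotone and commuting with additive constants, an exponential mean does not
  expand the sup norm.\<close>

lemma lmean_lipschitz:
  assumes c: "c \<ge> 0" and lip: "\<And>x y z. \<bar>F x z - F y z\<bar> \<le> L * \<bar>x - y\<bar>"
    and int: "\<And>x::real. integrable M (\<lambda>z. exp (c * F x z))"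
    and int0: "\<And>x. c = 0 \<Longrightarrow> integrable M (F x)"
  shows "\<bar>lmean c M (F x) - lmean c M (F y)\<bar> \<le> L * \<bar>x - y\<bar>"
proof -
  have "lmean c M (F x) \<le> lmean c M (F y) + L * \<bar>x - y\<bar>" for x y
  proof -
    have "integrable M (\<lambda>z. exp (c * F y z) * exp (c * (L * \<bar>x - y\<bar>)))"
      using int by simp
    then have "integrable M (\<lambda>z. exp (c * (F y z + L * \<bar>x - y\<bar>)))"
      by (simp add: distrib_left exp_add)
    moreover have "F x z \<le> F y z + L * \<bar>x - y\<bar>" for z
      using lip[of x z y] by linarith
    ultimately have "lmean c M (F x) \<le> lmean c M (\<lambda>z. F y z + L * \<bar>x - y\<bar>)"
      using c int int0 by (intro lmean_mono_fun) auto
    then show ?thesis using c int int0 by (simp add: lmean_add_const)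
  qed
  from this[of x y] this[of y x] show ?thesis by (simp add: abs_minus_commute)
qed

text \<open>The second derivative in \<open>x\<close> of an exponential mean is the tilted mean of
  the second derivative of \<open>F\<close> plus \<open>c\<close> times the tilted variance of the
  first, which is at most \<open>L\<^sup>2\<close>. The factor 2 is the price of working with finite
  differences.\<close>

lemma lmean_semiconcave:
  assumes c: "c > 0" and lip: "\<And>x y z. \<bar>F x z - F y z\<bar> \<le> L * \<bar>x - y\<bar>"
    and semi: "\<And>x s z. F (x + s) z + F (x - s) z - 2 * F x z \<le> K * s\<^sup>2"
    and int: "\<And>x::real. integrable M (\<lambda>z. exp (c * F x z))"
  shows "lmean c M (F (x + s)) + lmean c M (F (x - s)) - 2 * lmean c M (F x) \<le> (K + 2 * c * L\<^sup>2) * s\<^sup>2"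
proof -
  define A where "A = (\<integral>z. exp (c * F x z) \<partial>M)"
  define Ap where "Ap = (\<integral>z. exp (c * F (x + s) z) \<partial>M)"
  define Am where "Am = (\<integral>z. exp (c * F (x - s) z) \<partial>M)"
  define X where "X z = F (x + s) z - F x z" for z
  define b where "b = c\<^sup>2 * L\<^sup>2 * s\<^sup>2"
  \<comment> \<open>\<open>c\<close> times the mean of the first difference under the law tilted by
    \<open>exp (c * F x z)\<close>.\<close>
  define \<theta> where "\<theta> = (\<integral>z. exp (c * F x z) * (c * X z) \<partial>M) / A"
  have pos: "A > 0" "Ap > 0" "Am > 0"
    using int by (auto simp: A_def Ap_def Am_def intro!: integral_exp_pos)
  have Xb: "(c * X z)\<^sup>2 \<le> b" for z
  proof -
    have "\<bar>X z\<bar> \<le> L * \<bar>s\<bar>" using lip[of "x+s" z x] by (simp add: X_def)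
    then have "\<bar>X z\<bar>\<^sup>2 \<le> (L * \<bar>s\<bar>)\<^sup>2" by (intro power_mono) auto
    then show ?thesis
      using c by (simp add: b_def power_mult_distrib mult.assoc)
  qed
  \<comment> \<open>Measurability of the difference is recovered from the integrable exponentials by
    taking logarithms.\<close>
  have mX: "(\<lambda>z. c * X z) \<in> borel_measurable M"
  proof -
    have "(\<lambda>z. ln (exp (c * F y z))) \<in> borel_measurable M" for y
      using borel_measurable_integrable[OF int[of y]] by (intro borel_measurable_ln)
    then show ?thesis by (simp add: X_def right_diff_distrib)
  qed
  have intX: "integrable M (\<lambda>z. exp (c * F x z) * (c * X z))"
  proof (rule Bochner_Integration.integrable_bound)
    show "integrable M (\<lambda>z. exp (c * F x z) * (1 + b))"
      using int by simp
    show "AE z in M. norm (exp (c * F x z) * (c * X z)) \<le> norm (exp (c * F x z) * (1 + b))"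
    proof (intro AE_I2)
      fix z
      have "\<bar>c * X z\<bar> \<le> 1 + (c * X z)\<^sup>2"
        using sum_squares_bound[of 1 "\<bar>c * X z\<bar>"] by simp
      then show "norm (exp (c * F x z) * (c * X z)) \<le> norm (exp (c * F x z) * (1 + b))"
        using Xb[of z] by (simp add: abs_mult)
    qed
  qed (use int mX in auto)
  have eq: "(\<integral>z. exp (c * F x z) * (c * X z) \<partial>M) = A * \<theta>"
    using pos by (simp add: \<theta>_def)
  have 1: "Ap \<le> A * (exp b + \<theta>)"
  proof -
    have "Ap \<le> (\<integral>z. exp (c * F x z) * (c * X z) + exp (c * F x z) * exp b \<partial>M)"
      unfolding Ap_def
    proof (rule integral_mono)
      fix z
      have "exp (c * F (x + s) z) = exp (c * F x z) * exp (c * X z)"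
        by (simp add: X_def algebra_simps flip: exp_add)
      also have "\<dots> \<le> exp (c * F x z) * (c * X z + exp b)"
        using exp_le_add_exp_sq[of "c * X z"] Xb[of z]
        by (intro mult_left_mono) (auto intro: order_trans)
      finally show "exp (c * F (x + s) z) \<le> exp (c * F x z) * (c * X z) + exp (c * F x z) * exp b"
        by (simp add: distrib_left)
    qed (use int intX in auto)
    also have "\<dots> = A * (exp b + \<theta>)"
      using int intX by (simp add: eq flip: A_def) (simp add: algebra_simps)
    finally show ?thesis .
  qed
  have 2: "Am \<le> exp (c * K * s\<^sup>2) * (A * (exp b - \<theta>))"
  proof -
    have "Am \<le> (\<integral>z. exp (c * K * s\<^sup>2) * (exp (c * F x z) * exp b - exp (c * F x z) * (c * X z)) \<partial>M)"
      unfolding Am_def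
    proof (rule integral_mono)
      fix z
      have "F (x - s) z \<le> K * s\<^sup>2 + F x z - X z"
        using semi[of x s z] by (simp add: X_def)
      then have "exp (c * F (x - s) z) \<le> exp (c * (K * s\<^sup>2 + F x z - X z))"
        using c by simp
      also have "\<dots> = exp (c * K * s\<^sup>2) * (exp (c * F x z) * exp (- (c * X z)))"
        by (simp add: algebra_simps flip: exp_add)
      also have "\<dots> \<le> exp (c * K * s\<^sup>2) * (exp (c * F x z) * (exp b - c * X z))"
        using exp_le_add_exp_sq[of "- (c * X z)"] Xb[of z]
        by (intro mult_left_mono) (auto intro: order_trans)
      finally show "exp (c * F (x - s) z) \<le> exp (c * K * s\<^sup>2) * (exp (c * F x z) * exp b - exp (c * F x z) * (c * X z))"
        by (simp add: right_diff_distrib)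
    qed (use int intX in auto)
    also have "\<dots> = exp (c * K * s\<^sup>2) * (A * (exp b - \<theta>))"
      using int intX by (simp add: eq flip: A_def) (simp add: algebra_simps)
    finally show ?thesis .
  qed
  have "Ap * Am \<le> (A * (exp b + \<theta>)) * (exp (c * K * s\<^sup>2) * (A * (exp b - \<theta>)))"
    using 1 2 pos by (intro mult_mono) auto
  also have "\<dots> = A\<^sup>2 * exp (c * K * s\<^sup>2) * ((exp b)\<^sup>2 - \<theta>\<^sup>2)"
    by (simp add: power2_eq_square algebra_simps)
  also have "\<dots> \<le> A\<^sup>2 * exp (c * K * s\<^sup>2) * (exp b)\<^sup>2"
    by (intro mult_left_mono) auto
  also have "\<dots> = A\<^sup>2 * exp (c * K * s\<^sup>2 + 2 * b)"
    by (simp add: exp_add mult.assoc flip: exp_double)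
  finally have "ln (Ap * Am) \<le> ln (A\<^sup>2 * exp (c * K * s\<^sup>2 + 2 * b))"
    using pos by (subst ln_le_cancel_iff) auto
  then have "ln Ap + ln Am \<le> 2 * ln A + (c * K * s\<^sup>2 + 2 * b)"
    using pos by (simp add: ln_mult ln_realpow)
  then have "(ln Ap + ln Am - 2 * ln A) / c \<le> (c * K * s\<^sup>2 + 2 * b) / c"
    using c by (intro divide_right_mono) auto
  also have "\<dots> = (K + 2 * c * L\<^sup>2) * s\<^sup>2"
    using c by (simp add: b_def field_simps power2_eq_square)
  finally show ?thesis
    using c by (simp add: lmean_def Ap_def Am_def A_def diff_divide_distrib add_divide_distrib)
qed

end

section \<open>Gaussian exponential means\<close>

abbreviation gauss :: "real measure" where
  "gauss \<equiv> density lborel (\<lambda>g. ennreal (std_normal_density g))"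

interpretation gauss: prob_space gauss
  by (rule prob_space_normal_density) simp

lemma measure_gauss_UNIV [simp]: "measure gauss UNIV = 1"
  using gauss.prob_space by simp

text \<open>The Cameron-Martin formula: completing the square turns an exponential weight into a
  translation.\<close>

lemma
  fixes \<phi> :: "real \<Rightarrow> real"
  assumes [measurable]: "\<phi> \<in> borel_measurable borel"
  shows integrable_gauss_shift:
      "integrable gauss (\<lambda>g. exp (b * g) * \<phi> g) \<longleftrightarrow> integrable gauss (\<lambda>g. \<phi> (g + b))"
    and integral_gauss_shift:
      "(\<integral>g. exp (b * g) * \<phi> g \<partial>gauss) = exp (b\<^sup>2 / 2) * (\<integral>g. \<phi> (g + b) \<partial>gauss)"
proof -
  have eq: "std_normal_density (b + g) * (exp (b * (b + g)) * \<phi> (b + g)) =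
      exp (b\<^sup>2 / 2) * (std_normal_density g * \<phi> (g + b))" for g
  proof -
    have "exp (- (b + g)\<^sup>2 / 2) * exp (b * (b + g)) = exp (b\<^sup>2 / 2) * exp (- g\<^sup>2 / 2)"
      by (simp flip: exp_add) (simp add: power2_eq_square field_simps)
    then show ?thesis
      by (simp add: std_normal_density_def add.commute[of g b] mult.assoc[symmetric])
  qed
  show "integrable gauss (\<lambda>g. exp (b * g) * \<phi> g) \<longleftrightarrow> integrable gauss (\<lambda>g. \<phi> (g + b))"
    using lborel_integrable_real_affine_iff[of 1 "\<lambda>g. std_normal_density g * (exp (b * g) * \<phi> g)" b]
    by (simp add: integrable_density eq)
  show "(\<integral>g. exp (b * g) * \<phi> g \<partial>gauss) = exp (b\<^sup>2 / 2) * (\<integral>g. \<phi> (g + b) \<partial>gauss)"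
    using lborel_integral_real_affine[of 1 "\<lambda>g. std_normal_density g * (exp (b * g) * \<phi> g)" b]
    by (simp add: integral_density eq)
qed

lemma integrable_gauss_exp: "integrable gauss (\<lambda>g. exp (b * g))"
  using integrable_gauss_shift[of "\<lambda>_. 1" b] by simp

lemma integrable_gauss_exp_abs: "integrable gauss (\<lambda>g. exp (b * \<bar>g\<bar>))"
proof (rule Bochner_Integration.integrable_bound)
  show "integrable gauss (\<lambda>g. exp (b * g) + exp (- b * g))"
    by (intro Bochner_Integration.integrable_add integrable_gauss_exp)
  show "AE g in gauss. norm (exp (b * \<bar>g\<bar>)) \<le> norm (exp (b * g) + exp (- b * g))"
    using exp_ge_zero[of "b * _"] exp_ge_zero[of "- b * _"]
    by (intro AE_I2, subst (2) real_norm_def, subst abs_of_nonneg) (auto simp: abs_if)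
qed auto

definition lipschitz :: "real \<Rightarrow> (real \<Rightarrow> real) \<Rightarrow> bool" where
  "lipschitz L f \<longleftrightarrow> (\<forall>x y. \<bar>f x - f y\<bar> \<le> L * \<bar>x - y\<bar>)"

lemma lipschitzD: "lipschitz L f \<Longrightarrow> \<bar>f x - f y\<bar> \<le> L * \<bar>x - y\<bar>"
  by (simp add: lipschitz_def)

lemma lipschitz_nonneg: "lipschitz L f \<Longrightarrow> 0 \<le> L"
  using lipschitzD[of L f 1 0] by simp

lemma lipschitz_measurable [measurable_dest]:
  assumes "lipschitz L f"
  shows "f \<in> borel_measurable borel"
proof -
  have "L-lipschitz_on UNIV f"
    using assms lipschitz_nonneg[OF assms]
    by (auto simp: lipschitz_on_def lipschitz_def dist_real_def)
  then show ?thesis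
    by (intro borel_measurable_continuous_onI lipschitz_on_continuous_on)
qed

lemma lipschitz_integrable_exp:
  assumes f: "lipschitz L f"
  shows "integrable gauss (\<lambda>g. exp (c * f (x + s * g)))"
proof (rule Bochner_Integration.integrable_bound)
  note [measurable] = lipschitz_measurable[OF f]
  show "integrable gauss (\<lambda>g. exp (\<bar>c\<bar> * \<bar>f x\<bar>) * exp (\<bar>c\<bar> * L * \<bar>s\<bar> * \<bar>g\<bar>))"
    by (intro integrable_mult_right integrable_gauss_exp_abs)
  show "AE g in gauss. norm (exp (c * f (x + s * g)))
      \<le> norm (exp (\<bar>c\<bar> * \<bar>f x\<bar>) * exp (\<bar>c\<bar> * L * \<bar>s\<bar> * \<bar>g\<bar>))"
  proof (intro AE_I2)
    fix g
    have "\<bar>f (x + s * g)\<bar> \<le> \<bar>f x\<bar> + L * \<bar>s * g\<bar>"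
      using lipschitzD[OF f, of "x + s * g" x] by simp
    then have "\<bar>c * f (x + s * g)\<bar> \<le> \<bar>c\<bar> * (\<bar>f x\<bar> + L * \<bar>s * g\<bar>)"
      by (simp add: abs_mult mult_left_mono)
    then have "c * f (x + s * g) \<le> \<bar>c\<bar> * (\<bar>f x\<bar> + L * \<bar>s * g\<bar>)"
      by linarith
    then have "c * f (x + s * g) \<le> \<bar>c\<bar> * \<bar>f x\<bar> + \<bar>c\<bar> * L * \<bar>s\<bar> * \<bar>g\<bar>"
      by (simp add: abs_mult algebra_simps)
    then show "norm (exp (c * f (x + s * g))) \<le> norm (exp (\<bar>c\<bar> * \<bar>f x\<bar>) * exp (\<bar>c\<bar> * L * \<bar>s\<bar> * \<bar>g\<bar>))"
      by (simp flip: exp_add)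
  qed
  show "(\<lambda>g. exp (c * f (x + s * g))) \<in> borel_measurable gauss" by measurable
qed

lemma lipschitz_integrable:
  assumes f: "lipschitz L f"
  shows "integrable gauss (\<lambda>g. f (x + s * g))"
proof (rule Bochner_Integration.integrable_bound)
  note [measurable] = lipschitz_measurable[OF f]
  show "integrable gauss (\<lambda>g. exp (f (x + s * g)) + exp (- f (x + s * g)))"
    using lipschitz_integrable_exp[OF f, of 1] lipschitz_integrable_exp[OF f, of "- 1"] by simp
  show "AE g in gauss. norm (f (x + s * g)) \<le> norm (exp (f (x + s * g)) + exp (- f (x + s * g)))"
  proof (intro AE_I2)
    fix g
    have "f (x + s * g) \<le> exp (f (x + s * g))" "- f (x + s * g) \<le> exp (- f (x + s * g))"
      using exp_ge_add_one_self[of "f (x + s * g)"] exp_ge_add_one_self[of "- f (x + s * g)"] by linarith+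
    then show "norm (f (x + s * g)) \<le> norm (exp (f (x + s * g)) + exp (- f (x + s * g)))"
      using exp_ge_zero[of "f (x + s * g)"] exp_ge_zero[of "- f (x + s * g)"]
      unfolding real_norm_def by linarith
  qed
  show "(\<lambda>g. f (x + s * g)) \<in> borel_measurable gauss" by measurable
qed

text \<open>The parameter is the standard deviation, and a standard Gaussian is scaled by it, so
  that \<open>s = 0\<close> gives the identity.\<close>

definition gmean :: "real \<Rightarrow> real \<Rightarrow> (real \<Rightarrow> real) \<Rightarrow> real \<Rightarrow> real" where
  "gmean c s f x = lmean c gauss (\<lambda>g. f (x + s * g))"

lemma gmean_lipschitz:
  assumes "c \<ge> 0" "lipschitz L f"
  shows "lipschitz L (gmean c s f)"
  unfolding lipschitz_def gmean_def
proof (intro allI gauss.lmean_lipschitz)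
  fix x y z show "\<bar>f (x + s * z) - f (y + s * z)\<bar> \<le> L * \<bar>x - y\<bar>"
    using lipschitzD[OF assms(2), of "x + s * z" "y + s * z"] by simp
qed (use assms in \<open>auto intro: lipschitz_integrable lipschitz_integrable_exp\<close>)

lemma gmean_zero: "gmean c 0 f x = f x"
  by (simp add: gmean_def lmean_def)

text \<open>Strict positivity lets both laws be written with \<open>normal_density\<close>, which is
  identically 0 at standard deviation 0; the degenerate cases return in
  \<open>gmean_gmean\<close>.\<close>

lemma distr_gauss_pair:
  assumes "s > 0" "t > 0"
  shows "distr (gauss \<Otimes>\<^sub>M gauss) borel (\<lambda>(g, g'). s * g + t * g') =
    distr gauss borel (\<lambda>g. sqrt (s\<^sup>2 + t\<^sup>2) * g)"
proof -
  have scale: "distr gauss borel (\<lambda>g. r * g) = density lborel (normal_density 0 r)" if "r > 0" for r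
  proof -
    have "distributed gauss lborel (\<lambda>g. 0 + r * g) (normal_density (0 + r * 0) (\<bar>r\<bar> * 1))"
      using that by (intro gauss.normal_density_affine) (auto simp: distributed_def distr_id2)
    then have "distr gauss lborel (\<lambda>g. r * g) = density lborel (normal_density 0 r)"
      using that by (simp add: distributed_def)
    then show ?thesis by (simp cong: distr_cong)
  qed
  have fin: "finite_measure (density lborel (normal_density 0 r))" if "r > 0" for r
    using that prob_space_normal_density[of r 0] by (simp add: prob_space_def)
  have "distr (gauss \<Otimes>\<^sub>M gauss) borel (\<lambda>(g, g'). s * g + t * g') =
      convolution (distr gauss borel (\<lambda>g. s * g)) (distr gauss borel (\<lambda>g. t * g))"
  proof -
    have "sigma_finite_measure (distr gauss borel (\<lambda>g. t * g))"
      using scale fin assms by (auto intro!: finite_measure.sigma_finite_measure)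
    then show ?thesis
      unfolding convolution_def
      by (subst pair_measure_distr) (auto simp: distr_distr comp_def split_beta')
  qed
  also have "\<dots> = density lborel (\<lambda>x. \<integral>\<^sup>+y. ennreal (normal_density 0 s (x - y)) * ennreal (normal_density 0 t y) \<partial>lborel)"
    using fin assms by (simp add: scale convolution_density)
  also have "\<dots> = density lborel (normal_density 0 (sqrt (s\<^sup>2 + t\<^sup>2)))"
    using conv_normal_density_zero_mean[OF assms]
    by (simp add: ennreal_mult fun_eq_iff)
  also have "\<dots> = distr gauss borel (\<lambda>g. sqrt (s\<^sup>2 + t\<^sup>2) * g)"
    using assms by (simp add: scale sum_power2_gt_zero_iff)
  finally show ?thesis .
qed

text \<open>The semigroup property in the variance. Exponentiating cancels the logarithm of the
  inner mean, and Fubini leaves one integral over a sum of two independent Gaussians.\<close>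

lemma gmean_gmean_pos:
  assumes s: "s > 0" "t > 0" and f: "lipschitz L f"
  shows "gmean c s (gmean c t f) x = gmean c (sqrt (s\<^sup>2 + t\<^sup>2)) f x"
proof -
  interpret P: pair_prob_space gauss gauss ..
  note [measurable] = lipschitz_measurable[OF f]
  have key: "(\<integral>g. \<integral>g'. \<phi> (s * g + t * g') \<partial>gauss \<partial>gauss) = (\<integral>g. \<phi> (sqrt (s\<^sup>2 + t\<^sup>2) * g) \<partial>gauss)"
    if [measurable]: "\<phi> \<in> borel_measurable borel"
      and int: "integrable gauss (\<lambda>g. \<phi> (sqrt (s\<^sup>2 + t\<^sup>2) * g))" for \<phi> :: "real \<Rightarrow> real"
  proof -
    have "integrable (distr gauss borel (\<lambda>g. sqrt (s\<^sup>2 + t\<^sup>2) * g)) \<phi>"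
      using int by (subst integrable_distr_eq) auto
    then have "integrable (gauss \<Otimes>\<^sub>M gauss) (\<lambda>p. \<phi> (case p of (g, g') \<Rightarrow> s * g + t * g'))"
      unfolding distr_gauss_pair[OF s, symmetric] by (subst (asm) integrable_distr_eq) auto
    from P.integral_fst'[OF this]
    have "(\<integral>g. \<integral>g'. \<phi> (s * g + t * g') \<partial>gauss \<partial>gauss) =
        (\<integral>p. \<phi> (case p of (g, g') \<Rightarrow> s * g + t * g') \<partial>(gauss \<Otimes>\<^sub>M gauss))" by simp
    also have "\<dots> = (\<integral>y. \<phi> y \<partial>distr gauss borel (\<lambda>g. sqrt (s\<^sup>2 + t\<^sup>2) * g))"
      unfolding distr_gauss_pair[OF s, symmetric] by (subst integral_distr) auto
    also have "\<dots> = (\<integral>g. \<phi> (sqrt (s\<^sup>2 + t\<^sup>2) * g) \<partial>gauss)"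
      by (subst integral_distr) auto
    finally show ?thesis .
  qed
  show ?thesis
  proof (cases "c = 0")
    case True
    then show ?thesis
      using key[of "\<lambda>y. f (x + y)"] lipschitz_integrable[OF f]
      by (simp add: gmean_def lmean_def add.assoc)
  next
    case False
    have "exp (c * gmean c t f y) = (\<integral>g'. exp (c * f (y + t * g')) \<partial>gauss)" for y
      unfolding gmean_def using False lipschitz_integrable_exp[OF f] by (intro gauss.exp_lmean)
    then show ?thesis
      using key[of "\<lambda>y. exp (c * f (x + y))"] lipschitz_integrable_exp[OF f] False
      unfolding gmean_def[of c s] gmean_def[of c "sqrt _"] by (simp add: lmean_def add.assoc)
  qed
qed

section \<open>Joint convexity of the level map\<close>

lemma gmean_gmean:
  assumes s: "s \<ge> 0" "t \<ge> 0" and f: "lipschitz L f"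
  shows "gmean c s (gmean c t f) = gmean c (sqrt (s\<^sup>2 + t\<^sup>2)) f"
proof -
  have z: "gmean c 0 f = f" for f by (simp add: fun_eq_iff gmean_zero)
  have "gmean c s (gmean c t f) = gmean c (sqrt (s\<^sup>2 + t\<^sup>2)) f" if "s > 0" "t > 0"
    using gmean_gmean_pos[OF that f] by (simp add: fun_eq_iff)
  then show ?thesis
    using s by (cases "s = 0"; cases "t = 0") (simp_all add: z)
qed

lemma integral_gauss_id: "(\<integral>g. g \<partial>gauss) = 0" and integrable_gauss_id: "integrable gauss (\<lambda>g. g)"
  using normal_moment_nz_1[of 1 0]
  by (simp_all add: has_bochner_integral_iff integral_density integrable_density)

text \<open>The third clause is semiconcavity with constant \<open>K\<close>. Together with convexity it makes the error of one
  small Gaussian step quadratic in the variance, so that the errors of \<open>n\<close> steps of variance \<open>s\<^sup>2 / n\<close> vanish.\<close>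

definition tame :: "real \<Rightarrow> real \<Rightarrow> (real \<Rightarrow> real) \<Rightarrow> bool" where
  "tame L K f \<longleftrightarrow> convex_on UNIV f \<and> lipschitz L f \<and> (\<forall>x s. f (x + s) + f (x - s) - 2 * f x \<le> K * s\<^sup>2)"

text \<open>The new constant does not depend on \<open>s\<close>. All partial compositions of small
  steps are single means by the semigroup property, so they share it; one application per small step
  would let the constant accumulate.\<close>

lemma gmean_tame:
  assumes c: "c > 0" and f: "tame L K f"
  shows "tame L (K + 2 * c * L\<^sup>2) (gmean c s f)"
proof -
  have lip: "lipschitz L f" and semi: "f (x + s) + f (x - s) - 2 * f x \<le> K * s\<^sup>2" for x s
    using f by (auto simp: tame_def)
  have cvx: "convex_on UNIV f" using f by (simp add: tame_def)
  note int = lipschitz_integrable_exp[OF lip]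
  have "convex_on UNIV (gmean c s f)"
    unfolding gmean_def
  proof (intro gauss.lmean_convex c int convex_onI)
    fix t x y z :: real assume t: "0 < t" "t < 1"
    have "(1 - t) *\<^sub>R (x + s * z) + t *\<^sub>R (y + s * z) = (1 - t) *\<^sub>R x + t *\<^sub>R y + s * z"
      by (simp add: algebra_simps)
    then show "f ((1 - t) *\<^sub>R x + t *\<^sub>R y + s * z) \<le> (1 - t) * f (x + s * z) + t * f (y + s * z)"
      using convex_onD[OF cvx, of t "x + s * z" "y + s * z"] t by simp
  qed auto
  moreover have "lipschitz L (gmean c s f)"
    using c by (intro gmean_lipschitz lip) auto
  moreover have "gmean c s f (x + r) + gmean c s f (x - r) - 2 * gmean c s f x \<le> (K + 2 * c * L\<^sup>2) * r\<^sup>2" for x r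
    unfolding gmean_def
  proof (intro gauss.lmean_semiconcave c int)
    show "\<bar>f (x + s * z) - f (y + s * z)\<bar> \<le> L * \<bar>x - y\<bar>" for x y z
      using lipschitzD[OF lip, of "x + s * z" "y + s * z"] by simp
    show "f (x + r + s * z) + f (x - r + s * z) - 2 * f (x + s * z) \<le> K * r\<^sup>2" for x r z
      using semi[of "x + s * z" r] by (simp add: algebra_simps)
  qed
  ultimately show ?thesis by (simp add: tame_def)
qed

section \<open>Matching lower and upper bounds for one short Gaussian step\<close>

lemma convex_subgradient:
  fixes f :: "real \<Rightarrow> real"
  assumes "convex_on UNIV f"
  shows "\<exists>p. \<forall>y. f x + p * (y - x) \<le> f y"
  using convex_le_Inf_differential[OF assms, of x] by auto

lemma integrable_gauss_exp_abs_add: "integrable gauss (\<lambda>g. exp (b * (\<bar>g\<bar> + d)))"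
  using integrable_gauss_exp_abs[of b] by (simp add: distrib_left exp_add)

text \<open>The drift \<open>c * s\<^sup>2 * a\<close> is the discrete analogue of a control in the variational formula for the
  Parisi functional; a subgradient is optimal up to \<open>s ^ 4\<close>.\<close>

lemma gmean_lower:
  assumes c: "c \<ge> 0" and f: "lipschitz L f"
  shows "(\<integral>g. f (x + c * s\<^sup>2 * a + s * g) \<partial>gauss) - c * s\<^sup>2 * a\<^sup>2 / 2 \<le> gmean c s f x"
proof (cases "c = 0")
  case False
  note [measurable] = lipschitz_measurable[OF f]
  \<comment> \<open>The drift in units of \<open>g\<close>: shifting \<open>g\<close> by
    \<open>b\<close> moves the argument of \<open>f\<close> by \<open>c * s\<^sup>2 * a\<close>.
    Jensen's inequality after the shift leaves the penalty \<open>b\<^sup>2 / 2\<close>, which is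
    \<open>c\<close> times the one claimed.\<close>
  define b where "b = c * s * a"
  define u where "u g = c * f (x + c * s\<^sup>2 * a + s * g) - b * g" for g
  have eq: "c * f (x + s * (g + b)) - b * (g + b) = u g - b\<^sup>2" for g
    by (simp add: u_def b_def power2_eq_square algebra_simps)
  have "(\<integral>g. exp (b * g) * exp (c * f (x + s * g) - b * g) \<partial>gauss) = exp (b\<^sup>2 / 2) * (\<integral>g. exp (c * f (x + s * (g + b)) - b * (g + b)) \<partial>gauss)"
    by (intro integral_gauss_shift) measurable
  then have e: "(\<integral>g. exp (c * f (x + s * g)) \<partial>gauss) = exp (b\<^sup>2 / 2) * (\<integral>g. exp (u g - b\<^sup>2) \<partial>gauss)"
    unfolding eq by (simp flip: exp_add)
  have "integrable gauss (\<lambda>g. exp (b * g) * exp (c * f (x + s * g) - b * g)) \<longleftrightarrow>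
      integrable gauss (\<lambda>g. exp (c * f (x + s * (g + b)) - b * (g + b)))"
    by (intro integrable_gauss_shift) measurable
  then have i: "integrable gauss (\<lambda>g. exp (u g - b\<^sup>2))"
    unfolding eq using lipschitz_integrable_exp[OF f] by (simp flip: exp_add)
  have iu: "integrable gauss (\<lambda>g. u g - b\<^sup>2)"
    unfolding u_def using lipschitz_integrable[OF f] integrable_gauss_id by auto
  have "exp (b\<^sup>2 / 2) * exp (\<integral>g. u g - b\<^sup>2 \<partial>gauss) \<le> (\<integral>g. exp (c * f (x + s * g)) \<partial>gauss)"
    unfolding e by (intro mult_left_mono gauss.exp_integral_le i iu) auto
  then have "b\<^sup>2 / 2 + (\<integral>g. u g - b\<^sup>2 \<partial>gauss) \<le> ln (\<integral>g. exp (c * f (x + s * g)) \<partial>gauss)"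
    using gauss.integral_exp_pos[OF lipschitz_integrable_exp[OF f], of c x s]
    by (subst ln_ge_iff) (simp_all add: exp_add)
  moreover have "(\<integral>g. u g - b\<^sup>2 \<partial>gauss) = c * (\<integral>g. f (x + c * s\<^sup>2 * a + s * g) \<partial>gauss) - b\<^sup>2"
    unfolding u_def using lipschitz_integrable[OF f] integrable_gauss_id by (simp add: integral_gauss_id)
  ultimately have "c * (\<integral>g. f (x + c * s\<^sup>2 * a + s * g) \<partial>gauss) - b\<^sup>2 / 2 \<le> ln (\<integral>g. exp (c * f (x + s * g)) \<partial>gauss)"
    by simp
  then have "(c * (\<integral>g. f (x + c * s\<^sup>2 * a + s * g) \<partial>gauss) - b\<^sup>2 / 2) / c \<le> ln (\<integral>g. exp (c * f (x + s * g)) \<partial>gauss) / c"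
    using c by (intro divide_right_mono)
  then show ?thesis
    using False by (simp add: gmean_def lmean_def b_def diff_divide_distrib power2_eq_square mult_ac)
qed (simp add: gmean_def lmean_def)

lemma exp_le_quadratic:
  fixes u :: real
  assumes "u \<ge> 0"
  shows "exp u \<le> 1 + u + u\<^sup>2 * exp u"
proof -
  have "(1 + u) * (1 - u) * exp u \<le> (1 + u) * exp (- u) * exp u"
    using exp_ge_add_one_self[of "- u"] assms by (intro mult_right_mono mult_left_mono) auto
  also have "\<dots> = 1 + u" by (simp flip: exp_add add: mult.assoc)
  finally show ?thesis by (simp add: algebra_simps power2_eq_square)
qed

lemma power4_le_exp:
  fixes w :: real
  assumes "w \<ge> 0"
  shows "w ^ 4 \<le> 256 * exp w"
proof -
  have "(w / 4) ^ 4 \<le> exp (w / 4) ^ 4"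
    using exp_ge_add_one_self[of "w / 4"] assms by (intro power_mono) linarith+
  then show ?thesis by (simp add: power_divide flip: exp_of_nat_mult)
qed

text \<open>The factor 256 comes from \<open>power4_le_exp\<close> and \<open>K\<^sup>2\<close> from
  squaring the quadratic bound on the remainder after the tangent. The integral collects the
  exponential from that lemma and the exponential of the remainder, with \<open>c * L\<close>
  bounding the shift of \<open>g\<close>. Neither the point nor the step length enters.\<close>

definition step_error :: "real \<Rightarrow> real \<Rightarrow> real \<Rightarrow> real" where
  "step_error c L K = c * (256 * K\<^sup>2 * (\<integral>g. exp ((2 * c * L + 1) * (\<bar>g\<bar> + c * L)) \<partial>gauss))"

text \<open>The tangent at \<open>x\<close> is split off and absorbed by a Cameron-Martin shift.
  What is left lies between 0 and \<open>K * y\<^sup>2\<close>, so the logarithm of its exponential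
  mean exceeds the linear term only at second order, that is by order \<open>s ^ 4\<close>.\<close>

lemma gmean_upper:
  assumes c: "c > 0" and f: "tame L K f" and s: "0 \<le> s" "s \<le> 1"
  obtains a where "gmean c s f x \<le> (\<integral>g. f (x + c * s\<^sup>2 * a + s * g) \<partial>gauss) - c * s\<^sup>2 * a\<^sup>2 / 2 + step_error c L K * s ^ 4"
proof -
  have cvx: "convex_on UNIV f" and lip: "lipschitz L f"
    and semi: "\<And>x s. f (x + s) + f (x - s) - 2 * f x \<le> K * s\<^sup>2"
    using f by (auto simp: tame_def)
  have L: "L \<ge> 0" by (rule lipschitz_nonneg[OF lip])
  obtain a where a: "\<And>y. f x + a * (y - x) \<le> f y"
    using convex_subgradient[OF cvx, of x] by blast
  have aL: "\<bar>a\<bar> \<le> L"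
    using a[of "x + 1"] a[of "x - 1"] lipschitzD[OF lip, of "x + 1" x] lipschitzD[OF lip, of "x - 1" x]
    by (simp add: abs_if split: if_splits)
  define b where "b = c * s * a"
  define r where "r y = f (x + y) - f x - a * y" for y
  have r0: "0 \<le> r y" for y using a[of "x + y"] by (simp add: r_def)
  \<comment> \<open>Semiconcavity bounds \<open>r y + r (- y)\<close>, and \<open>r (- y)\<close> is
    nonnegative.\<close>
  have rK: "r y \<le> K * y\<^sup>2" for y
    using r0[of "- y"] semi[of x y] by (simp add: r_def)
  have rlip: "lipschitz (2 * L) r"
    unfolding lipschitz_def
  proof (intro allI)
    fix y z
    have "r y - r z = (f (x + y) - f (x + z)) - a * (y - z)" by (simp add: r_def algebra_simps)
    moreover have "\<bar>a * (y - z)\<bar> \<le> L * \<bar>y - z\<bar>" using aL by (simp add: abs_mult mult_right_mono)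
    moreover have "\<bar>f (x + y) - f (x + z)\<bar> \<le> L * \<bar>y - z\<bar>"
      using lipschitzD[OF lip, of "x + y" "x + z"] by simp
    moreover have "2 * L * \<bar>y - z\<bar> = L * \<bar>y - z\<bar> + L * \<bar>y - z\<bar>" by simp
    ultimately show "\<bar>r y - r z\<bar> \<le> 2 * L * \<bar>y - z\<bar>"
      by linarith
  qed
  have rL: "r y \<le> 2 * L * \<bar>y\<bar>" for y
    using lipschitzD[OF rlip, of y 0] by (simp add: r_def)
  note [measurable] = lipschitz_measurable[OF rlip]
  define R where "R g = r (s * b + s * g)" for g
  have R0: "0 \<le> R g" for g by (simp add: R_def r0)
  have intR: "integrable gauss R" and inteR: "integrable gauss (\<lambda>g. exp (c * R g))"
    unfolding R_def using lipschitz_integrable[OF rlip] lipschitz_integrable_exp[OF rlip] by auto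
  define h where "h g = exp ((2 * c * L + 1) * (\<bar>g\<bar> + c * L))" for g :: real
  have inth: "integrable gauss h" unfolding h_def by (rule integrable_gauss_exp_abs_add)
  have "(\<integral>g. exp (c * R g) \<partial>gauss) \<le> (\<integral>g. 1 + c * R g + c\<^sup>2 * (256 * K\<^sup>2 * s ^ 4 * h g) \<partial>gauss)"
  proof (rule integral_mono)
    fix g
    define w where "w = \<bar>g\<bar> + c * L"
    have w0: "w \<ge> 0" using c L by (simp add: w_def)
    have "\<bar>b\<bar> \<le> c * L"
    proof -
      have "\<bar>b\<bar> = c * (s * \<bar>a\<bar>)" using c s by (simp add: b_def abs_mult)
      also have "\<dots> \<le> c * (1 * L)"
        using c s aL by (intro mult_left_mono mult_mono) auto
      finally show ?thesis by simp
    qed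
    then have yw: "\<bar>s * b + s * g\<bar> \<le> s * w"
      using s by (simp add: w_def abs_mult mult_left_mono flip: distrib_left)
    have "R g \<le> K * \<bar>s * b + s * g\<bar>\<^sup>2" using rK[of "s * b + s * g"] by (simp add: R_def)
    also have "\<dots> \<le> \<bar>K\<bar> * (s * w)\<^sup>2"
      using yw by (intro mult_mono power_mono) auto
    finally have "(R g)\<^sup>2 \<le> (\<bar>K\<bar> * (s * w)\<^sup>2)\<^sup>2"
      using R0 by (intro power_mono)
    also have "\<dots> = K\<^sup>2 * s ^ 4 * w ^ 4"
      by (simp add: power_mult_distrib)
    also have "\<dots> \<le> K\<^sup>2 * s ^ 4 * (256 * exp w)"
      using w0 by (intro mult_left_mono power4_le_exp) auto
    finally have R2: "(R g)\<^sup>2 \<le> 256 * K\<^sup>2 * s ^ 4 * exp w" by (simp add: mult_ac)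
    \<comment> \<open>In the exponent the linear bound replaces the quadratic one, whose exponential
      need not be integrable against the Gaussian.\<close>
    have "R g \<le> 2 * L * (s * w)"
      using rL[of "s * b + s * g"] yw L by (simp add: R_def) (meson mult_left_mono order_trans mult_nonneg_nonneg zero_le_numeral)
    also have "\<dots> \<le> 2 * L * (1 * w)"
      using s w0 L by (intro mult_left_mono mult_right_mono) auto
    finally have "c * R g \<le> c * (2 * L * w)" using c by simp
    then have eR: "exp (c * R g) \<le> exp (2 * c * L * w)" by (simp add: mult_ac)
    have "exp (c * R g) \<le> 1 + c * R g + (c * R g)\<^sup>2 * exp (c * R g)"
      using c R0 by (intro exp_le_quadratic) auto
    also have "(c * R g)\<^sup>2 * exp (c * R g) = c\<^sup>2 * ((R g)\<^sup>2 * exp (c * R g))"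
      by (simp add: power_mult_distrib)
    also have "c\<^sup>2 * ((R g)\<^sup>2 * exp (c * R g)) \<le> c\<^sup>2 * ((256 * K\<^sup>2 * s ^ 4 * exp w) * exp (2 * c * L * w))"
      using R2 eR by (intro mult_left_mono mult_mono) auto
    also have "(256 * K\<^sup>2 * s ^ 4 * exp w) * exp (2 * c * L * w) = 256 * K\<^sup>2 * s ^ 4 * h g"
      by (simp add: h_def w_def algebra_simps flip: exp_add)
    finally show "exp (c * R g) \<le> 1 + c * R g + c\<^sup>2 * (256 * K\<^sup>2 * s ^ 4 * h g)" by simp
  qed (use intR inteR inth in auto)
  also have "\<dots> = 1 + c * (\<integral>g. R g \<partial>gauss) + c\<^sup>2 * (256 * K\<^sup>2 * s ^ 4 * (\<integral>g. h g \<partial>gauss))"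
    using intR inth by simp
  also have "\<dots> = 1 + c * ((\<integral>g. R g \<partial>gauss) + step_error c L K * s ^ 4)"
    by (simp add: step_error_def h_def algebra_simps power2_eq_square)
  finally have ub: "(\<integral>g. exp (c * R g) \<partial>gauss) \<le> 1 + c * ((\<integral>g. R g \<partial>gauss) + step_error c L K * s ^ 4)" .
  have "ln (\<integral>g. exp (c * R g) \<partial>gauss) \<le> (\<integral>g. exp (c * R g) \<partial>gauss) - 1"
    using gauss.integral_exp_pos[OF inteR] by (rule ln_le_minus_one)
  with ub have lnR: "ln (\<integral>g. exp (c * R g) \<partial>gauss) \<le> c * ((\<integral>g. R g \<partial>gauss) + step_error c L K * s ^ 4)"
    by linarith
  have "(\<integral>g. exp (c * f (x + s * g)) \<partial>gauss) = exp (c * f x) * (\<integral>g. exp (b * g) * exp (c * r (s * g)) \<partial>gauss)"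
    by (subst integral_mult_right_zero[symmetric], intro Bochner_Integration.integral_cong)
       (auto simp: r_def b_def algebra_simps simp flip: exp_add)
  also have "(\<integral>g. exp (b * g) * exp (c * r (s * g)) \<partial>gauss) = exp (b\<^sup>2 / 2) * (\<integral>g. exp (c * r (s * (g + b))) \<partial>gauss)"
    by (intro integral_gauss_shift) measurable
  also have "(\<lambda>g. exp (c * r (s * (g + b)))) = (\<lambda>g. exp (c * R g))"
    by (simp add: R_def algebra_simps)
  finally have "ln (\<integral>g. exp (c * f (x + s * g)) \<partial>gauss) = c * f x + b\<^sup>2 / 2 + ln (\<integral>g. exp (c * R g) \<partial>gauss)"
    using gauss.integral_exp_pos[OF inteR] by (simp add: ln_mult)
  with lnR have "c * gmean c s f x \<le> c * f x + b\<^sup>2 / 2 + c * ((\<integral>g. R g \<partial>gauss) + step_error c L K * s ^ 4)"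
    using c by (simp add: gmean_def lmean_def)
  also have "\<dots> = c * (f x + c * s\<^sup>2 * a\<^sup>2 / 2 + (\<integral>g. R g \<partial>gauss) + step_error c L K * s ^ 4)"
    by (simp add: b_def power2_eq_square algebra_simps)
  finally have 1: "gmean c s f x \<le> f x + c * s\<^sup>2 * a\<^sup>2 / 2 + (\<integral>g. R g \<partial>gauss) + step_error c L K * s ^ 4"
    using c by simp
  \<comment> \<open>Along the tangent the drift gains \<open>c * s\<^sup>2 * a\<^sup>2\<close>, and
    the penalty takes back half of it; the other half is the term in the bound just
    obtained.\<close>
  have "(\<integral>g. f (x + c * s\<^sup>2 * a + s * g) \<partial>gauss) = (\<integral>g. f x + c * s\<^sup>2 * a\<^sup>2 + a * s * g + R g \<partial>gauss)"
    by (intro Bochner_Integration.integral_cong) (auto simp: R_def r_def b_def power2_eq_square algebra_simps)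
  also have "\<dots> = f x + c * s\<^sup>2 * a\<^sup>2 + (\<integral>g. R g \<partial>gauss)"
    using intR integrable_gauss_id by (simp add: integral_gauss_id)
  finally have 2: "(\<integral>g. f (x + c * s\<^sup>2 * a + s * g) \<partial>gauss) = f x + c * s\<^sup>2 * a\<^sup>2 + (\<integral>g. R g \<partial>gauss)" .
  show ?thesis
    using 1 by (intro that[of a]) (unfold 2, linarith)
qed

text \<open>The drift that is nearly optimal for \<open>F\<close> serves only as a trial drift for
  \<open>f0\<close> and \<open>f1\<close>. Hence tameness is asked of \<open>F\<close> alone, and
  the right side contributes no error.\<close>

lemma comparison_step:
  assumes t: "0 \<le> t" "t \<le> 1" and c: "c0 \<ge> 0" "c1 \<ge> 0" and c_eq: "c = (1 - t) * c0 + t * c1" "c > 0"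
    and F: "tame L K F" and f: "lipschitz L0 f0" "lipschitz L1 f1" and s: "0 \<le> s" "s \<le> 1"
    and le: "\<And>x y. F ((1 - t) * x + t * y) \<le> (1 - t) * f0 x + t * f1 y + e"
  shows "gmean c s F ((1 - t) * x + t * y) \<le> (1 - t) * gmean c0 s f0 x + t * gmean c1 s f1 y + (e + step_error c L K * s ^ 4)"
proof -
  define w where "w = (1 - t) * x + t * y"
  obtain a where a: "gmean c s F w \<le> (\<integral>g. F (w + c * s\<^sup>2 * a + s * g) \<partial>gauss) - c * s\<^sup>2 * a\<^sup>2 / 2 + step_error c L K * s ^ 4"
    using gmean_upper[OF c_eq(2) F s] .
  have lipF: "lipschitz L F" using F by (simp add: tame_def)
  note int = lipschitz_integrable[OF lipF] lipschitz_integrable[OF f(1)] lipschitz_integrable[OF f(2)]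
  have "(\<integral>g. F (w + c * s\<^sup>2 * a + s * g) \<partial>gauss) \<le>
      (\<integral>g. (1 - t) * f0 (x + c0 * s\<^sup>2 * a + s * g) + t * f1 (y + c1 * s\<^sup>2 * a + s * g) + e \<partial>gauss)"
  proof (rule integral_mono)
    fix g
    show "F (w + c * s\<^sup>2 * a + s * g) \<le> (1 - t) * f0 (x + c0 * s\<^sup>2 * a + s * g) + t * f1 (y + c1 * s\<^sup>2 * a + s * g) + e"
      using le[of "x + c0 * s\<^sup>2 * a + s * g" "y + c1 * s\<^sup>2 * a + s * g"]
      by (simp add: w_def c_eq(1) algebra_simps)
  qed (use int in auto)
  also have "\<dots> = (1 - t) * (\<integral>g. f0 (x + c0 * s\<^sup>2 * a + s * g) \<partial>gauss) + t * (\<integral>g. f1 (y + c1 * s\<^sup>2 * a + s * g) \<partial>gauss) + e"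
    using int by simp
  also have "\<dots> \<le> (1 - t) * (gmean c0 s f0 x + c0 * s\<^sup>2 * a\<^sup>2 / 2) + t * (gmean c1 s f1 y + c1 * s\<^sup>2 * a\<^sup>2 / 2) + e"
    using gmean_lower[OF c(1) f(1), of x s a] gmean_lower[OF c(2) f(2), of y s a] t
    by (intro add_mono mult_left_mono) auto
  also have "\<dots> = (1 - t) * gmean c0 s f0 x + t * gmean c1 s f1 y + e + c * s\<^sup>2 * a\<^sup>2 / 2"
    by (simp add: c_eq(1) field_simps)
  finally show ?thesis using a by (simp add: w_def)
qed

text \<open>With \<open>n\<close> steps of length \<open>w = s / sqrt n\<close> the total error is
  \<open>n * E * w ^ 4 = E * s ^ 4 / n\<close>, which tends to 0.\<close>

lemma comparison_tame:
  assumes t: "0 \<le> t" "t \<le> 1" and c: "c0 \<ge> 0" "c1 \<ge> 0" and c_eq: "c = (1 - t) * c0 + t * c1" "c > 0"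
    and F: "tame L K F" and f: "lipschitz L0 f0" "lipschitz L1 f1" and s: "0 \<le> s"
    and le: "\<And>x y. F ((1 - t) * x + t * y) \<le> (1 - t) * f0 x + t * f1 y"
  shows "gmean c s F ((1 - t) * x + t * y) \<le> (1 - t) * gmean c0 s f0 x + t * gmean c1 s f1 y"
proof -
  have lipF: "lipschitz L F" using F by (simp add: tame_def)
  \<comment> \<open>\<open>K + 2 * c * L\<^sup>2\<close> is a semiconcavity constant for every
    partial composition, whatever its length.\<close>
  define E where "E = step_error c L (K + 2 * c * L\<^sup>2)"
  have iter: "gmean c (w * sqrt (real j)) F ((1 - t) * x + t * y) \<le>
      (1 - t) * gmean c0 (w * sqrt (real j)) f0 x + t * gmean c1 (w * sqrt (real j)) f1 y + real j * (E * w ^ 4)"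
    if w: "0 \<le> w" "w \<le> 1" for w j x y
  proof (induction j arbitrary: x y)
    case 0
    then show ?case by (simp add: gmean_zero le)
  next
    case (Suc j)
    have sq: "sqrt (w\<^sup>2 + (w * sqrt (real j))\<^sup>2) = w * sqrt (real (Suc j))"
    proof -
      have "w\<^sup>2 + (w * sqrt (real j))\<^sup>2 = w\<^sup>2 * real (Suc j)"
        by (simp add: power_mult_distrib algebra_simps)
      then show ?thesis using w by (simp add: real_sqrt_mult)
    qed
    have comp: "gmean c' (w * sqrt (real (Suc j))) f = gmean c' w (gmean c' (w * sqrt (real j)) f)"
      if "lipschitz L' f" for c' L' f
      using gmean_gmean[OF w(1) _ that, of "w * sqrt (real j)" c'] w by (simp add: sq)
    have "gmean c w (gmean c (w * sqrt (real j)) F) ((1 - t) * x + t * y) \<le>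
        (1 - t) * gmean c0 w (gmean c0 (w * sqrt (real j)) f0) x
        + t * gmean c1 w (gmean c1 (w * sqrt (real j)) f1) y + (real j * (E * w ^ 4) + E * w ^ 4)"
      unfolding E_def
      by (rule comparison_step[OF t c c_eq gmean_tame[OF c_eq(2) F] gmean_lipschitz[OF c(1) f(1)]
            gmean_lipschitz[OF c(2) f(2)] w Suc.IH[unfolded E_def]])
    moreover have "real j * (E * w ^ 4) + E * w ^ 4 = real (Suc j) * (E * w ^ 4)"
      by (simp add: algebra_simps)
    ultimately show ?case
      unfolding comp[OF f(1)] comp[OF f(2)] comp[OF lipF] by simp
  qed
  have "(\<lambda>n. (1 - t) * gmean c0 s f0 x + t * gmean c1 s f1 y + E * s ^ 4 / real n)
      \<longlonglongrightarrow> (1 - t) * gmean c0 s f0 x + t * gmean c1 s f1 y + 0"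
    by (intro tendsto_intros lim_const_over_n)
  moreover have "eventually (\<lambda>n. gmean c s F ((1 - t) * x + t * y) \<le>
      (1 - t) * gmean c0 s f0 x + t * gmean c1 s f1 y + E * s ^ 4 / real n) sequentially"
  proof (rule eventually_sequentiallyI)
    \<comment> \<open>The lower bound on \<open>n\<close> ensures \<open>w \<le> 1\<close>, the
      range in which the one-step bound holds.\<close>
    fix n assume n: "nat \<lceil>s\<^sup>2\<rceil> + 1 \<le> n"
    define w where "w = s / sqrt (real n)"
    have n0: "real n > 0" using n by simp
    have "s\<^sup>2 \<le> real n" using n by linarith
    then have "sqrt (s\<^sup>2) \<le> sqrt (real n)" by (rule real_sqrt_le_mono)
    then have "s \<le> sqrt (real n)" using s by simp
    then have w: "0 \<le> w" "w \<le> 1" using s n0 by (auto simp: w_def divide_le_eq)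
    have ws: "w * sqrt (real n) = s" using n0 by (simp add: w_def)
    have "w ^ 4 = s ^ 4 / (real n)\<^sup>2"
    proof -
      have "sqrt (real n) ^ 4 = (real n)\<^sup>2" using power_mult[of "sqrt (real n)" 2 2] by simp
      then show ?thesis by (simp add: w_def power_divide)
    qed
    then have "real n * (E * w ^ 4) = E * s ^ 4 / real n"
      using n0 by (simp add: power2_eq_square)
    then show "gmean c s F ((1 - t) * x + t * y) \<le>
      (1 - t) * gmean c0 s f0 x + t * gmean c1 s f1 y + E * s ^ 4 / real n"
      using iter[OF w, of n x y] unfolding ws by simp
  qed
  ultimately have "gmean c s F ((1 - t) * x + t * y) \<le> (1 - t) * gmean c0 s f0 x + t * gmean c1 s f1 y + 0"
    by (intro tendsto_lowerbound[where F = sequentially]) auto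
  then show ?thesis by simp
qed

text \<open>Replacing \<open>f0\<close>, \<open>f1\<close> by their infimal convolutions with \<open>L * \<bar>\<cdot>\<bar>\<close> keeps an inequality whose left side is
  \<open>L\<close>-Lipschitz, and removes every integrability concern.\<close>

definition inf_conv :: "real \<Rightarrow> (real \<Rightarrow> real) \<Rightarrow> real \<Rightarrow> real" where
  "inf_conv L f x = (INF y. f y + L * \<bar>x - y\<bar>)"

lemma inf_conv_le:
  assumes "\<And>y. B \<le> f y + L * \<bar>x - y\<bar>"
  shows "inf_conv L f x \<le> f y + L * \<bar>x - y\<bar>"
  unfolding inf_conv_def using assms by (intro cINF_lower bdd_belowI2) auto

lemma lipschitz_inf_conv:
  assumes L: "L \<ge> 0" and B: "\<And>x y. B x \<le> f y + L * \<bar>x - y\<bar>"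
  shows "lipschitz L (inf_conv L f)"
proof -
  have "inf_conv L f x - L * \<bar>x - z\<bar> \<le> inf_conv L f z" for x z
    unfolding inf_conv_def[of L f z]
  proof (intro cINF_greatest)
    fix y
    have "L * \<bar>x - y\<bar> \<le> L * (\<bar>x - z\<bar> + \<bar>z - y\<bar>)"
      using L by (intro mult_left_mono) auto
    then show "inf_conv L f x - L * \<bar>x - z\<bar> \<le> f y + L * \<bar>z - y\<bar>"
      using inf_conv_le[of "B x" f L x y] B by (simp add: distrib_left)
  qed auto
  from this this show ?thesis
    unfolding lipschitz_def by (smt (verit) abs_minus_commute)
qed

lemma comparison_lipschitz_minorant:
  assumes t: "0 < t" "t < 1" and c: "c0 \<ge> 0" "c1 \<ge> 0" and c_eq: "c = (1 - t) * c0 + t * c1" "c > 0"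
    and F: "tame L K F" and s: "0 \<le> s"
    and int: "\<And>x. integrable gauss (\<lambda>g. exp (c0 * f0 (x + s * g)))" "\<And>x. integrable gauss (\<lambda>g. exp (c1 * f1 (x + s * g)))"
    and int0: "\<And>x. c0 = 0 \<Longrightarrow> integrable gauss (\<lambda>g. f0 (x + s * g))" "\<And>x. c1 = 0 \<Longrightarrow> integrable gauss (\<lambda>g. f1 (x + s * g))"
    and le: "\<And>x y. F ((1 - t) * x + t * y) \<le> (1 - t) * f0 x + t * f1 y"
  shows "gmean c s F ((1 - t) * x + t * y) \<le> (1 - t) * gmean c0 s f0 x + t * gmean c1 s f1 y"
proof -
  have lipF: "lipschitz L F" using F by (simp add: tame_def)
  have L: "L \<ge> 0" by (rule lipschitz_nonneg[OF lipF])
  \<comment> \<open>Moving from \<open>x'\<close>, \<open>y'\<close> to \<open>x\<close>,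
    \<open>y\<close> changes the left side by at most \<open>L\<close> times the same convex
    combination of the distances. This is why the Lipschitz constant of \<open>F\<close> is the
    right slope for the infimal convolutions.\<close>
  have key: "F ((1 - t) * x + t * y) \<le> (1 - t) * (f0 x' + L * \<bar>x - x'\<bar>) + t * (f1 y' + L * \<bar>y - y'\<bar>)" for x y x' y'
  proof -
    have "\<bar>((1 - t) * x + t * y) - ((1 - t) * x' + t * y')\<bar> = \<bar>(1 - t) * (x - x') + t * (y - y')\<bar>"
      by (simp add: algebra_simps)
    also have "\<dots> \<le> (1 - t) * \<bar>x - x'\<bar> + t * \<bar>y - y'\<bar>"
      using t by (intro order_trans[OF abs_triangle_ineq]) (simp add: abs_mult)
    finally have "L * \<bar>((1 - t) * x + t * y) - ((1 - t) * x' + t * y')\<bar> \<le> L * ((1 - t) * \<bar>x - x'\<bar> + t * \<bar>y - y'\<bar>)"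
      using L by (rule mult_left_mono)
    then have "F ((1 - t) * x + t * y) \<le> F ((1 - t) * x' + t * y') + L * ((1 - t) * \<bar>x - x'\<bar> + t * \<bar>y - y'\<bar>)"
      using lipschitzD[OF lipF, of "(1 - t) * x + t * y" "(1 - t) * x' + t * y'"] by linarith
    also have "\<dots> \<le> (1 - t) * f0 x' + t * f1 y' + L * ((1 - t) * \<bar>x - x'\<bar> + t * \<bar>y - y'\<bar>)"
      using le[of x' y'] by simp
    finally show ?thesis by (simp add: algebra_simps)
  qed
  \<comment> \<open>With the other points fixed, \<open>key\<close> bounds the family under each
    infimum from below, so both infima are finite.\<close>
  have k0: "(F ((1 - t) * x + t * y) - t * (f1 y' + L * \<bar>y - y'\<bar>)) / (1 - t) \<le> f0 x' + L * \<bar>x - x'\<bar>" for x y x' y'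
    using key[of x y x' y'] t by (simp add: field_simps)
  have k1: "(F ((1 - t) * x + t * y) - (1 - t) * (f0 x' + L * \<bar>x - x'\<bar>)) / t \<le> f1 y' + L * \<bar>y - y'\<bar>" for x y x' y'
    using key[of x y x' y'] t by (simp add: field_simps)
  let ?h0 = "inf_conv L f0" and ?h1 = "inf_conv L f1"
  have lip: "lipschitz L ?h0" "lipschitz L ?h1"
    using lipschitz_inf_conv[OF L, OF k0[of _ 0 0]] lipschitz_inf_conv[OF L, OF k1[of 0 _ 0]] by simp_all
  have below: "?h0 x \<le> f0 x" "?h1 x \<le> f1 x" for x
    using inf_conv_le[OF k0[of x 0 0], of x] inf_conv_le[OF k1[of 0 x 0], of x] by simp_all
  \<comment> \<open>The two infima are taken one after the other, first the one for
    \<open>f0\<close> and then the one for \<open>f1\<close>.\<close>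
  have "F ((1 - t) * x + t * y) \<le> (1 - t) * ?h0 x + t * ?h1 y" for x y
  proof -
    have 1: "(F ((1 - t) * x + t * y) - t * (f1 y' + L * \<bar>y - y'\<bar>)) / (1 - t) \<le> ?h0 x" for y'
      unfolding inf_conv_def[of L f0 x] by (intro cINF_greatest k0) auto
    have "(F ((1 - t) * x + t * y) - (1 - t) * ?h0 x) / t \<le> ?h1 y"
      unfolding inf_conv_def[of L f1 y]
    proof (intro cINF_greatest)
      show "(F ((1 - t) * x + t * y) - (1 - t) * ?h0 x) / t \<le> f1 y' + L * \<bar>y - y'\<bar>" for y'
        using 1[of y'] t by (simp add: field_simps)
    qed auto
    then show ?thesis using t by (simp add: field_simps)
  qed
  then have "gmean c s F ((1 - t) * x + t * y) \<le> (1 - t) * gmean c0 s ?h0 x + t * gmean c1 s ?h1 y"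
    using t by (intro comparison_tame[OF _ _ c c_eq F lip s]) auto
  also have "\<dots> \<le> (1 - t) * gmean c0 s f0 x + t * gmean c1 s f1 y"
    unfolding gmean_def using t below
    by (intro add_mono mult_left_mono gauss.lmean_mono_fun c int int0
        lipschitz_integrable_exp[OF lip(1)] lipschitz_integrable[OF lip(1)]
        lipschitz_integrable_exp[OF lip(2)] lipschitz_integrable[OF lip(2)]) auto
  finally show ?thesis .
qed

section \<open>Tame approximation of convex functions from below\<close>

lemma lmean_const:
  assumes "prob_space M"
  shows "lmean c M (\<lambda>_. b) = b"
  using assms by (simp add: lmean_def prob_space.prob_space)

lemma tame_affine: "tame \<bar>p\<bar> 0 (\<lambda>x. b + p * x)"
proof -
  have "convex_on UNIV (\<lambda>x::real. b + p * x)"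
    by (rule convex_onI) (auto simp: algebra_simps)
  moreover have "lipschitz \<bar>p\<bar> (\<lambda>x. b + p * x)"
    by (auto simp: lipschitz_def abs_mult[symmetric] algebra_simps)
  ultimately show ?thesis by (simp add: tame_def algebra_simps)
qed

lemma lipschitz_mono: "lipschitz L f \<Longrightarrow> L \<le> L' \<Longrightarrow> lipschitz L' f"
  unfolding lipschitz_def by (meson abs_ge_zero mult_right_mono order_trans)

text \<open>The approximants are normalised log-sum-exp combinations of finitely many tangents.\<close>

lemma convex_tame_approximation:
  fixes F :: "real \<Rightarrow> real"
  assumes cvx: "convex_on UNIV F"
  obtains f L K where "\<And>n::nat. tame (L n) (K n) (f n)" "\<And>n x. f n x \<le> F x" "\<And>x. (\<lambda>n. f n x) \<longlonglongrightarrow> F x"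
proof -
  obtain p where p: "\<And>q y. F q + p q * (y - q) \<le> F y"
    using convex_subgradient[OF cvx] by metis
  \<comment> \<open>Tangents are taken at rational points, so that they can be enumerated and still
    lie densely.\<close>
  define r :: "nat \<Rightarrow> real" where "r = from_nat_into \<rat>"
  have r: "range r = (\<rat> :: real set)"
    unfolding r_def using countable_rat Rats_0 by (intro range_from_nat_into) auto
  define T where "T i x = F (r i) + p (r i) * (x - r i)" for i x
  have TF: "T i x \<le> F x" for i x by (simp add: T_def p)
  define U where "U n = measure_pmf (pmf_of_set {..n})" for n :: nat
  \<comment> \<open>The exponent grows with the number of tangents: against their maximum, averaging
    over \<open>n + 1\<close> of them costs at most \<open>ln (n + 1) / (n + 1)\<close>, which tends
    to 0.\<close>
  define f where "f n x = lmean (real (Suc n)) (U n) (\<lambda>i. T i x)" for n x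
  define L where "L n = Max ((\<lambda>i. \<bar>p (r i)\<bar>) ` {..n})" for n
  have U: "prob_space (U n)" for n unfolding U_def by (rule prob_space_measure_pmf)
  have int: "integrable (U n) (h :: nat \<Rightarrow> real)" for n h
    unfolding U_def by (intro integrable_measure_pmf_finite) simp
  have sum: "integral\<^sup>L (U n) h = (\<Sum>i\<le>n. h i) / real (Suc n)" for n and h :: "nat \<Rightarrow> real"
    unfolding U_def by (subst integral_pmf_of_set) auto
  \<comment> \<open>The uniform law on \<open>{..n}\<close> is a measure on all of
    \<open>nat\<close>, and the general lemmas ask for bounds at every index. Capping the index
    makes the bound \<open>L n\<close> hold everywhere without changing the integrals.\<close>
  define T' where "T' n x i = T (min i n) x" for n x i
  have f': "f n x = lmean (real (Suc n)) (U n) (T' n x)" for n x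
    by (simp add: f_def lmean_def sum T'_def)
  have tT: "tame (L n) 0 (\<lambda>x. T' n x i)" for n i
  proof -
    let ?j = "min i n"
    have "tame \<bar>p (r ?j)\<bar> 0 (\<lambda>x. (F (r ?j) - p (r ?j) * r ?j) + p (r ?j) * x)"
      by (rule tame_affine)
    also have "(\<lambda>x. (F (r ?j) - p (r ?j) * r ?j) + p (r ?j) * x) = (\<lambda>x. T' n x i)"
      by (simp add: T'_def T_def algebra_simps)
    finally have "tame \<bar>p (r ?j)\<bar> 0 (\<lambda>x. T' n x i)" .
    moreover have "\<bar>p (r ?j)\<bar> \<le> L n"
      unfolding L_def by (intro Max_ge) auto
    ultimately show ?thesis by (auto simp: tame_def intro: lipschitz_mono)
  qed
  have "tame (L n) (0 + 2 * real (Suc n) * (L n)\<^sup>2) (f n)" for n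
    unfolding tame_def f'
  proof (intro conjI allI)
    have lip: "\<bar>T' n x i - T' n y i\<bar> \<le> L n * \<bar>x - y\<bar>" for x y i
      using tT[of n i] by (simp add: tame_def lipschitz_def)
    show "convex_on UNIV (\<lambda>x. lmean (real (Suc n)) (U n) (T' n x))"
      using tT by (intro prob_space.lmean_convex[OF U] int) (auto simp: tame_def)
    show "lipschitz (L n) (\<lambda>x. lmean (real (Suc n)) (U n) (T' n x))"
      unfolding lipschitz_def
      by (intro allI prob_space.lmean_lipschitz[OF U] int lip) auto
    show "lmean (real (Suc n)) (U n) (T' n (x + s)) + lmean (real (Suc n)) (U n) (T' n (x - s)) -
       2 * lmean (real (Suc n)) (U n) (T' n x) \<le> (0 + 2 * real (Suc n) * (L n)\<^sup>2) * s\<^sup>2" for x s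
      using tT by (intro prob_space.lmean_semiconcave[OF U] int lip) (auto simp: tame_def)
  qed
  moreover have fF: "f n x \<le> F x" for n x
  proof -
    have "f n x \<le> lmean (real (Suc n)) (U n) (\<lambda>i. F x)"
      unfolding f_def by (intro prob_space.lmean_mono_fun[OF U] int TF) auto
    then show ?thesis by (simp add: lmean_const[OF U])
  qed
  moreover have "(\<lambda>n. f n x) \<longlonglongrightarrow> F x" for x
  proof (rule LIMSEQ_I)
    fix e :: real assume e: "e > 0"
    \<comment> \<open>A lower bound, continuous in \<open>q\<close>, for the value at
      \<open>x\<close> of the tangent at \<open>q\<close>: the slope \<open>p q\<close>, which may
      jump, is bounded by differences of \<open>F\<close> over unit distance. At
      \<open>q = x\<close> it equals \<open>F x\<close>.\<close>
    define \<psi> where "\<psi> q = F q - (\<bar>F (q + 1) - F q\<bar> + \<bar>F (q - 1) - F q\<bar>) * \<bar>x - q\<bar>" for q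
    have cont: "continuous_on UNIV F" using cvx by (intro convex_on_continuous) auto
    have "continuous_on UNIV \<psi>"
      unfolding \<psi>_def by (intro continuous_intros continuous_on_compose2[OF cont]) auto
    then have "(\<psi> \<longlongrightarrow> \<psi> x) (at x)" by (simp add: continuous_on_def)
    then obtain d where d: "d > 0" "\<And>q. q \<noteq> x \<Longrightarrow> \<bar>q - x\<bar> < d \<Longrightarrow> \<bar>\<psi> q - \<psi> x\<bar> < e / 2"
      using e by (metis LIM_eq half_gt_zero real_norm_def)
    obtain q where q: "q \<in> \<rat>" "x < q" "q < x + d"
      using Rats_dense_in_real[of x "x + d"] d(1) by auto
    obtain i where i: "r i = q" using r q(1) by (metis imageE)
    have "\<psi> q \<le> T i x"
    proof -
      have "- p q * (x - q) \<le> \<bar>p q\<bar> * \<bar>x - q\<bar>"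
        by (metis abs_ge_self abs_minus_cancel abs_mult)
      also have "\<bar>p q\<bar> \<le> \<bar>F (q + 1) - F q\<bar> + \<bar>F (q - 1) - F q\<bar>"
        using p[of q "q + 1"] p[of q "q - 1"] by simp
      then have "\<bar>p q\<bar> * \<bar>x - q\<bar> \<le> (\<bar>F (q + 1) - F q\<bar> + \<bar>F (q - 1) - F q\<bar>) * \<bar>x - q\<bar>"
        by (intro mult_right_mono) auto
      finally show ?thesis by (simp add: \<psi>_def T_def i)
    qed
    moreover have "\<bar>\<psi> q - \<psi> x\<bar> < e / 2" using d q by auto
    moreover have "\<psi> x = F x" by (simp add: \<psi>_def)
    ultimately have Ti: "F x - e / 2 < T i x" by linarith
    have lim: "(\<lambda>n. ln (real (Suc n)) / real (Suc n)) \<longlonglongrightarrow> 0"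
      using lim_ln_over_n by (rule LIMSEQ_Suc)
    obtain N where N: "\<And>n. n \<ge> N \<Longrightarrow> norm (ln (real (Suc n)) / real (Suc n) - 0) < e / 2"
      using LIMSEQ_D[OF lim half_gt_zero[OF e]] by blast
    show "\<exists>no. \<forall>n\<ge>no. norm (f n x - F x) < e"
    proof (intro exI allI impI)
      fix n assume n: "max i N \<le> n"
      let ?k = "real (Suc n)"
      have "exp (?k * T i x) \<le> (\<Sum>i\<le>n. exp (?k * T i x))"
        using n by (intro member_le_sum) auto
      then have "exp (?k * T i x) / ?k \<le> (\<Sum>i\<le>n. exp (?k * T i x)) / ?k"
        by (intro divide_right_mono) auto
      then have "ln (exp (?k * T i x) / ?k) \<le> ln ((\<Sum>i\<le>n. exp (?k * T i x)) / ?k)"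
        by (intro ln_mono) auto
      then have "(?k * T i x - ln ?k) / ?k \<le> ln ((\<Sum>i\<le>n. exp (?k * T i x)) / ?k) / ?k"
        by (intro divide_right_mono) (auto simp: ln_div)
      then have "T i x - ln ?k / ?k \<le> f n x"
        by (simp add: f_def lmean_def sum diff_divide_distrib del: of_nat_Suc)
      moreover have "ln ?k / ?k < e / 2" using N[of n] n by simp
      ultimately show "norm (f n x - F x) < e"
        using Ti fF[of n x] by (simp del: of_nat_Suc)
    qed
  qed
  ultimately show ?thesis by (rule that)
qed

text \<open>Approximants below \<open>F\<close> inherit the hypothesis, and
  \<open>exp (c * F)\<close> dominates their exponentials; a limit is taken on the left side only.
  If \<open>c = 0\<close>, then \<open>c0\<close> and \<open>c1\<close> vanish too, and integrating
  the hypothesis is enough.\<close>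

lemma gmean_comparison:
  assumes t: "0 < t" "t < 1" and c: "c0 \<ge> 0" "c1 \<ge> 0" and c_eq: "c = (1 - t) * c0 + t * c1"
    and F: "convex_on UNIV F" and s: "0 \<le> s"
    and int: "\<And>x. integrable gauss (\<lambda>g. exp (c0 * f0 (x + s * g)))" "\<And>x. integrable gauss (\<lambda>g. exp (c1 * f1 (x + s * g)))"
      "\<And>x. integrable gauss (\<lambda>g. exp (c * F (x + s * g)))"
    and int0: "\<And>x. c0 = 0 \<Longrightarrow> integrable gauss (\<lambda>g. f0 (x + s * g))" "\<And>x. c1 = 0 \<Longrightarrow> integrable gauss (\<lambda>g. f1 (x + s * g))"
      "\<And>x. c = 0 \<Longrightarrow> integrable gauss (\<lambda>g. F (x + s * g))"
    and le: "\<And>x y. F ((1 - t) * x + t * y) \<le> (1 - t) * f0 x + t * f1 y"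
  shows "gmean c s F ((1 - t) * x + t * y) \<le> (1 - t) * gmean c0 s f0 x + t * gmean c1 s f1 y"
proof (cases "c = 0")
  case True
  have "(1 - t) * c0 \<ge> 0" "t * c1 \<ge> 0" using c t by auto
  then have "(1 - t) * c0 = 0" "t * c1 = 0" using c_eq True by linarith+
  then have c01: "c0 = 0" "c1 = 0" using t by auto
  have "(\<integral>g. F ((1 - t) * x + t * y + s * g) \<partial>gauss) \<le> (\<integral>g. (1 - t) * f0 (x + s * g) + t * f1 (y + s * g) \<partial>gauss)"
  proof (rule integral_mono)
    show "F ((1 - t) * x + t * y + s * g) \<le> (1 - t) * f0 (x + s * g) + t * f1 (y + s * g)" for g
      using le[of "x + s * g" "y + s * g"] by (simp add: algebra_simps)
  qed (use int0 True c01 in auto)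
  then show ?thesis using int0 True c01 by (simp add: gmean_def lmean_def)
next
  case False
  then have c0: "c > 0" using c t c_eq by (simp add: less_le)
  obtain f L K where f: "\<And>n::nat. tame (L n) (K n) (f n)" "\<And>n x. f n x \<le> F x" "\<And>x. (\<lambda>n. f n x) \<longlonglongrightarrow> F x"
    by (rule convex_tame_approximation[OF F]) blast
  let ?w = "(1 - t) * x + t * y"
  have "continuous_on UNIV F" using F by (intro convex_on_continuous) auto
  then have [measurable]: "F \<in> borel_measurable borel" by (rule borel_measurable_continuous_onI)
  have [measurable]: "f n \<in> borel_measurable borel" for n
    using f(1)[of n] lipschitz_measurable by (auto simp: tame_def)
  have "(\<lambda>n. \<integral>g. exp (c * f n (?w + s * g)) \<partial>gauss) \<longlonglongrightarrow> (\<integral>g. exp (c * F (?w + s * g)) \<partial>gauss)"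
  proof (rule integral_dominated_convergence)
    show "integrable gauss (\<lambda>g. exp (c * F (?w + s * g)))" by (rule int)
    show "AE g in gauss. (\<lambda>n. exp (c * f n (?w + s * g))) \<longlonglongrightarrow> exp (c * F (?w + s * g))"
      by (intro AE_I2 tendsto_intros f)
    show "AE g in gauss. norm (exp (c * f n (?w + s * g))) \<le> exp (c * F (?w + s * g))" for n
      using c0 f(2) by auto
  qed measurable
  then have "(\<lambda>n. gmean c s (f n) ?w) \<longlonglongrightarrow> gmean c s F ?w"
    unfolding gmean_def lmean_def if_not_P[OF False]
    using gauss.integral_exp_pos[OF int(3)[of ?w]] by (intro tendsto_intros) auto
  moreover have "gmean c s (f n) ?w \<le> (1 - t) * gmean c0 s f0 x + t * gmean c1 s f1 y" for n
    by (intro comparison_lipschitz_minorant[OF t c c_eq c0 f(1) s int(1,2) int0(1,2)] order_trans[OF f(2) le])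
  ultimately show ?thesis by (intro LIMSEQ_le_const2) auto
qed

section \<open>Differentiating exponential means\<close>

text \<open>Differentiation under the integral at the single point 0. The domination concerns the
  difference from the base value rather than a derivative near 0, since the induction over the
  levels provides derivatives at 0 only.\<close>

lemma
  fixes w :: "real \<Rightarrow> 'a \<Rightarrow> real"
  assumes \<delta>: "\<delta> > 0"
    and meas: "\<And>t. \<bar>t\<bar> < \<delta> \<Longrightarrow> w t \<in> borel_measurable M"
    and bound: "\<And>t z. \<bar>t\<bar> < \<delta> \<Longrightarrow> \<bar>w t z - w 0 z\<bar> \<le> \<bar>t\<bar> * H z"
    and H: "integrable M H" and w0: "integrable M (w 0)"
    and deriv: "\<And>z. ((\<lambda>t. w t z) has_real_derivative W z) (at 0)"
  shows integrable_derivative: "integrable M W"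
    and has_derivative_integral: "((\<lambda>t. \<integral>z. w t z \<partial>M) has_real_derivative (\<integral>z. W z \<partial>M)) (at 0)"
proof -
  have int: "integrable M (w t)" if t: "\<bar>t\<bar> < \<delta>" for t
  proof -
    have "integrable M (\<lambda>z. w t z - w 0 z)"
    proof (rule Bochner_Integration.integrable_bound)
      show "integrable M (\<lambda>z. \<bar>t\<bar> * H z)" using H by simp
      show "AE z in M. norm (w t z - w 0 z) \<le> norm (\<bar>t\<bar> * H z)"
        unfolding real_norm_def by (intro AE_I2 order_trans[OF bound[OF t] abs_ge_self])
      show "(\<lambda>z. w t z - w 0 z) \<in> borel_measurable M"
        using meas[OF t] w0 by measurable
    qed
    from Bochner_Integration.integrable_add[OF this w0] show ?thesis by simp
  qed
  have quot: "(\<lambda>i. (w (X i) z - w 0 z) / X i) \<longlonglongrightarrow> W z" if "\<And>i. X i \<noteq> 0" "X \<longlonglongrightarrow> 0" for X z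
    using deriv[of z] that unfolding has_field_derivative_iff tendsto_at_iff_sequentially
    by (simp add: comp_def)
  have lim: "integrable M W \<and> (\<lambda>i. (\<integral>z. (w (X i) z - w 0 z) / X i \<partial>M)) \<longlonglongrightarrow> (\<integral>z. W z \<partial>M)"
    if X: "\<And>i. X i \<noteq> 0" "X \<longlonglongrightarrow> 0" "\<And>i. \<bar>X i\<bar> < \<delta>" for X
  proof -
    have s: "(\<lambda>z. (w (X i) z - w 0 z) / X i) \<in> borel_measurable M" for i
      using meas[OF X(3)[of i]] w0 by measurable
    have W: "W \<in> borel_measurable M"
      by (rule borel_measurable_LIMSEQ_real[OF quot s]) (use X in auto)
    have b: "norm ((w (X i) z - w 0 z) / X i) \<le> H z" for i z
      using bound[OF X(3)[of i], of z] X(1)[of i] by (simp add: abs_divide divide_le_eq mult.commute)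
    have ptw: "AE z in M. (\<lambda>i. (w (X i) z - w 0 z) / X i) \<longlonglongrightarrow> W z"
      by (intro AE_I2 quot X)
    have bd: "AE z in M. norm ((w (X i) z - w 0 z) / X i) \<le> H z" for i
      by (intro AE_I2 b)
    show ?thesis
      using integrable_dominated_convergence[OF W s H ptw bd]
        integral_dominated_convergence[OF W s H ptw bd] by blast
  qed
  \<comment> \<open>Some null sequence within the range; it serves only to obtain integrability of
    the limit \<open>W\<close>.\<close>
  have "(\<lambda>i. \<delta> / (real i + 2)) \<longlonglongrightarrow> 0" by real_asymp
  with lim[of "\<lambda>i. \<delta> / (real i + 2)"] \<delta> show W: "integrable M W"
    by (auto simp: divide_less_eq)
  show "((\<lambda>t. \<integral>z. w t z \<partial>M) has_real_derivative (\<integral>z. W z \<partial>M)) (at 0)"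
    unfolding has_field_derivative_iff tendsto_at_iff_sequentially comp_def
  proof (intro allI impI)
    fix X :: "nat \<Rightarrow> real"
    assume X: "\<forall>i. X i \<in> UNIV - {0}" "X \<longlonglongrightarrow> 0"
    then obtain N where N: "\<And>i. i \<ge> N \<Longrightarrow> \<bar>X i\<bar> < \<delta>"
      using LIMSEQ_D[OF X(2) \<delta>] by auto
    have "(\<lambda>i. \<integral>z. (w (X (i + N)) z - w 0 z) / X (i + N) \<partial>M) \<longlonglongrightarrow> (\<integral>z. W z \<partial>M)"
      using lim[of "\<lambda>i. X (i + N)"] X N LIMSEQ_ignore_initial_segment[OF X(2), of N] by auto
    moreover have eq: "(\<integral>z. (w (X (i + N)) z - w 0 z) / X (i + N) \<partial>M) =
        ((\<integral>z. w (X (i + N)) z \<partial>M) - (\<integral>z. w 0 z \<partial>M)) / (X (i + N) - 0)" for i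
      using int[of "X (i + N)"] w0 N[of "i + N"] by simp
    ultimately have "(\<lambda>i. ((\<integral>z. w (X (i + N)) z \<partial>M) - (\<integral>z. w 0 z \<partial>M)) / (X (i + N) - 0)) \<longlonglongrightarrow> (\<integral>z. W z \<partial>M)"
      unfolding eq by blast
    then show "(\<lambda>i. ((\<integral>z. w (X i) z \<partial>M) - (\<integral>z. w 0 z \<partial>M)) / (X i - 0)) \<longlonglongrightarrow> (\<integral>z. W z \<partial>M)"
      by (rule LIMSEQ_offset)
  qed
qed

lemma le_exp_divide:
  fixes y :: real
  assumes "\<eta> > 0"
  shows "y \<le> exp (\<eta> * y) / \<eta>"
proof -
  have "\<eta> * y \<le> exp (\<eta> * y)" using exp_ge_add_one_self[of "\<eta> * y"] by linarith
  then show ?thesis using assms by (simp add: pos_le_divide_eq mult.commute)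
qed

lemma abs_exp_diff_le:
  fixes a b :: real
  assumes "a \<le> m" "b \<le> m"
  shows "\<bar>exp a - exp b\<bar> \<le> \<bar>a - b\<bar> * exp m"
proof -
  have *: "exp a - exp b \<le> \<bar>a - b\<bar> * exp m" if "a \<le> m" for a b :: real
  proof -
    have "exp a * (1 + (b - a)) \<le> exp a * exp (b - a)"
      by (intro mult_left_mono exp_ge_add_one_self) auto
    then have "exp a - exp b \<le> (a - b) * exp a" by (simp add: algebra_simps flip: exp_add)
    also have "\<dots> \<le> \<bar>a - b\<bar> * exp m" using that by (intro mult_mono) auto
    finally show ?thesis .
  qed
  from *[of a b] *[of b a] assms show ?thesis by (simp add: abs_minus_commute abs_le_iff)
qed

context prob_space
begin

text \<open>Jensen's inequality for \<open>y powr (\<eta> / s)\<close>: a small exponential moment under the tilted law is bounded by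
  a small power of a large exponential moment. This is what keeps the growth bounds arbitrarily slow
  when they are passed down the recursion.\<close>

lemma
  fixes w U :: "'a \<Rightarrow> real"
  assumes w[measurable]: "w \<in> borel_measurable M" and U[measurable]: "U \<in> borel_measurable M"
    and w1: "1 \<le> (\<integral>z. w z \<partial>M)" and wU: "\<And>z. 0 \<le> w z" "\<And>z. w z \<le> exp (a * U z)"
    and \<eta>: "0 < \<eta>" "\<eta> \<le> s" and int: "integrable M (\<lambda>z. exp ((a + s) * U z))" "integrable M w"
  shows integrable_tilted: "integrable M (\<lambda>z. w z * exp (\<eta> * U z))"
    and tilted_mean_le: "(\<integral>z. w z * exp (\<eta> * U z) \<partial>M) \<le>
      (\<integral>z. w z \<partial>M) * exp (\<eta> / s * ln (\<integral>z. exp ((a + s) * U z) \<partial>M))"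
proof -
  define B where "B = (\<integral>z. exp ((a + s) * U z) \<partial>M)"
  define \<theta> where "\<theta> = \<eta> / s"
  have s: "s > 0" using \<eta> by linarith
  have \<theta>: "0 \<le> \<theta>" "\<theta> \<le> 1" using \<eta> by (auto simp: \<theta>_def)
  have B: "B > 0" unfolding B_def by (rule integral_exp_pos[OF int(1)])
  have ws: "w z * exp (s * U z) \<le> exp ((a + s) * U z)" for z
    using wU(2)[of z] by (simp add: distrib_right exp_add)
  have int_ws: "integrable M (\<lambda>z. w z * exp (s * U z))"
    by (rule Bochner_Integration.integrable_bound[OF int(1)]) (use ws wU in \<open>auto simp: abs_mult\<close>)
  \<comment> \<open>The weighted arithmetic-geometric inequality with weight
    \<open>\<theta>\<close>; division by \<open>B\<close> makes the large moment at most 1.\<close>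
  have le: "w z * exp (\<eta> * U z) \<le> exp (\<theta> * ln B) * (\<theta> / B * (w z * exp (s * U z)) + (1 - \<theta>) * w z)" for z
  proof -
    have "exp (\<eta> * U z) = exp (\<theta> * ln B) * exp ((1 - \<theta>) *\<^sub>R 0 + \<theta> *\<^sub>R (s * U z - ln B))"
      using s by (simp add: \<theta>_def algebra_simps flip: exp_add)
    also have "\<dots> \<le> exp (\<theta> * ln B) * ((1 - \<theta>) * exp 0 + \<theta> * exp (s * U z - ln B))"
      using \<theta> by (intro mult_left_mono convex_onD[OF exp_convex]) auto
    finally have "w z * exp (\<eta> * U z) \<le> w z * (exp (\<theta> * ln B) * ((1 - \<theta>) * exp 0 + \<theta> * exp (s * U z - ln B)))"
      using wU(1) by (rule mult_left_mono)
    also have "\<dots> = exp (\<theta> * ln B) * (\<theta> / B * (w z * exp (s * U z)) + (1 - \<theta>) * w z)"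
      using B by (simp add: exp_diff algebra_simps)
    finally show ?thesis .
  qed
  have int_r: "integrable M (\<lambda>z. exp (\<theta> * ln B) * (\<theta> / B * (w z * exp (s * U z)) + (1 - \<theta>) * w z))"
    by (intro integrable_mult_right Bochner_Integration.integrable_add int_ws int(2))
  show int_l: "integrable M (\<lambda>z. w z * exp (\<eta> * U z))"
  proof (rule Bochner_Integration.integrable_bound[OF int_r])
    show "AE z in M. norm (w z * exp (\<eta> * U z)) \<le> norm (exp (\<theta> * ln B) * (\<theta> / B * (w z * exp (s * U z)) + (1 - \<theta>) * w z))"
      unfolding real_norm_def using wU(1)
      by (intro AE_I2) (subst abs_of_nonneg, simp, rule order_trans[OF le abs_ge_self])
  qed measurable
  have "(\<integral>z. w z * exp (\<eta> * U z) \<partial>M) \<le> (\<integral>z. exp (\<theta> * ln B) * (\<theta> / B * (w z * exp (s * U z)) + (1 - \<theta>) * w z) \<partial>M)"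
    by (rule integral_mono[OF int_l int_r le])
  also have "\<dots> = exp (\<theta> * ln B) * (\<theta> / B * (\<integral>z. w z * exp (s * U z) \<partial>M) + (1 - \<theta>) * (\<integral>z. w z \<partial>M))"
    using int_ws int(2) by simp
  also have "\<dots> \<le> exp (\<theta> * ln B) * (\<theta> / B * B + (1 - \<theta>) * (\<integral>z. w z \<partial>M))"
    unfolding B_def[symmetric]
    using \<theta> B integral_mono[OF int_ws int(1) ws] by (intro mult_left_mono add_mono) (auto simp: B_def)
  \<comment> \<open>By \<open>w1\<close> the constant 1 is replaced by the total mass of
    \<open>w\<close>, so that the two terms combine.\<close>
  also have "\<dots> \<le> exp (\<theta> * ln B) * (\<theta> * (\<integral>z. w z \<partial>M) + (1 - \<theta>) * (\<integral>z. w z \<partial>M))"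
    using \<theta> B w1 by (intro mult_left_mono add_mono) (auto simp: mult_le_cancel_left1)
  also have "\<dots> = (\<integral>z. w z \<partial>M) * exp (\<eta> / s * ln B)"
    by (simp add: \<theta>_def algebra_simps)
  finally show "(\<integral>z. w z * exp (\<eta> * U z) \<partial>M) \<le> (\<integral>z. w z \<partial>M) * exp (\<eta> / s * ln (\<integral>z. exp ((a + s) * U z) \<partial>M))"
    by (simp add: B_def)
qed

text \<open>Jensen's inequality for the law tilted by \<open>exp (a z)\<close>, that is, the Gibbs
  variational principle: \<open>\<kappa>\<close> is the tilted mean of \<open>a - b\<close>, and
  \<open>exp\<close> is bounded below by its tangent at \<open>- \<kappa>\<close>.\<close>

lemma ln_integral_exp_diff_le:
  assumes int: "integrable M (\<lambda>z. exp (a z :: real))" "integrable M (\<lambda>z. exp (b z))"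
    "integrable M (\<lambda>z. (a z - b z) * exp (a z))"
  shows "ln (\<integral>z. exp (a z) \<partial>M) - ln (\<integral>z. exp (b z) \<partial>M) \<le>
    (\<integral>z. (a z - b z) * exp (a z) \<partial>M) / (\<integral>z. exp (a z) \<partial>M)"
proof -
  define A where "A = (\<integral>z. exp (a z) \<partial>M)"
  define \<kappa> where "\<kappa> = (\<integral>z. (a z - b z) * exp (a z) \<partial>M) / A"
  have A: "A > 0" unfolding A_def by (rule integral_exp_pos[OF int(1)])
  have k: "(\<integral>z. (a z - b z) * exp (a z) \<partial>M) = \<kappa> * A" using A by (simp add: \<kappa>_def)
  have "exp (- \<kappa>) * A = (\<integral>z. exp (- \<kappa>) * ((1 + \<kappa>) * exp (a z) - (a z - b z) * exp (a z)) \<partial>M)"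
    using int by (simp add: k flip: A_def) (simp add: algebra_simps)
  also have "\<dots> \<le> (\<integral>z. exp (b z) \<partial>M)"
  proof (rule integral_mono)
    fix z
    have "exp (- \<kappa>) * ((1 + \<kappa>) * exp (a z) - (a z - b z) * exp (a z)) =
        exp (a z - \<kappa>) * (1 + (b z - a z + \<kappa>))"
      by (simp add: exp_diff exp_minus field_simps)
    also have "\<dots> \<le> exp (a z - \<kappa>) * exp (b z - a z + \<kappa>)"
      by (intro mult_left_mono exp_ge_add_one_self) auto
    also have "\<dots> = exp (b z)" by (simp flip: exp_add)
    finally show "exp (- \<kappa>) * ((1 + \<kappa>) * exp (a z) - (a z - b z) * exp (a z)) \<le> exp (b z)" .
  qed (use int in auto)
  finally have "ln (exp (- \<kappa>) * A) \<le> ln (\<integral>z. exp (b z) \<partial>M)"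
    using A by (intro ln_mono) auto
  then show ?thesis using A by (simp add: ln_mult \<kappa>_def A_def)
qed

text \<open>The exponent \<open>c\<close> may be negative, because vectors near \<open>m\<close>
  have components on both sides of \<open>m 0 = 0\<close>. In that case Jensen's inequality puts the
  exponential mean below the plain one.\<close>

lemma lmean_le_lmean:
  assumes c: "c \<le> c'" "c' > 0" and u[measurable]: "u \<in> borel_measurable M" and U[measurable]: "U \<in> borel_measurable M"
    and uU: "\<And>z. 0 \<le> u z" "\<And>z. u z \<le> U z" and int: "integrable M (\<lambda>z. exp (c' * U z))"
  shows "0 \<le> lmean c M u" "lmean c M u \<le> lmean c' M U"
    and "integrable M u" "integrable M (\<lambda>z. exp (c * u z))"
proof -
  have U0: "0 \<le> U z" for z using uU[of z] by linarith
  have iU: "integrable M U"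
  proof (rule Bochner_Integration.integrable_bound)
    show "integrable M (\<lambda>z. exp (c' * U z) / c')" using int by simp
    show "AE z in M. norm (U z) \<le> norm (exp (c' * U z) / c')"
      using le_exp_divide[OF c(2)] U0 c(2) by auto
  qed measurable
  show iu: "integrable M u"
    by (rule Bochner_Integration.integrable_bound[OF iU]) (use uU U0 in auto)
  show ieu: "integrable M (\<lambda>z. exp (c * u z))"
  proof (rule Bochner_Integration.integrable_bound[OF int])
    have "c * u z \<le> c' * U z" for z
      using mult_right_mono[OF c(1) uU(1)[of z]] mult_left_mono[OF uU(2)[of z], of c'] c(2) by linarith
    then show "AE z in M. norm (exp (c * u z)) \<le> norm (exp (c' * U z))" by simp
  qed measurable
  have intU: "(\<integral>z. U z \<partial>M) \<le> lmean c' M U" using c by (intro integral_le_lmean iU int) auto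
  have uUi: "(\<integral>z. u z \<partial>M) \<le> (\<integral>z. U z \<partial>M)" by (intro integral_mono iu iU uU)
  have one: "(\<integral>z. 1 \<partial>M) = (1::real)" by (simp add: prob_space)
  consider "c = 0" | "c > 0" | "c < 0" by linarith
  then have "0 \<le> lmean c M u \<and> lmean c M u \<le> lmean c' M U"
  proof cases
    case 1
    then show ?thesis using uUi intU uU by (simp add: lmean_def)
  next
    case 2
    have "(\<integral>z. 1 \<partial>M) \<le> (\<integral>z. exp (c * u z) \<partial>M)"
      using 2 uU by (intro integral_mono ieu) auto
    then have "0 \<le> lmean c M u" using 2 by (simp add: lmean_def prob_space)
    moreover have "(\<integral>z. exp (c * u z) \<partial>M) \<le> exp (c * lmean c' M U)"
    proof -
      \<comment> \<open>With constant weight 1 and \<open>a = 0\<close> the tilted bound becomes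
        monotonicity of power means.\<close>
      have "integrable M (\<lambda>z. 1 * exp (c * U z))"
        by (rule integrable_tilted[where a = 0 and s = c']) (use 2 c int in \<open>auto simp: prob_space\<close>)
      then have "(\<integral>z. exp (c * u z) \<partial>M) \<le> (\<integral>z. 1 * exp (c * U z) \<partial>M)"
        using 2 uU by (intro integral_mono ieu) auto
      also have "\<dots> \<le> (\<integral>z. 1 \<partial>M) * exp (c / c' * ln (\<integral>z. exp ((0 + c') * U z) \<partial>M))"
        by (rule tilted_mean_le) (use 2 c int in \<open>auto simp: prob_space\<close>)
      also have "\<dots> = exp (c * lmean c' M U)" using c by (simp add: prob_space lmean_def)
      finally show ?thesis .
    qed
    then have "lmean c M u \<le> lmean c' M U" using 2 ieu by (simp add: lmean_le_iff)
    ultimately show ?thesis by simp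
  next
    case 3
    have "(\<integral>z. exp (c * u z) \<partial>M) \<le> (\<integral>z. 1 \<partial>M)"
      using 3 uU by (intro integral_mono ieu) (auto simp: mult_nonpos_nonneg)
    then have "ln (\<integral>z. exp (c * u z) \<partial>M) \<le> 0"
      using integral_exp_pos[OF ieu] by (simp add: prob_space)
    then have "0 \<le> lmean c M u" using 3 by (simp add: lmean_def divide_nonpos_neg)
    moreover have "lmean c M u \<le> (\<integral>z. u z \<partial>M)"
    proof -
      have "exp (\<integral>z. c * u z \<partial>M) \<le> (\<integral>z. exp (c * u z) \<partial>M)"
        using iu ieu by (intro exp_integral_le) auto
      then have "c * (\<integral>z. u z \<partial>M) \<le> ln (\<integral>z. exp (c * u z) \<partial>M)"
        using integral_exp_pos[OF ieu] by (simp add: ln_ge_iff)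
      then show ?thesis using 3 by (simp add: lmean_def field_simps)
    qed
    ultimately show ?thesis using uUi intU by linarith
  qed
  then show "0 \<le> lmean c M u" "lmean c M u \<le> lmean c' M U" by auto
qed

end

section \<open>Removing the singularity at exponent zero\<close>

lemma abs_exp_remainder_le:
  fixes y :: real
  shows "\<bar>exp y - 1 - y\<bar> \<le> y\<^sup>2 * exp \<bar>y\<bar>"
proof (cases "y \<ge> 0")
  case True
  then show ?thesis using exp_le_quadratic[OF True] exp_ge_add_one_self[of y] by (simp only: abs_of_nonneg)
next
  case False
  define v where "v = - y"
  have v: "v > 0" using False by (simp add: v_def)
  have "1 \<le> (1 - v + v\<^sup>2) * (1 + v)"
  proof -
    have "(1 - v + v\<^sup>2) * (1 + v) = 1 + v ^ 3" by (simp add: algebra_simps power2_eq_square power3_eq_cube)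
    then show ?thesis using v by simp
  qed
  also have "\<dots> \<le> (1 - v + v\<^sup>2) * exp v"
  proof (rule mult_left_mono)
    have "0 \<le> (1 - v)\<^sup>2 + v" using v by simp
    then show "0 \<le> 1 - v + v\<^sup>2" by (simp add: power2_eq_square algebra_simps)
  qed (rule exp_ge_add_one_self)
  finally have "exp y \<le> 1 + y + y\<^sup>2" by (simp add: v_def exp_minus field_simps)
  moreover have "y\<^sup>2 \<le> y\<^sup>2 * exp \<bar>y\<bar>" by (simp add: mult_le_cancel_left1)
  moreover have "1 + y \<le> exp y" by (rule exp_ge_add_one_self)
  ultimately show ?thesis by linarith
qed

text \<open>Caratheodory's form of the derivative: a correction \<open>t * g t\<close> can be
  differentiated at 0 when \<open>g\<close> is merely continuous there.\<close>

lemma has_derivative_mult_isCont: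
  fixes g :: "real \<Rightarrow> real"
  assumes "isCont g 0"
  shows "((\<lambda>t. t * g t) has_real_derivative g 0) (at 0)"
proof -
  have "((\<lambda>t. (t * g t - 0 * g 0) / (t - 0)) \<longlongrightarrow> g 0) (at 0)"
  proof (rule Lim_transform_eventually)
    show "(g \<longlongrightarrow> g 0) (at 0)" using assms by (simp add: isCont_def)
    show "\<forall>\<^sub>F t in at 0. g t = (t * g t - 0 * g 0) / (t - 0)"
      by (auto simp: eventually_at_filter)
  qed
  then show ?thesis unfolding has_field_derivative_iff by simp
qed

text \<open>The values at 0, here and in \<open>ln_remainder\<close>, are the limits. The two
  functions expand \<open>exp\<close> and \<open>ln\<close> to second order without dividing by an
  exponent that may vanish.\<close>

definition exp_remainder :: "real \<Rightarrow> real" where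
  "exp_remainder y = (if y = 0 then 1 / 2 else (exp y - 1 - y) / y\<^sup>2)"

definition ln_remainder :: "real \<Rightarrow> real" where
  "ln_remainder y = (if y = 0 then - 1 / 2 else (ln (1 + y) - y) / y\<^sup>2)"

lemma isCont_exp_remainder: "isCont exp_remainder 0"
proof -
  have "((\<lambda>y::real. (exp y - 1 - y) / y\<^sup>2) \<longlongrightarrow> 1 / 2) (at 0)" by real_asymp
  then have "(exp_remainder \<longlongrightarrow> 1 / 2) (at 0)"
    by (rule Lim_transform_eventually) (auto simp: exp_remainder_def eventually_at_filter)
  then show ?thesis by (simp add: isCont_def exp_remainder_def)
qed

lemma isCont_ln_remainder: "isCont ln_remainder 0"
proof -
  have "((\<lambda>y::real. (ln (1 + y) - y) / y\<^sup>2) \<longlongrightarrow> - 1 / 2) (at 0)" by real_asymp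
  then have "(ln_remainder \<longlongrightarrow> - 1 / 2) (at 0)"
    by (rule Lim_transform_eventually) (auto simp: ln_remainder_def eventually_at_filter)
  then show ?thesis by (simp add: isCont_def ln_remainder_def)
qed

lemma abs_exp_remainder_quotient_le: "\<bar>exp_remainder y\<bar> \<le> exp \<bar>y\<bar>"
proof (cases "y = 0")
  case False
  then have "\<bar>exp y - 1 - y\<bar> / y\<^sup>2 \<le> exp \<bar>y\<bar>"
    using abs_exp_remainder_le[of y] by (simp add: divide_le_eq mult.commute)
  then show ?thesis using False by (simp add: exp_remainder_def abs_divide)
qed (simp add: exp_remainder_def)

lemma borel_measurable_exp_remainder [measurable]: "exp_remainder \<in> borel_measurable borel"
  unfolding exp_remainder_def by measurable

lemma exp_eq_remainder: "exp (c * y) = 1 + c * (y + c * y\<^sup>2 * exp_remainder (c * y))"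
  by (simp add: exp_remainder_def field_simps power2_eq_square)

lemma ln_eq_remainder: "ln (1 + y) = y + y\<^sup>2 * ln_remainder y"
  by (simp add: ln_remainder_def)

text \<open>The derivative of the exponential mean in its exponent. At \<open>c = 0\<close> it is
  half the variance; otherwise \<open>c\<^sup>2\<close> times it is the relative entropy, with
  respect to \<open>M\<close>, of the law tilted by \<open>exp (c * u)\<close>.\<close>

definition lmean_slope :: "real \<Rightarrow> 'a measure \<Rightarrow> ('a \<Rightarrow> real) \<Rightarrow> real" where
  "lmean_slope c M u =
     (if c = 0 then ((\<integral>z. (u z)\<^sup>2 \<partial>M) - (\<integral>z. u z \<partial>M)\<^sup>2) / 2
      else (\<integral>z. u z * exp (c * u z) \<partial>M) / (c * (\<integral>z. exp (c * u z) \<partial>M)) - ln (\<integral>z. exp (c * u z) \<partial>M) / c\<^sup>2)"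

text \<open>One level of the recursion along a line of parameter vectors: \<open>u t\<close> is the
  next level, \<open>U\<close> the same level for the enlarged vector. The bound
  \<open>\<epsilon> / 4\<close> leaves room for the products of exponentials in the estimates, whose
  rates are \<open>c + \<epsilon> / 4 + \<eta>\<close> or \<open>3 * \<eta>\<close>, both at most
  \<open>c + \<epsilon>\<close>. The bound \<open>c / 2\<close> keeps a positive exponent away from
  0.\<close>

locale lmean_family = prob_space M for M :: "'a measure" +
  fixes c d \<epsilon> \<delta> C \<eta> :: real and u :: "real \<Rightarrow> 'a \<Rightarrow> real" and U D :: "'a \<Rightarrow> real"
  assumes c: "0 \<le> c" and \<epsilon>: "0 < \<epsilon>" and \<delta>: "0 < \<delta>" and C: "0 \<le> C"
    and \<eta>: "0 < \<eta>" "\<eta> \<le> \<epsilon> / 4"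
    and \<delta>_small: "\<And>t. \<bar>t\<bar> < \<delta> \<Longrightarrow> \<bar>t * d\<bar> \<le> \<eta>" "\<And>t. \<bar>t\<bar> < \<delta> \<Longrightarrow> c > 0 \<Longrightarrow> \<bar>t * d\<bar> \<le> c / 2"
    and u_meas: "\<And>t. \<bar>t\<bar> < \<delta> \<Longrightarrow> u t \<in> borel_measurable M"
    and U_meas [measurable]: "U \<in> borel_measurable M"
    and u_nonneg: "\<And>t z. \<bar>t\<bar> < \<delta> \<Longrightarrow> 0 \<le> u t z"
    and u_le: "\<And>t z. \<bar>t\<bar> < \<delta> \<Longrightarrow> u t z \<le> U z"
    and U_int: "integrable M (\<lambda>z. exp ((c + \<epsilon>) * U z))"
    and u_diff: "\<And>t z. \<bar>t\<bar> < \<delta> \<Longrightarrow> \<bar>u t z - u 0 z\<bar> \<le> \<bar>t\<bar> * (C * exp (\<eta> * U z))"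
    and u_deriv: "\<And>z. ((\<lambda>t. u t z) has_real_derivative D z) (at 0)"
begin

lemma zero_in_range: "\<bar>0\<bar> < \<delta>" using \<delta> by simp

lemma U_nonneg: "0 \<le> U z"
  using u_nonneg[OF zero_in_range, of z] u_le[OF zero_in_range, of z] by linarith

lemma u_cont: "isCont (\<lambda>t. u t z) 0"
  using u_deriv by (rule DERIV_isCont)

lemma integrable_exp_U: 
  assumes "b \<le> c + \<epsilon>"
  shows "integrable M (\<lambda>z. exp (b * U z))"
proof (rule Bochner_Integration.integrable_bound[OF U_int])
  show "AE z in M. norm (exp (b * U z)) \<le> norm (exp ((c + \<epsilon>) * U z))"
    using mult_right_mono[OF assms U_nonneg] by simp
qed measurable

lemma U_le: "U z \<le> exp (\<eta> * U z) / \<eta>"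
  by (rule le_exp_divide[OF \<eta>(1)])

lemma U_sq_le: "(U z)\<^sup>2 \<le> exp (2 * \<eta> * U z) / \<eta>\<^sup>2"
proof -
  have "(U z)\<^sup>2 \<le> (exp (\<eta> * U z) / \<eta>)\<^sup>2" using U_le U_nonneg by (rule power_mono)
  then show ?thesis by (simp add: power_divide mult.assoc flip: exp_double)
qed

lemma cu_le: "\<bar>t\<bar> < \<delta> \<Longrightarrow> (c + t * d) * u t z \<le> (c + \<epsilon> / 4) * U z"
proof -
  assume t: "\<bar>t\<bar> < \<delta>"
  have "(c + t * d) * u t z \<le> (c + \<epsilon> / 4) * u t z"
    using \<delta>_small(1)[OF t] \<eta> u_nonneg[OF t] by (intro mult_right_mono) auto
  also have "\<dots> \<le> (c + \<epsilon> / 4) * U z"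
    using u_le[OF t] c \<epsilon> by (intro mult_left_mono) auto
  finally show ?thesis .
qed

lemma cu_diff: "\<bar>t\<bar> < \<delta> \<Longrightarrow>
    \<bar>(c + t * d) * u t z - c * u 0 z\<bar> \<le> \<bar>t\<bar> * ((\<bar>d\<bar> / \<eta> + c * C) * exp (\<eta> * U z))"
proof -
  assume t: "\<bar>t\<bar> < \<delta>"
  have "\<bar>(c + t * d) * u t z - c * u 0 z\<bar> = \<bar>t * d * u t z + c * (u t z - u 0 z)\<bar>"
    by (simp add: algebra_simps)
  also have "\<dots> \<le> \<bar>t\<bar> * \<bar>d\<bar> * u t z + c * \<bar>u t z - u 0 z\<bar>"
    using c u_nonneg[OF t, of z] by (intro order_trans[OF abs_triangle_ineq]) (simp add: abs_mult)
  also have "\<dots> \<le> \<bar>t\<bar> * \<bar>d\<bar> * (exp (\<eta> * U z) / \<eta>) + c * (\<bar>t\<bar> * (C * exp (\<eta> * U z)))"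
    using u_diff[OF t] c order_trans[OF u_le[OF t] U_le] by (intro add_mono mult_left_mono) auto
  also have "\<dots> = \<bar>t\<bar> * ((\<bar>d\<bar> / \<eta> + c * C) * exp (\<eta> * U z))"
    by (simp add: algebra_simps)
  finally show ?thesis .
qed

lemma integrable_u: "\<bar>t\<bar> < \<delta> \<Longrightarrow> integrable M (u t)"
  and integrable_exp_u: "\<bar>t\<bar> < \<delta> \<Longrightarrow> integrable M (\<lambda>z. exp ((c + t * d) * u t z))"
proof -
  assume t: "\<bar>t\<bar> < \<delta>"
  have "c + t * d \<le> c + \<epsilon>" "0 < c + \<epsilon>" using \<delta>_small(1)[OF t] \<eta> \<epsilon> c by auto
  from lmean_le_lmean(3,4)[OF this u_meas[OF t] U_meas u_nonneg[OF t] u_le[OF t] U_int]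
  show "integrable M (u t)" "integrable M (\<lambda>z. exp ((c + t * d) * u t z))" by auto
qed

lemma lmean_U_nonneg: "0 \<le> lmean (c + \<epsilon>) M U"
  using c \<epsilon> by (intro lmean_le_lmean(1)[OF order_refl _ U_meas U_meas U_nonneg order_refl U_int]) simp

lemma
  assumes c_pos: "c > 0"
  shows integrable_deriv_pos: "integrable M (\<lambda>z. D z * exp (c * u 0 z))"
    and lmean_deriv_pos: "((\<lambda>t. lmean (c + t * d) M (u t)) has_real_derivative
      (\<integral>z. D z * exp (c * u 0 z) \<partial>M) / (\<integral>z. exp (c * u 0 z) \<partial>M) + d * lmean_slope c M (u 0)) (at 0)"
proof -
  define w where "w t z = exp ((c + t * d) * u t z)" for t z
  define K where "K = \<bar>d\<bar> / \<eta> + c * C"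
  define W where "W z = (d * u 0 z + c * D z) * exp (c * u 0 z)" for z
  have K: "K \<ge> 0" using \<eta> C c by (simp add: K_def)
  have 1: "w t \<in> borel_measurable M" if "\<bar>t\<bar> < \<delta>" for t
    unfolding w_def using u_meas[OF that] by measurable
  have 2: "\<bar>w t z - w 0 z\<bar> \<le> \<bar>t\<bar> * (K * exp ((c + \<epsilon>) * U z))" if t: "\<bar>t\<bar> < \<delta>" for t z
  proof -
    have "\<bar>w t z - w 0 z\<bar> \<le> \<bar>(c + t * d) * u t z - (c + 0 * d) * u 0 z\<bar> * exp ((c + \<epsilon> / 4) * U z)"
      unfolding w_def using cu_le[OF t] cu_le[OF zero_in_range] by (intro abs_exp_diff_le)
    also have "\<dots> \<le> \<bar>t\<bar> * (K * exp (\<eta> * U z)) * exp ((c + \<epsilon> / 4) * U z)"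
      using cu_diff[OF t, of z] by (intro mult_right_mono) (auto simp: K_def)
    also have "\<dots> = \<bar>t\<bar> * K * exp ((c + \<epsilon> / 4 + \<eta>) * U z)"
      by (simp add: algebra_simps flip: exp_add)
    also have "\<dots> \<le> \<bar>t\<bar> * K * exp ((c + \<epsilon>) * U z)"
      using K \<eta> \<epsilon> U_nonneg[of z] by (intro mult_left_mono) (auto intro!: mult_right_mono)
    finally show ?thesis by (simp add: mult.assoc)
  qed
  have 3: "integrable M (\<lambda>z. K * exp ((c + \<epsilon>) * U z))" using U_int by simp
  have 4: "integrable M (w 0)" unfolding w_def using integrable_exp_u[OF zero_in_range] by simp
  have 5: "((\<lambda>t. w t z) has_real_derivative W z) (at 0)" for z
    unfolding w_def W_def using u_deriv[of z]
    by (auto intro!: derivative_eq_intros simp: algebra_simps)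
  have iW: "integrable M W" by (rule integrable_derivative[OF \<delta> 1 2 3 4 5])
  have dW: "((\<lambda>t. \<integral>z. w t z \<partial>M) has_real_derivative (\<integral>z. W z \<partial>M)) (at 0)"
    by (rule has_derivative_integral[OF \<delta> 1 2 3 4 5])
  have u0: "u 0 \<in> borel_measurable M" by (rule u_meas[OF zero_in_range])
  have iu: "integrable M (\<lambda>z. u 0 z * exp (c * u 0 z))"
  proof (rule Bochner_Integration.integrable_bound)
    show "integrable M (\<lambda>z. exp ((c + \<epsilon>) * U z) / \<eta>)" using U_int by simp
    show "AE z in M. norm (u 0 z * exp (c * u 0 z)) \<le> norm (exp ((c + \<epsilon>) * U z) / \<eta>)"
    proof (intro AE_I2)
      fix z
      have "u 0 z * exp (c * u 0 z) \<le> (exp (\<eta> * U z) / \<eta>) * exp ((c + \<epsilon> / 4) * U z)"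
        using order_trans[OF u_le[OF zero_in_range] U_le] cu_le[OF zero_in_range, of z] u_nonneg[OF zero_in_range, of z] \<eta>
        by (intro mult_mono) auto
      also have "\<dots> = exp ((c + \<epsilon> / 4 + \<eta>) * U z) / \<eta>"
        by (simp add: algebra_simps flip: exp_add)
      also have "\<dots> \<le> exp ((c + \<epsilon>) * U z) / \<eta>"
        using \<eta> \<epsilon> U_nonneg[of z] by (intro divide_right_mono) (auto intro!: mult_right_mono)
      finally show "norm (u 0 z * exp (c * u 0 z)) \<le> norm (exp ((c + \<epsilon>) * U z) / \<eta>)"
        using u_nonneg[OF zero_in_range, of z] \<eta> by simp
    qed
  qed (use u0 in measurable)
  \<comment> \<open>Integrability of the term with \<open>D\<close> is reached indirectly:
    \<open>W\<close> is integrable as a limit of difference quotients, and the term with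
    \<open>u 0\<close> is subtracted.\<close>
  have "integrable M (\<lambda>z. (W z - d * (u 0 z * exp (c * u 0 z))) / c)"
    using iW iu by simp
  moreover have "(W z - d * (u 0 z * exp (c * u 0 z))) / c = D z * exp (c * u 0 z)" for z
    using c_pos by (simp add: W_def field_simps)
  ultimately show iD: "integrable M (\<lambda>z. D z * exp (c * u 0 z))" by simp
  define A where "A = (\<integral>z. exp (c * u 0 z) \<partial>M)"
  have A0: "A > 0" unfolding A_def using integrable_exp_u[OF zero_in_range] by (intro integral_exp_pos) simp
  have w0: "(\<integral>z. w 0 z \<partial>M) = A" by (simp add: w_def A_def)
  have "((\<lambda>t. 1 / (c + t * d) * ln (\<integral>z. w t z \<partial>M)) has_real_derivative
      1 / c * ((\<integral>z. W z \<partial>M) / A) - d / c\<^sup>2 * ln A) (at 0)"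
    using dW A0 c_pos
    by (auto intro!: derivative_eq_intros simp: w0 power2_eq_square diff_divide_distrib mult_ac)
  also have "(\<integral>z. W z \<partial>M) = d * (\<integral>z. u 0 z * exp (c * u 0 z) \<partial>M) + c * (\<integral>z. D z * exp (c * u 0 z) \<partial>M)"
  proof -
    have "W = (\<lambda>z. d * (u 0 z * exp (c * u 0 z)) + c * (D z * exp (c * u 0 z)))"
      by (simp add: W_def fun_eq_iff algebra_simps)
    then show ?thesis using iu iD by simp
  qed
  also have "1 / c * ((d * (\<integral>z. u 0 z * exp (c * u 0 z) \<partial>M) + c * (\<integral>z. D z * exp (c * u 0 z) \<partial>M)) / A) - d / c\<^sup>2 * ln A =
      (\<integral>z. D z * exp (c * u 0 z) \<partial>M) / (\<integral>z. exp (c * u 0 z) \<partial>M) + d * lmean_slope c M (u 0)"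
    using c_pos A0 by (simp add: lmean_slope_def flip: A_def) (simp add: field_simps)
  finally have der: "((\<lambda>t. 1 / (c + t * d) * ln (\<integral>z. w t z \<partial>M)) has_real_derivative
      (\<integral>z. D z * exp (c * u 0 z) \<partial>M) / (\<integral>z. exp (c * u 0 z) \<partial>M) + d * lmean_slope c M (u 0)) (at 0)" .
  have eq: "1 / (c + t * d) * ln (\<integral>z. w t z \<partial>M) = lmean (c + t * d) M (u t)" if "\<bar>t\<bar> < \<delta>" for t
  proof -
    have "\<bar>t * d\<bar> \<le> c / 2" by (rule \<delta>_small(2)[OF that c_pos])
    then have "c + t * d \<noteq> 0" using c_pos by linarith
    then show ?thesis by (simp add: lmean_def w_def)
  qed
  show "((\<lambda>t. lmean (c + t * d) M (u t)) has_real_derivative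
      (\<integral>z. D z * exp (c * u 0 z) \<partial>M) / (\<integral>z. exp (c * u 0 z) \<partial>M) + d * lmean_slope c M (u 0)) (at 0)"
    by (rule has_field_derivative_transform_within[OF der \<delta>]) (simp_all only: dist_0_norm dist_commute[of _ 0] real_norm_def eq UNIV_I)
qed

text \<open>For \<open>c = 0\<close> the exponent vanishes at the base point; \<open>(exp (c * y) - 1) / c\<close> is
  continued to \<open>c = 0\<close> by means of \<^const>\<open>exp_remainder\<close>.\<close>

definition reduced :: "real \<Rightarrow> 'a \<Rightarrow> real" where
  "reduced t z = u t z + t * (d * (u t z)\<^sup>2 * exp_remainder (t * d * u t z))"

lemma reduced_diff:
  assumes t: "\<bar>t\<bar> < \<delta>"
  shows "\<bar>reduced t z - u t z\<bar> \<le> \<bar>t\<bar> * (\<bar>d\<bar> / \<eta>\<^sup>2 * exp (3 * \<eta> * U z))"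
proof -
  have "\<bar>reduced t z - u t z\<bar> = \<bar>t\<bar> * \<bar>d\<bar> * ((u t z)\<^sup>2 * \<bar>exp_remainder (t * d * u t z)\<bar>)"
    by (simp add: reduced_def abs_mult)
  \<comment> \<open>The rate \<open>2 * \<eta>\<close> pays for the square of \<open>u t z\<close>,
    a further \<open>\<eta>\<close> for the remainder, whose argument is at most
    \<open>\<eta> * U z\<close> in absolute value.\<close>
  also have "\<dots> \<le> \<bar>t\<bar> * \<bar>d\<bar> * ((exp (2 * \<eta> * U z) / \<eta>\<^sup>2) * exp (\<eta> * U z))"
  proof (intro mult_left_mono mult_mono)
    show "(u t z)\<^sup>2 \<le> exp (2 * \<eta> * U z) / \<eta>\<^sup>2"
      using power_mono[OF u_le[OF t, of z] u_nonneg[OF t, of z], of 2] U_sq_le[of z] by linarith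
    have "\<bar>t * d * u t z\<bar> \<le> \<eta> * U z"
      using \<delta>_small(1)[OF t] u_le[OF t, of z] u_nonneg[OF t, of z] \<eta>
      unfolding abs_mult[of "t * d"] by (intro mult_mono) auto
    then show "\<bar>exp_remainder (t * d * u t z)\<bar> \<le> exp (\<eta> * U z)"
      using abs_exp_remainder_quotient_le[of "t * d * u t z"] by (meson exp_le_cancel_iff order_trans)
  qed auto
  also have "\<dots> = \<bar>t\<bar> * (\<bar>d\<bar> / \<eta>\<^sup>2 * exp (3 * \<eta> * U z))"
    by (simp flip: exp_add)
  finally show ?thesis .
qed

lemma reduced_measurable: "\<bar>t\<bar> < \<delta> \<Longrightarrow> reduced t \<in> borel_measurable M"
  unfolding reduced_def using u_meas[of t] by measurable

lemma integrable_reduced: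
  assumes t: "\<bar>t\<bar> < \<delta>"
  shows "integrable M (reduced t)"
proof -
  have "integrable M (\<lambda>z. reduced t z - u t z)"
  proof (rule Bochner_Integration.integrable_bound)
    have "3 * \<eta> \<le> c + \<epsilon>" using \<eta> \<epsilon> c by linarith
    then show "integrable M (\<lambda>z. \<bar>t\<bar> * (\<bar>d\<bar> / \<eta>\<^sup>2 * exp (3 * \<eta> * U z)))"
      by (intro integrable_mult_right integrable_exp_U)
    show "AE z in M. norm (reduced t z - u t z) \<le> norm (\<bar>t\<bar> * (\<bar>d\<bar> / \<eta>\<^sup>2 * exp (3 * \<eta> * U z)))"
      unfolding real_norm_def by (intro AE_I2 order_trans[OF reduced_diff[OF t] abs_ge_self])
  qed (use reduced_measurable[OF t] u_meas[OF t] in measurable)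
  from Bochner_Integration.integrable_add[OF this integrable_u[OF t]] show ?thesis by simp
qed

lemma integral_exp_eq_reduced:
  assumes t: "\<bar>t\<bar> < \<delta>"
  shows "(\<integral>z. exp (t * d * u t z) \<partial>M) = 1 + t * d * (\<integral>z. reduced t z \<partial>M)"
proof -
  have "exp (t * d * u t z) = 1 + t * d * reduced t z" for z
    using exp_eq_remainder[of "t * d" "u t z"] by (simp add: reduced_def mult.assoc)
  then show ?thesis using integrable_reduced[OF t] by (simp add: prob_space)
qed

text \<open>The variance in the slope has two sources: \<open>exp_remainder 0 = 1 / 2\<close> yields
  the mean square, \<open>ln_remainder 0 = - 1 / 2\<close> the square of the mean.\<close>

lemma
  assumes c_zero: "c = 0"
  shows integrable_deriv_zero: "integrable M D"
    and lmean_deriv_zero: "((\<lambda>t. lmean (t * d) M (u t)) has_real_derivative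
      (\<integral>z. D z \<partial>M) + d * lmean_slope 0 M (u 0)) (at 0)"
proof -
  define H where "H z = (C + \<bar>d\<bar> / \<eta>\<^sup>2) * exp (\<epsilon> * U z)" for z
  define W where "W z = D z + d * (u 0 z)\<^sup>2 / 2" for z
  have r0: "reduced 0 = u 0" by (simp add: reduced_def fun_eq_iff)
  have 2: "\<bar>reduced t z - reduced 0 z\<bar> \<le> \<bar>t\<bar> * H z" if t: "\<bar>t\<bar> < \<delta>" for t z
  proof -
    have "\<bar>reduced t z - reduced 0 z\<bar> \<le> \<bar>u t z - u 0 z\<bar> + \<bar>reduced t z - u t z\<bar>"
      by (simp add: r0)
    also have "\<dots> \<le> \<bar>t\<bar> * (C * exp (\<eta> * U z)) + \<bar>t\<bar> * (\<bar>d\<bar> / \<eta>\<^sup>2 * exp (3 * \<eta> * U z))"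
      using u_diff[OF t] reduced_diff[OF t] by (intro add_mono)
    also have "\<dots> \<le> \<bar>t\<bar> * (C * exp (\<epsilon> * U z)) + \<bar>t\<bar> * (\<bar>d\<bar> / \<eta>\<^sup>2 * exp (\<epsilon> * U z))"
      using C \<eta> \<epsilon> U_nonneg[of z] by (intro add_mono mult_left_mono) (auto intro!: mult_right_mono)
    finally show ?thesis by (simp add: H_def algebra_simps)
  qed
  have 3: "integrable M H" unfolding H_def using c_zero by (intro integrable_mult_right integrable_exp_U) simp
  have 4: "integrable M (reduced 0)" by (rule integrable_reduced[OF zero_in_range])
  have 5: "((\<lambda>t. reduced t z) has_real_derivative W z) (at 0)" for z
  proof -
    have "isCont (\<lambda>t. t * d * u t z) 0"
      by (intro isCont_mult u_cont continuous_ident continuous_const)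
    then have "isCont (\<lambda>t. exp_remainder (t * d * u t z)) 0"
      by (rule isCont_o2) (simp add: isCont_exp_remainder)
    then have "isCont (\<lambda>t. d * (u t z)\<^sup>2 * exp_remainder (t * d * u t z)) 0"
      by (intro isCont_mult isCont_power u_cont continuous_const)
    from DERIV_add[OF u_deriv[of z] has_derivative_mult_isCont[OF this]]
    show ?thesis by (simp add: reduced_def[abs_def] W_def exp_remainder_def)
  qed
  have iW: "integrable M W" by (rule integrable_derivative[OF \<delta> reduced_measurable 2 3 4 5])
  have dW: "((\<lambda>t. \<integral>z. reduced t z \<partial>M) has_real_derivative (\<integral>z. W z \<partial>M)) (at 0)"
    by (rule has_derivative_integral[OF \<delta> reduced_measurable 2 3 4 5])
  have iu: "integrable M (\<lambda>z. (u 0 z)\<^sup>2)"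
  proof (rule Bochner_Integration.integrable_bound)
    show "integrable M (\<lambda>z. exp (2 * \<eta> * U z) / \<eta>\<^sup>2)"
      using \<eta> \<epsilon> c by (intro integrable_divide integrable_exp_U) linarith
    show "AE z in M. norm ((u 0 z)\<^sup>2) \<le> norm (exp (2 * \<eta> * U z) / \<eta>\<^sup>2)"
    proof (intro AE_I2)
      fix z
      have "(u 0 z)\<^sup>2 \<le> exp (2 * \<eta> * U z) / \<eta>\<^sup>2"
        using power_mono[OF u_le[OF zero_in_range, of z] u_nonneg[OF zero_in_range, of z], of 2] U_sq_le[of z] by linarith
      then show "norm ((u 0 z)\<^sup>2) \<le> norm (exp (2 * \<eta> * U z) / \<eta>\<^sup>2)" by simp
    qed
  qed (use u_meas[OF zero_in_range] in measurable)
  have "integrable M (\<lambda>z. W z - d * (u 0 z)\<^sup>2 / 2)" using iW iu by simp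
  then show iD: "integrable M D" by (simp add: W_def)
  define E where "E t = (\<integral>z. reduced t z \<partial>M)" for t
  have E0: "E 0 = (\<integral>z. u 0 z \<partial>M)" by (simp add: E_def r0)
  have contE: "isCont E 0" unfolding E_def using dW by (rule DERIV_isCont)
  have "isCont (\<lambda>t. t * d * E t) 0"
    by (intro isCont_mult contE continuous_ident continuous_const)
  then have "isCont (\<lambda>t. ln_remainder (t * d * E t)) 0"
    by (rule isCont_o2) (simp add: isCont_ln_remainder)
  then have "isCont (\<lambda>t. d * (E t)\<^sup>2 * ln_remainder (t * d * E t)) 0"
    by (intro isCont_mult isCont_power contE continuous_const)
  from DERIV_add[OF dW has_derivative_mult_isCont[OF this]]
  have "((\<lambda>t. E t + t * (d * (E t)\<^sup>2 * ln_remainder (t * d * E t))) has_real_derivative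
      (\<integral>z. W z \<partial>M) - d * (E 0)\<^sup>2 / 2) (at 0)"
    by (simp add: ln_remainder_def E_def)
  also have "(\<integral>z. W z \<partial>M) - d * (E 0)\<^sup>2 / 2 = (\<integral>z. D z \<partial>M) + d * lmean_slope 0 M (u 0)"
    using iu iD by (simp add: W_def[abs_def] lmean_slope_def E0 field_simps)
  finally have der: "((\<lambda>t. E t + t * (d * (E t)\<^sup>2 * ln_remainder (t * d * E t))) has_real_derivative
      (\<integral>z. D z \<partial>M) + d * lmean_slope 0 M (u 0)) (at 0)" .
  have eq: "E t + t * (d * (E t)\<^sup>2 * ln_remainder (t * d * E t)) = lmean (t * d) M (u t)" if t: "\<bar>t\<bar> < \<delta>" for t
  \<comment> \<open>This includes \<open>d = 0\<close> with \<open>t \<noteq> 0\<close>, where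
    \<open>lmean\<close> is the plain integral as well.\<close>
  proof (cases "t * d = 0")
    case True
    then have "t * (d * (E t)\<^sup>2 * ln_remainder (t * d * E t)) = 0" by auto
    moreover have "reduced t = u t" using True by (auto simp: reduced_def fun_eq_iff)
    ultimately show ?thesis unfolding lmean_def if_P[OF True] by (simp add: E_def)
  next
    case False
    have "lmean (t * d) M (u t) = 1 / (t * d) * ln (1 + t * d * E t)"
      using integral_exp_eq_reduced[OF t] False by (simp add: lmean_def E_def)
    also have "\<dots> = E t + t * (d * (E t)\<^sup>2 * ln_remainder (t * d * E t))"
      using False unfolding ln_eq_remainder[of "t * d * E t"] by (simp add: field_simps power2_eq_square)
    finally show ?thesis by simp
  qed
  show "((\<lambda>t. lmean (t * d) M (u t)) has_real_derivative
      (\<integral>z. D z \<partial>M) + d * lmean_slope 0 M (u 0)) (at 0)"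
    by (rule has_field_derivative_transform_within[OF der \<delta>]) (simp_all only: dist_0_norm dist_commute[of _ 0] real_norm_def eq UNIV_I)
qed

lemma integrable_deriv: "integrable M (\<lambda>z. D z * exp (c * u 0 z))"
  using integrable_deriv_pos integrable_deriv_zero c by (cases "c = 0") auto

lemma lmean_deriv: "((\<lambda>t. lmean (c + t * d) M (u t)) has_real_derivative
    (\<integral>z. D z * exp (c * u 0 z) \<partial>M) / (\<integral>z. exp (c * u 0 z) \<partial>M) + d * lmean_slope c M (u 0)) (at 0)"
  using lmean_deriv_pos lmean_deriv_zero c by (cases "c = 0") (auto simp: prob_space)

section \<open>Passing the growth bound down one level\<close>

lemma ln_integral_exp_U: "ln (\<integral>z. exp ((c + \<epsilon>) * U z) \<partial>M) = (c + \<epsilon>) * lmean (c + \<epsilon>) M U"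
  using c \<epsilon> by (simp add: lmean_def)

text \<open>The bound has the form of \<open>u_diff\<close>, with the dominating function of the
  level below in place of \<open>U\<close>. Tilting with \<open>s = 3 * \<epsilon> / 4\<close>
  multiplies the rate by \<open>4 * (c + \<epsilon>) / (3 * \<epsilon>)\<close>, whence the
  condition on \<open>\<eta>'\<close>.\<close>

lemma lmean_growth_pos:
  assumes c_pos: "c > 0" and \<eta>': "4 * \<eta> * (c + \<epsilon>) \<le> 3 * \<epsilon> * \<eta>'" and t: "\<bar>t\<bar> < \<delta>"
  shows "\<bar>lmean (c + t * d) M (u t) - lmean c M (u 0)\<bar> \<le>
    \<bar>t\<bar> * ((2 * (\<bar>d\<bar> / \<eta> + c * C) / c + 2 * \<bar>d\<bar> * (c + \<epsilon>) / (c\<^sup>2 * \<eta>')) * exp (\<eta>' * lmean (c + \<epsilon>) M U))"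
proof -
  define V where "V = lmean (c + \<epsilon>) M U"
  define K where "K = \<bar>d\<bar> / \<eta> + c * C"
  define g where "g \<tau> z = (c + \<tau> * d) * u \<tau> z" for \<tau> z
  define \<Lambda> where "\<Lambda> \<tau> = ln (\<integral>z. exp (g \<tau> z) \<partial>M)" for \<tau>
  have V: "V \<ge> 0" unfolding V_def by (rule lmean_U_nonneg)
  have K: "K \<ge> 0" using \<eta> C c by (simp add: K_def)
  have "0 < 4 * \<eta> * (c + \<epsilon>)" using \<eta> c \<epsilon> by simp
  with \<eta>' have "0 < 3 * \<epsilon> * \<eta>'" by linarith
  then have \<eta>'0: "\<eta>' > 0" using \<epsilon> by (simp add: zero_less_mult_iff)
  have g_meas: "g \<tau> \<in> borel_measurable M" if "\<bar>\<tau>\<bar> < \<delta>" for \<tau>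
    unfolding g_def using u_meas[OF that] by measurable
  have ig: "integrable M (\<lambda>z. exp (g \<tau> z))" if "\<bar>\<tau>\<bar> < \<delta>" for \<tau>
    unfolding g_def by (rule integrable_exp_u[OF that])
  have half: "c / 2 \<le> c + \<tau> * d" if "\<bar>\<tau>\<bar> < \<delta>" for \<tau>
    using \<delta>_small(2)[OF that c_pos] by linarith
  have g0: "0 \<le> g \<tau> z" if "\<bar>\<tau>\<bar> < \<delta>" for \<tau> z
    unfolding g_def using half[OF that] c_pos u_nonneg[OF that] by (intro mult_nonneg_nonneg) auto
  have one: "1 \<le> (\<integral>z. exp (g \<tau> z) \<partial>M)" if "\<bar>\<tau>\<bar> < \<delta>" for \<tau>
  proof -
    have "(\<integral>z. 1 \<partial>M) \<le> (\<integral>z. exp (g \<tau> z) \<partial>M)"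
      using g0[OF that] by (intro integral_mono ig that) auto
    then show ?thesis by (simp add: prob_space)
  qed
  \<comment> \<open>Two arbitrary parameters, because the bound is applied in both orders to
    \<open>t\<close> and 0.\<close>
  have diff: "\<Lambda> \<tau> - \<Lambda> \<tau>' \<le> \<bar>t\<bar> * (K * exp (\<eta>' * V))"
    if \<tau>: "\<bar>\<tau>\<bar> < \<delta>" "\<bar>\<tau>'\<bar> < \<delta>" and d: "\<And>z. \<bar>g \<tau> z - g \<tau>' z\<bar> \<le> \<bar>t\<bar> * (K * exp (\<eta> * U z))" for \<tau> \<tau>'
  proof -
    note [measurable] = g_meas[OF \<tau>(1)] g_meas[OF \<tau>(2)]
    let ?A = "\<integral>z. exp (g \<tau> z) \<partial>M"
    have A: "1 \<le> ?A" by (rule one[OF \<tau>(1)])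
    have w: "exp (g \<tau> z) \<le> exp ((c + \<epsilon> / 4) * U z)" for z
      using cu_le[OF \<tau>(1)] by (simp add: g_def)
    have s: "\<eta> \<le> 3 * \<epsilon> / 4" using \<eta> \<epsilon> by linarith
    have a: "c + \<epsilon> / 4 + 3 * \<epsilon> / 4 = c + \<epsilon>" by simp
    have it: "integrable M (\<lambda>z. exp (g \<tau> z) * exp (\<eta> * U z))"
      by (rule integrable_tilted[OF _ U_meas A exp_ge_zero w \<eta>(1) s]) (use U_int ig[OF \<tau>(1)] in \<open>auto simp: a\<close>)
    have "(\<integral>z. exp (g \<tau> z) * exp (\<eta> * U z) \<partial>M) \<le> ?A * exp (\<eta> / (3 * \<epsilon> / 4) * ln (\<integral>z. exp ((c + \<epsilon> / 4 + 3 * \<epsilon> / 4) * U z) \<partial>M))"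
      by (rule tilted_mean_le[OF _ U_meas A exp_ge_zero w \<eta>(1) s]) (use U_int ig[OF \<tau>(1)] in \<open>auto simp: a\<close>)
    also have "\<dots> = ?A * exp (4 * \<eta> * (c + \<epsilon>) / (3 * \<epsilon>) * V)"
      unfolding a ln_integral_exp_U V_def[symmetric] by (simp add: field_simps)
    also have "\<dots> \<le> ?A * exp (\<eta>' * V)"
    proof -
      have "4 * \<eta> * (c + \<epsilon>) / (3 * \<epsilon>) \<le> \<eta>'" using \<eta>' \<epsilon> by (simp add: divide_le_eq mult_ac)
      then show ?thesis using A V
        by (intro mult_left_mono iffD2[OF exp_le_cancel_iff] mult_right_mono) auto
    qed
    finally have tilt: "(\<integral>z. exp (g \<tau> z) * exp (\<eta> * U z) \<partial>M) \<le> ?A * exp (\<eta>' * V)" .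
    have i1: "integrable M (\<lambda>z. (g \<tau> z - g \<tau>' z) * exp (g \<tau> z))"
    proof (rule Bochner_Integration.integrable_bound)
      show "integrable M (\<lambda>z. \<bar>t\<bar> * (K * (exp (g \<tau> z) * exp (\<eta> * U z))))" using it by simp
      show "AE z in M. norm ((g \<tau> z - g \<tau>' z) * exp (g \<tau> z)) \<le> norm (\<bar>t\<bar> * (K * (exp (g \<tau> z) * exp (\<eta> * U z))))"
      proof (intro AE_I2)
        fix z
        have "\<bar>g \<tau> z - g \<tau>' z\<bar> * exp (g \<tau> z) \<le> \<bar>t\<bar> * (K * exp (\<eta> * U z)) * exp (g \<tau> z)"
          using d by (rule mult_right_mono) simp
        then show "norm ((g \<tau> z - g \<tau>' z) * exp (g \<tau> z)) \<le> norm (\<bar>t\<bar> * (K * (exp (g \<tau> z) * exp (\<eta> * U z))))"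
          using K by (simp add: abs_mult mult_ac)
      qed
    qed measurable
    have "\<Lambda> \<tau> - \<Lambda> \<tau>' \<le> (\<integral>z. (g \<tau> z - g \<tau>' z) * exp (g \<tau> z) \<partial>M) / ?A"
      unfolding \<Lambda>_def by (rule ln_integral_exp_diff_le[OF ig[OF \<tau>(1)] ig[OF \<tau>(2)] i1])
    also have "\<dots> \<le> (\<integral>z. \<bar>t\<bar> * (K * (exp (g \<tau> z) * exp (\<eta> * U z))) \<partial>M) / ?A"
    proof (intro divide_right_mono integral_mono i1)
      show "integrable M (\<lambda>z. \<bar>t\<bar> * (K * (exp (g \<tau> z) * exp (\<eta> * U z))))" using it by simp
      fix z
      have "(g \<tau> z - g \<tau>' z) * exp (g \<tau> z) \<le> \<bar>t\<bar> * (K * exp (\<eta> * U z)) * exp (g \<tau> z)"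
        using order_trans[OF abs_ge_self d] by (rule mult_right_mono) simp
      then show "(g \<tau> z - g \<tau>' z) * exp (g \<tau> z) \<le> \<bar>t\<bar> * (K * (exp (g \<tau> z) * exp (\<eta> * U z)))"
        by (simp add: mult_ac)
    qed (use A in simp)
    also have "\<dots> \<le> \<bar>t\<bar> * (K * (?A * exp (\<eta>' * V))) / ?A"
      using tilt K A by (intro divide_right_mono) (auto intro!: mult_left_mono)
    also have "\<dots> = \<bar>t\<bar> * (K * exp (\<eta>' * V))" using A by simp
    finally show ?thesis .
  qed
  have dg: "\<bar>g t z - g 0 z\<bar> \<le> \<bar>t\<bar> * (K * exp (\<eta> * U z))" for z
    using cu_diff[OF t, of z] by (simp add: g_def K_def)
  have L: "\<bar>\<Lambda> t - \<Lambda> 0\<bar> \<le> \<bar>t\<bar> * (K * exp (\<eta>' * V))"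
    using diff[OF t zero_in_range dg] diff[OF zero_in_range t] dg by (simp add: abs_le_iff abs_minus_commute)
  have \<Lambda>0: "0 \<le> \<Lambda> 0" "\<Lambda> 0 \<le> (c + \<epsilon>) * V"
  proof -
    show "0 \<le> \<Lambda> 0" unfolding \<Lambda>_def using one[OF zero_in_range] by simp
    have "g 0 z \<le> (c + \<epsilon>) * U z" for z
      using order_trans[OF cu_le[OF zero_in_range, of z] mult_right_mono[OF _ U_nonneg, of _ "c + \<epsilon>"]] \<epsilon>
      by (simp add: g_def)
    then have "(\<integral>z. exp (g 0 z) \<partial>M) \<le> (\<integral>z. exp ((c + \<epsilon>) * U z) \<partial>M)"
      by (intro integral_mono ig zero_in_range U_int) simp
    then show "\<Lambda> 0 \<le> (c + \<epsilon>) * V"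
      unfolding \<Lambda>_def V_def ln_integral_exp_U[symmetric] using one[OF zero_in_range] by (intro ln_mono) auto
  qed
  have ct: "c + t * d > 0" using half[OF t] c_pos by linarith
  have "lmean (c + t * d) M (u t) - lmean c M (u 0) = \<Lambda> t / (c + t * d) - \<Lambda> 0 / c"
    using ct c_pos by (simp add: lmean_def \<Lambda>_def g_def)
  \<comment> \<open>The change of the integral is separated from the change of the prefactor. The
    latter is controlled by \<open>\<Lambda> 0 \<le> (c + \<epsilon>) * V\<close> and
    \<open>V \<le> exp (\<eta>' * V) / \<eta>'\<close>.\<close>
  also have "\<dots> = (\<Lambda> t - \<Lambda> 0) / (c + t * d) - t * d * \<Lambda> 0 / (c * (c + t * d))"
  proof -
    have "a / r - b / c = (a - b) / r - (r - c) * b / (c * r)" if "r > 0" for a b r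
      using that c_pos by (simp add: field_simps)
    from this[OF ct] show ?thesis by simp
  qed
  finally have "\<bar>lmean (c + t * d) M (u t) - lmean c M (u 0)\<bar> \<le>
      \<bar>\<Lambda> t - \<Lambda> 0\<bar> / (c + t * d) + \<bar>t\<bar> * \<bar>d\<bar> * \<Lambda> 0 / (c * (c + t * d))"
    using ct c_pos \<Lambda>0(1) by (auto intro!: order_trans[OF abs_triangle_ineq4] simp: abs_mult)
  also have "\<dots> \<le> (\<bar>t\<bar> * (K * exp (\<eta>' * V))) / (c / 2) + \<bar>t\<bar> * \<bar>d\<bar> * ((c + \<epsilon>) * (exp (\<eta>' * V) / \<eta>')) / (c * (c / 2))"
  proof (intro add_mono frac_le mult_left_mono L half t)
    have "(c + \<epsilon>) * V \<le> (c + \<epsilon>) * (exp (\<eta>' * V) / \<eta>')"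
      using le_exp_divide[OF \<eta>'0] c \<epsilon> by (intro mult_left_mono) auto
    then show "\<Lambda> 0 \<le> (c + \<epsilon>) * (exp (\<eta>' * V) / \<eta>')" using \<Lambda>0(2) by linarith
  qed (use K c_pos \<epsilon> \<eta>'0 in \<open>auto intro!: mult_nonneg_nonneg\<close>)
  also have "\<dots> = \<bar>t\<bar> * ((2 * K / c + 2 * \<bar>d\<bar> * (c + \<epsilon>) / (c\<^sup>2 * \<eta>')) * exp (\<eta>' * V))"
    using c_pos \<eta>'0 by (simp add: field_simps power2_eq_square)
  finally show ?thesis by (simp add: K_def V_def)
qed

text \<open>The mean at exponent \<open>t * d\<close> is compared with the plain mean of
  \<open>u t\<close>, and this with the plain mean of \<open>u 0\<close>. The law is not tilted at
  exponent 0, so the rate grows only to \<open>3 * \<eta>\<close>, the one in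
  \<open>reduced_diff\<close>.\<close>

lemma lmean_growth_zero:
  assumes c_zero: "c = 0" and \<eta>': "3 * \<eta> \<le> \<eta>'" and t: "\<bar>t\<bar> < \<delta>"
  shows "\<bar>lmean (c + t * d) M (u t) - lmean c M (u 0)\<bar> \<le>
    \<bar>t\<bar> * ((\<bar>d\<bar> / \<eta>\<^sup>2 + C) * exp (\<eta>' * lmean (c + \<epsilon>) M U))"
proof -
  define V where "V = lmean \<epsilon> M U"
  have V: "V \<ge> 0" unfolding V_def using lmean_U_nonneg c_zero by simp
  have tilt: "(\<integral>z. exp (b * U z) \<partial>M) \<le> exp (\<eta>' * V)" if b: "0 < b" "b \<le> 3 * \<eta>" for b
  proof -
    have b\<epsilon>: "b \<le> \<epsilon>" using b \<eta> \<epsilon> by linarith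
    have i: "integrable M (\<lambda>z. exp ((0 + \<epsilon>) * U z))" using U_int c_zero by simp
    have "(\<integral>z. 1 * exp (b * U z) \<partial>M) \<le> (\<integral>z. 1 \<partial>M) * exp (b / \<epsilon> * ln (\<integral>z. exp ((0 + \<epsilon>) * U z) \<partial>M))"
      by (rule tilted_mean_le[OF _ U_meas _ _ _ b(1) b\<epsilon> i]) (auto simp: prob_space)
    also have "\<dots> = exp (b * V)" using \<epsilon> by (simp add: prob_space V_def lmean_def)
    also have "\<dots> \<le> exp (\<eta>' * V)" using b \<eta>' V by (auto intro!: mult_right_mono)
    finally show ?thesis by simp
  qed
  define E where "E = (\<integral>z. reduced t z \<partial>M)"
  have iu: "integrable M (u t)" and iu0: "integrable M (u 0)"
    using integrable_u t zero_in_range by auto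
  have ie: "integrable M (\<lambda>z. exp (b * U z))" if "b \<le> 3 * \<eta>" for b
    using that \<eta> \<epsilon> c by (intro integrable_exp_U) linarith
  have abs_int: "\<bar>(\<integral>z. f z \<partial>M) - (\<integral>z. f' z \<partial>M)\<bar> \<le> \<bar>t\<bar> * (k * exp (\<eta>' * V))"
    if "integrable M f" "integrable M f'" "0 < b" "b \<le> 3 * \<eta>" "k \<ge> 0" "\<And>z. \<bar>f z - f' z\<bar> \<le> \<bar>t\<bar> * (k * exp (b * U z))"
    for f f' :: "'a \<Rightarrow> real" and b k
  proof -
    have "\<bar>(\<integral>z. f z \<partial>M) - (\<integral>z. f' z \<partial>M)\<bar> = \<bar>\<integral>z. f z - f' z \<partial>M\<bar>" using that by simp
    also have "\<dots> \<le> (\<integral>z. \<bar>f z - f' z\<bar> \<partial>M)" by (rule integral_abs_bound)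
    also have "\<dots> \<le> (\<integral>z. \<bar>t\<bar> * (k * exp (b * U z)) \<partial>M)"
      using that ie[OF that(4)] by (intro integral_mono) auto
    also have "\<dots> = \<bar>t\<bar> * (k * (\<integral>z. exp (b * U z) \<partial>M))" by simp
    also have "\<dots> \<le> \<bar>t\<bar> * (k * exp (\<eta>' * V))"
      using tilt[OF that(3,4)] that(5) by (intro mult_left_mono) auto
    finally show ?thesis .
  qed
  have 1: "\<bar>(\<integral>z. u t z \<partial>M) - (\<integral>z. u 0 z \<partial>M)\<bar> \<le> \<bar>t\<bar> * (C * exp (\<eta>' * V))"
    using iu iu0 \<eta> C u_diff[OF t] by (intro abs_int[of "u t" "u 0" \<eta>]) auto
  have 2: "\<bar>E - (\<integral>z. u t z \<partial>M)\<bar> \<le> \<bar>t\<bar> * (\<bar>d\<bar> / \<eta>\<^sup>2 * exp (\<eta>' * V))"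
    unfolding E_def using iu integrable_reduced[OF t] \<eta> reduced_diff[OF t] by (intro abs_int[of "reduced t" "u t" "3 * \<eta>"]) auto
  have ieu: "integrable M (\<lambda>z. exp (t * d * u t z))"
    using integrable_exp_u[OF t] c_zero by simp
  have eq: "(\<integral>z. exp (t * d * u t z) \<partial>M) = 1 + t * d * E"
    unfolding E_def by (rule integral_exp_eq_reduced[OF t])
  have pos: "0 < 1 + t * d * E" using integral_exp_pos[OF ieu] by (simp add: eq)
  have ln1: "ln (1 + t * d * E) \<le> t * d * E" using ln_le_minus_one[OF pos] by simp
  have "exp (\<integral>z. t * d * u t z \<partial>M) \<le> 1 + t * d * E"
    unfolding eq[symmetric] using iu ieu by (intro exp_integral_le) auto
  then have ln2: "t * d * (\<integral>z. u t z \<partial>M) \<le> ln (1 + t * d * E)"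
    using pos by (simp add: ln_ge_iff)
  \<comment> \<open>The exponential mean lies between the plain mean and \<open>E\<close>, by
    Jensen's inequality on one side and \<open>ln y \<le> y - 1\<close> on the other; the sign of
    \<open>t * d\<close> decides the order.\<close>
  have "\<bar>lmean (t * d) M (u t) - (\<integral>z. u t z \<partial>M)\<bar> \<le> \<bar>E - (\<integral>z. u t z \<partial>M)\<bar>"
  proof -
    consider "t * d = 0" | "t * d > 0" | "t * d < 0" by linarith
    then show ?thesis
    proof cases
      case 1
      then show ?thesis unfolding lmean_def if_P[OF 1] by simp
    next
      case 2
      then have "t * d \<noteq> 0" by (metis less_irrefl)
      then have "lmean (t * d) M (u t) = ln (1 + t * d * E) / (t * d)"
        unfolding lmean_def eq by (simp only: if_False) simp
      moreover have "ln (1 + t * d * E) / (t * d) \<le> E" "(\<integral>z. u t z \<partial>M) \<le> ln (1 + t * d * E) / (t * d)"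
        using 2 ln1 ln2 by (simp_all add: pos_divide_le_eq pos_le_divide_eq mult.commute)
      ultimately show ?thesis by linarith
    next
      case 3
      then have "t * d \<noteq> 0" by (metis less_irrefl)
      then have "lmean (t * d) M (u t) = ln (1 + t * d * E) / (t * d)"
        unfolding lmean_def eq by (simp only: if_False) simp
      moreover have "E \<le> ln (1 + t * d * E) / (t * d)" "ln (1 + t * d * E) / (t * d) \<le> (\<integral>z. u t z \<partial>M)"
        using 3 ln1 ln2 by (simp_all add: neg_divide_le_eq neg_le_divide_eq mult.commute)
      ultimately show ?thesis by linarith
    qed
  qed
  with 1 2 have "\<bar>lmean (t * d) M (u t) - (\<integral>z. u 0 z \<partial>M)\<bar> \<le> \<bar>t\<bar> * (C * exp (\<eta>' * V)) + \<bar>t\<bar> * (\<bar>d\<bar> / \<eta>\<^sup>2 * exp (\<eta>' * V))"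
    by linarith
  then show ?thesis by (simp add: c_zero lmean_def[of 0] V_def algebra_simps)
qed

end

section \<open>The Parisi recursion\<close>

lemma even_convex_nonneg:
  fixes f :: "real \<Rightarrow> real"
  assumes "convex_on UNIV f" "\<And>x. f (- x) = f x" "f 0 = 0"
  shows "0 \<le> f x"
  using convex_onD[OF assms(1), of "1 / 2" x "- x"] assms(2,3) by (simp add: algebra_simps)

lemma convex_deriv_mono:
  fixes f :: "real \<Rightarrow> real"
  assumes f: "convex_on UNIV f" and diff: "\<And>x. f differentiable (at x)" and "a \<le> b"
  shows "deriv f a \<le> deriv f b"
proof (cases "a = b")
  case False
  have D: "(f has_real_derivative deriv f x) (at x)" for x
    using diff DERIV_deriv_iff_real_differentiable by blast
  have "f y - f x \<ge> deriv f x * (y - x)" for x y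
    using D by (intro convex_on_imp_above_tangent[OF f]) auto
  from this[of a b] this[of b a] have "deriv f a * (b - a) \<le> deriv f b * (b - a)"
    by (simp add: algebra_simps)
  then show ?thesis using False \<open>a \<le> b\<close> by (simp add: mult_le_cancel_right)
qed simp

text \<open>The comparison with \<open>f0 = f1 = F\<close> and equal exponents is exactly
  convexity.\<close>

lemma gmean_convex:
  assumes F: "convex_on UNIV F" and c: "0 \<le> c" and s: "0 \<le> s"
    and int: "\<And>x. integrable gauss (\<lambda>g. exp (c * F (x + s * g)))"
      "\<And>x. c = 0 \<Longrightarrow> integrable gauss (\<lambda>g. F (x + s * g))"
  shows "convex_on UNIV (gmean c s F)"
proof (rule convex_onI)
  fix t x y :: real assume t: "0 < t" "t < 1"
  have "gmean c s F ((1 - t) * x + t * y) \<le> (1 - t) * gmean c s F x + t * gmean c s F y"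
  proof (rule gmean_comparison[OF t c c _ F s int(1) int(1) int(1) int(2) int(2) int(2)])
    show "F ((1 - t) * x + t * y) \<le> (1 - t) * F x + t * F y" for x y
      using convex_onD[OF F, of t x y] t by simp
  qed (simp_all add: algebra_simps)
  then show "gmean c s F ((1 - t) *\<^sub>R x + t *\<^sub>R y) \<le> (1 - t) * gmean c s F x + t * gmean c s F y"
    by simp
qed auto

text \<open>Nonnegativity of \<open>\<Phi>\<close> stems from convexity, evenness and
  \<open>\<Phi> 0 = 0\<close>, that of the variances from convexity of \<open>\<xi>\<close> and the
  ordering of \<open>q\<close>.\<close>

locale parisi_functional =
  fixes k :: nat and \<Phi> \<xi> :: "real \<Rightarrow> real" and q :: "nat \<Rightarrow> real"
  assumes \<Phi>_convex: "convex_on UNIV \<Phi>" and \<Phi>_nonneg: "\<And>x. 0 \<le> \<Phi> x"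
    and variance: "\<And>l. l \<le> k \<Longrightarrow> 0 \<le> deriv \<xi> (q (Suc l)) - deriv \<xi> (q l)"
begin

abbreviation "level \<equiv> parisi_level k \<Phi> \<xi> q"
abbreviation "wd \<equiv> parisi_well_defined k \<Phi> \<xi> q"

definition \<sigma> :: "nat \<Rightarrow> real" where
  "\<sigma> l = sqrt (deriv \<xi> (q (Suc l)) - deriv \<xi> (q l))"

lemma \<sigma>_nonneg: "l \<le> k \<Longrightarrow> 0 \<le> \<sigma> l"
  unfolding \<sigma>_def using variance by simp

lemma z_law_eq: "z_law \<xi> q l = distr gauss borel (\<lambda>g. \<sigma> l * g)"
  by (simp add: z_law_def centered_gaussian_def \<sigma>_def)

text \<open>Measurability is contained in the assumed integrability; for a nonzero exponent a
  logarithm recovers the level from its exponential.\<close>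

lemma level_measurable:
  assumes "wd m" "l \<le> k"
  shows "level m (Suc l) \<in> borel_measurable borel"
proof (cases "m l = 0")
  case True
  then have "integrable (z_law \<xi> q l) (\<lambda>z. level m (Suc l) (0 + z))"
    using assms unfolding parisi_well_defined_def by metis
  then show ?thesis using borel_measurable_integrable by (fastforce simp: z_law_eq)
next
  case False
  then have "integrable (z_law \<xi> q l) (\<lambda>z. exp (m l * level m (Suc l) (0 + z)))"
    using assms unfolding parisi_well_defined_def by metis
  then have "(\<lambda>z. exp (m l * level m (Suc l) z)) \<in> borel_measurable borel"
    using borel_measurable_integrable by (fastforce simp: z_law_eq)
  then have "(\<lambda>z. ln (exp (m l * level m (Suc l) z)) / m l) \<in> borel_measurable borel"
    by measurable
  then show ?thesis using False by simp
qed

lemma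
  assumes "wd m" "l \<le> k"
  shows integrable_exp_level: "integrable gauss (\<lambda>g. exp (m l * level m (Suc l) (x + \<sigma> l * g)))"
    and integrable_level: "m l = 0 \<Longrightarrow> integrable gauss (\<lambda>g. level m (Suc l) (x + \<sigma> l * g))"
proof -
  note [measurable] = level_measurable[OF assms]
  show "integrable gauss (\<lambda>g. exp (m l * level m (Suc l) (x + \<sigma> l * g)))"
  proof (cases "m l = 0")
    case False
    then have "integrable (z_law \<xi> q l) (\<lambda>z. exp (m l * level m (Suc l) (x + z)))"
      using assms unfolding parisi_well_defined_def by metis
    then show ?thesis unfolding z_law_eq by (subst (asm) integrable_distr_eq) auto
  qed simp
  assume "m l = 0"
  then have "integrable (z_law \<xi> q l) (\<lambda>z. level m (Suc l) (x + z))"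
    using assms unfolding parisi_well_defined_def by metis
  then show "integrable gauss (\<lambda>g. level m (Suc l) (x + \<sigma> l * g))"
    unfolding z_law_eq by (subst (asm) integrable_distr_eq) auto
qed

lemma level_eq_gmean:
  assumes "wd m" "l \<le> k"
  shows "level m l = gmean (m l) (\<sigma> l) (level m (Suc l))"
proof
  fix x
  note [measurable] = level_measurable[OF assms]
  show "level m l x = gmean (m l) (\<sigma> l) (level m (Suc l)) x"
    unfolding parisi_level_step[OF assms(2)] log_exp_mean_def gmean_def lmean_def z_law_eq
    by (subst integral_distr, measurable)+
qed

lemma level_convex:
  assumes "wd m" and m: "\<And>l. l \<le> k \<Longrightarrow> 0 \<le> m l" and "l \<le> Suc k"
  shows "convex_on UNIV (level m l)"
  using assms(3)
proof (induction rule: inc_induct)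
  case base
  then show ?case by (simp add: parisi_level_top \<Phi>_convex)
next
  case (step l)
  then have l: "l \<le> k" by simp
  show ?case
    unfolding level_eq_gmean[OF assms(1) l]
    by (intro gmean_convex step.IH m l \<sigma>_nonneg integrable_exp_level integrable_level assms(1))
qed

text \<open>The points \<open>x\<close> and \<open>y\<close> vary independently, although only
  \<open>x = y\<close> is used in the end: the two sides receive different drifts, which separates
  the points at the next level.\<close>

lemma level_comparison:
  assumes wd: "wd m" "wd n" "wd w" and m: "\<And>l. l \<le> k \<Longrightarrow> 0 \<le> m l" and n: "\<And>l. l \<le> k \<Longrightarrow> 0 \<le> n l"
    and t: "0 < t" "t < 1" and w: "\<And>l. l \<le> k \<Longrightarrow> w l = (1 - t) * m l + t * n l" and "l \<le> Suc k"
  shows "level w l ((1 - t) * x + t * y) \<le> (1 - t) * level m l x + t * level n l y"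
  using \<open>l \<le> Suc k\<close>
proof (induction arbitrary: x y rule: inc_induct)
  case base
  then show ?case using convex_onD[OF \<Phi>_convex, of t x y] t by (simp add: parisi_level_top)
next
  case (step l)
  then have l: "l \<le> k" by simp
  have "0 \<le> w l" if "l \<le> k" for l using m n t w that by simp
  then have F: "convex_on UNIV (level w (Suc l))"
    using l by (intro level_convex wd) auto
  show ?case
    unfolding level_eq_gmean[OF wd(1) l] level_eq_gmean[OF wd(2) l] level_eq_gmean[OF wd(3) l]
    by (intro gmean_comparison[OF t m[OF l] n[OF l] w[OF l] F \<sigma>_nonneg[OF l]]
        integrable_exp_level integrable_level wd l step.IH)
qed

text \<open>The components of \<open>m\<close> may be negative. Nonnegativity is carried through the
  induction because \<open>lmean_le_lmean\<close> compares nonnegative functions.\<close>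

lemma level_mono:
  assumes wd: "wd m" "wd m'" and le: "\<And>l. l \<le> k \<Longrightarrow> m l \<le> m' l" and pos: "\<And>l. l \<le> k \<Longrightarrow> 0 < m' l"
    and "l \<le> Suc k"
  shows "0 \<le> level m l x \<and> level m l x \<le> level m' l x"
  using \<open>l \<le> Suc k\<close>
proof (induction arbitrary: x rule: inc_induct)
  case base
  then show ?case by (simp add: parisi_level_top \<Phi>_nonneg)
next
  case (step l)
  then have l: "l \<le> k" by simp
  note [measurable] = level_measurable[OF wd(1) l] level_measurable[OF wd(2) l]
  have 1: "(\<lambda>g. level m (Suc l) (x + \<sigma> l * g)) \<in> borel_measurable gauss" by measurable
  have 2: "(\<lambda>g. level m' (Suc l) (x + \<sigma> l * g)) \<in> borel_measurable gauss" by measurable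
  show ?case
    unfolding level_eq_gmean[OF wd(1) l] level_eq_gmean[OF wd(2) l] gmean_def
    using step.IH
    by (intro conjI gauss.lmean_le_lmean(1,2)[OF le[OF l] pos[OF l] 1 2 _ _ integrable_exp_level[OF wd(2) l]]) auto
qed

text \<open>\<open>D\<close> is chosen before the direction, so that one induction yields the
  partial derivatives and every directional derivative as their linear combination. The growth
  clause holds for every \<open>\<eta>\<close> because each level spends a fixed factor of it, while
  \<open>\<epsilon>\<close> stays the same at all levels.\<close>

lemma level_derivative:
  fixes m :: "nat \<Rightarrow> real" and \<epsilon> e :: real
  assumes near: "\<And>m'. (\<And>l. l \<le> k \<Longrightarrow> \<bar>m' l - m l\<bar> < e) \<Longrightarrow> wd m'"
    and m: "\<And>l. l \<le> k \<Longrightarrow> 0 \<le> m l" and \<epsilon>: "0 < \<epsilon>" "\<epsilon> < e" and "l \<le> Suc k"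
  defines "m' \<equiv> \<lambda>l. m l + \<epsilon>"
  shows "\<exists>D :: nat \<Rightarrow> real \<Rightarrow> real. \<forall>d :: nat \<Rightarrow> real.
    (\<forall>x. ((\<lambda>t. level (\<lambda>i. m i + t * d i) l x) has_real_derivative (\<Sum>j\<le>k. d j * D j x)) (at 0)) \<and>
    (\<forall>\<eta>>0. \<exists>C\<ge>0. \<exists>\<delta>>0. \<forall>t x. \<bar>t\<bar> < \<delta> \<longrightarrow>
      \<bar>level (\<lambda>i. m i + t * d i) l x - level m l x\<bar> \<le> \<bar>t\<bar> * (C * exp (\<eta> * level m' l x)))"
  using \<open>l \<le> Suc k\<close>
proof (induction rule: inc_induct)
  case base
  show ?case
    by (rule exI[of _ "\<lambda>_ _. 0"]) (auto simp: parisi_level_top intro!: exI[of _ 0] exI[of _ 1])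
next
  case (step l)
  then have l: "l \<le> k" by simp
  from step.IH obtain D where
    D: "\<And>d x. ((\<lambda>t. level (\<lambda>i. m i + t * d i) (Suc l) x) has_real_derivative (\<Sum>j\<le>k. d j * D j x)) (at 0)"
    and growth: "\<And>d \<eta>. \<eta> > 0 \<Longrightarrow> \<exists>C\<ge>0. \<exists>\<delta>>0. \<forall>t x. \<bar>t\<bar> < \<delta> \<longrightarrow>
      \<bar>level (\<lambda>i. m i + t * d i) (Suc l) x - level m (Suc l) x\<bar> \<le> \<bar>t\<bar> * (C * exp (\<eta> * level m' (Suc l) x))"
    by blast
  define c where "c = m l"
  have c: "0 \<le> c" using m l by (simp add: c_def)
  have wd_m: "wd m" using \<epsilon> by (intro near) simp
  have wd_m': "wd m'" using \<epsilon> by (intro near) (simp add: m'_def)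
  have m'_pos: "0 < m' j" if "j \<le> k" for j using m[OF that] \<epsilon> by (simp add: m'_def)
  define u where "u d x t g = level (\<lambda>i. m i + t * d i) (Suc l) (x + \<sigma> l * g)" for d x t g
  define U where "U x g = level m' (Suc l) (x + \<sigma> l * g)" for x g
  define D' where "D' d x g = (\<Sum>j\<le>k. d j * D j (x + \<sigma> l * g))" for d x g
  have u0: "u d x 0 = (\<lambda>g. level m (Suc l) (x + \<sigma> l * g))" for d x by (simp add: u_def fun_eq_iff)
  have family: "\<exists>C \<eta> \<delta>. (\<forall>x. lmean_family gauss c (d l) \<epsilon> \<delta> C \<eta> (u d x) (U x) (D' d x)) \<and>
      3 * \<eta> \<le> \<eta>' \<and> 4 * \<eta> * (c + \<epsilon>) \<le> 3 * \<epsilon> * \<eta>' \<and>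
      (\<forall>t. \<bar>t\<bar> < \<delta> \<longrightarrow> wd (\<lambda>i. m i + t * d i))" if \<eta>': "\<eta>' > 0" for d :: "nat \<Rightarrow> real" and \<eta>'
  proof -
    \<comment> \<open>The three bounds serve \<open>lmean_family\<close>,
      \<open>lmean_growth_zero\<close> and \<open>lmean_growth_pos\<close>.\<close>
    define \<eta> where "\<eta> = min (\<epsilon> / 4) (min (\<eta>' / 3) (3 * \<epsilon> * \<eta>' / (4 * (c + \<epsilon>))))"
    have \<eta>: "0 < \<eta>" "\<eta> \<le> \<epsilon> / 4" "3 * \<eta> \<le> \<eta>'" using \<eta>' \<epsilon> c by (auto simp: \<eta>_def)
    have "\<eta> \<le> 3 * \<epsilon> * \<eta>' / (4 * (c + \<epsilon>))" by (simp add: \<eta>_def)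
    then have \<eta>2: "4 * \<eta> * (c + \<epsilon>) \<le> 3 * \<epsilon> * \<eta>'" using \<epsilon> c by (simp add: field_simps)
    obtain C \<delta>1 where C: "C \<ge> 0" and \<delta>1: "\<delta>1 > 0" and
      Cb: "\<And>t x. \<bar>t\<bar> < \<delta>1 \<Longrightarrow> \<bar>level (\<lambda>i. m i + t * d i) (Suc l) x - level m (Suc l) x\<bar> \<le> \<bar>t\<bar> * (C * exp (\<eta> * level m' (Suc l) x))"
      using growth[OF \<eta>(1), of d] by blast
    define S where "S = 1 + (\<Sum>j\<le>k. \<bar>d j\<bar>)"
    have S: "S > 0" unfolding S_def by (intro add_pos_nonneg sum_nonneg) auto
    have dS: "\<bar>d j\<bar> \<le> S" if "j \<le> k" for j
    proof -
      have "\<bar>d j\<bar> \<le> (\<Sum>j\<le>k. \<bar>d j\<bar>)" using that by (intro member_le_sum) auto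
      then show ?thesis by (simp add: S_def)
    qed
    define b where "b = min \<eta> (if c > 0 then c / 2 else 1)"
    have b: "b > 0" using \<eta> by (simp add: b_def)
    define \<delta> where "\<delta> = min \<delta>1 (b / S)"
    have \<delta>: "\<delta> > 0" "\<delta> \<le> \<delta>1" using \<delta>1 b S by (auto simp: \<delta>_def)
    have small: "\<bar>t * d j\<bar> \<le> b" if "\<bar>t\<bar> < \<delta>" "j \<le> k" for t j
    proof -
      have "\<bar>t * d j\<bar> \<le> b / S * S"
        unfolding abs_mult using that dS b S by (intro mult_mono) (auto simp: \<delta>_def)
      then show ?thesis using S by simp
    qed
    have small_\<epsilon>: "\<bar>t * d j\<bar> \<le> \<epsilon> / 4" if "\<bar>t\<bar> < \<delta>" "j \<le> k" for t j
      using small[OF that] \<eta> by (simp add: b_def)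
    have wd_t: "wd (\<lambda>i. m i + t * d i)" if "\<bar>t\<bar> < \<delta>" for t
      using small_\<epsilon>[OF that] \<epsilon> by (intro near) fastforce
    have bounds: "0 \<le> level (\<lambda>i. m i + t * d i) (Suc l) x \<and> level (\<lambda>i. m i + t * d i) (Suc l) x \<le> level m' (Suc l) x"
      if "\<bar>t\<bar> < \<delta>" for t x
    proof (rule level_mono[OF wd_t[OF that] wd_m'])
      show "m j + t * d j \<le> m' j" if "j \<le> k" for j
        using small_\<epsilon>[OF \<open>\<bar>t\<bar> < \<delta>\<close> that] \<epsilon> by (simp add: m'_def abs_le_iff)
    qed (use m'_pos l in auto)
    have "lmean_family gauss c (d l) \<epsilon> \<delta> C \<eta> (u d x) (U x) (D' d x)" for x
    proof (unfold_locales)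
      show "\<bar>t * d l\<bar> \<le> \<eta>" "c > 0 \<Longrightarrow> \<bar>t * d l\<bar> \<le> c / 2" if "\<bar>t\<bar> < \<delta>" for t
        using small[OF that l] by (auto simp: b_def)
      show "u d x t \<in> borel_measurable gauss" if "\<bar>t\<bar> < \<delta>" for t
        using level_measurable[OF wd_t[OF that] l] unfolding u_def by measurable
      show "U x \<in> borel_measurable gauss"
        using level_measurable[OF wd_m' l] unfolding U_def by measurable
      show "0 \<le> u d x t z" "u d x t z \<le> U x z" if "\<bar>t\<bar> < \<delta>" for t z
        using bounds[OF that] by (auto simp: u_def U_def)
      show "integrable gauss (\<lambda>z. exp ((c + \<epsilon>) * U x z))"
        using integrable_exp_level[OF wd_m' l, of x] by (simp add: m'_def c_def U_def)
      show "\<bar>u d x t z - u d x 0 z\<bar> \<le> \<bar>t\<bar> * (C * exp (\<eta> * U x z))" if "\<bar>t\<bar> < \<delta>" for t z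
        using Cb[of t "x + \<sigma> l * z"] that \<delta> unfolding u0 by (simp add: u_def U_def)
      show "((\<lambda>t. u d x t z) has_real_derivative D' d x z) (at 0)" for z
        unfolding u_def D'_def by (rule D)
    qed (use c \<epsilon> \<delta> C \<eta> in auto)
    then show ?thesis using \<eta> \<eta>2 wd_t by blast
  qed
  have level_t: "level (\<lambda>i. m i + t * d i) l x = lmean (c + t * d l) gauss (u d x t)"
    if "wd (\<lambda>i. m i + t * d i)" for t d x
    unfolding level_eq_gmean[OF that l] by (simp add: gmean_def c_def u_def[abs_def])
  have level_0: "level m l x = lmean c gauss (u d x 0)" for d x
    using level_t[of 0 d x] wd_m by simp
  have level_m': "level m' l x = lmean (c + \<epsilon>) gauss (U x)" for x
    unfolding level_eq_gmean[OF wd_m' l] by (simp add: gmean_def m'_def c_def U_def[abs_def])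
  define f where "f x g = level m (Suc l) (x + \<sigma> l * g)" for x g
  \<comment> \<open>Chain rule: a derivative of the next level passes through as its mean under the
    tilted law, and the exponent of the present level adds its own slope.\<close>
  define D2 where "D2 j x = (\<integral>g. D j (x + \<sigma> l * g) * exp (c * f x g) \<partial>gauss) / (\<integral>g. exp (c * f x g) \<partial>gauss) +
      (if j = l then lmean_slope c gauss (f x) else 0)" for j x
  \<comment> \<open>The locale gives integrability of the sum over \<open>j\<close> only; unit
    directions isolate the summands.\<close>
  have int_D: "integrable gauss (\<lambda>g. D j (x + \<sigma> l * g) * exp (c * f x g))" if j: "j \<le> k" for j x
  proof -
    define d where "d i = (if i = j then 1 else 0 :: real)" for i
    obtain C \<eta> \<delta> where "lmean_family gauss c (d l) \<epsilon> \<delta> C \<eta> (u d x) (U x) (D' d x)"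
      using family[of 1 d] by auto
    from lmean_family.integrable_deriv[OF this]
    have "integrable gauss (\<lambda>g. D' d x g * exp (c * f x g))" by (simp add: u0 f_def)
    moreover have "D' d x g = D j (x + \<sigma> l * g)" for g
      unfolding D'_def d_def using j by (subst sum.remove[of _ j]) auto
    ultimately show ?thesis by simp
  qed
  show ?case
  proof (intro exI[of _ D2] allI conjI impI)
    fix d x
    obtain C \<eta> \<delta> where fam: "lmean_family gauss c (d l) \<epsilon> \<delta> C \<eta> (u d x) (U x) (D' d x)"
      and wd_t: "\<And>t. \<bar>t\<bar> < \<delta> \<Longrightarrow> wd (\<lambda>i. m i + t * d i)"
      using family[of 1 d] by fastforce
    have \<delta>: "\<delta> > 0" using fam by (rule lmean_family.\<delta>)
    have "((\<lambda>t. lmean (c + t * d l) gauss (u d x t)) has_real_derivative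
        (\<integral>g. D' d x g * exp (c * f x g) \<partial>gauss) / (\<integral>g. exp (c * f x g) \<partial>gauss) + d l * lmean_slope c gauss (f x)) (at 0)"
      using lmean_family.lmean_deriv[OF fam] unfolding u0 f_def[symmetric] .
    also have "(\<integral>g. D' d x g * exp (c * f x g) \<partial>gauss) = (\<Sum>j\<le>k. d j * (\<integral>g. D j (x + \<sigma> l * g) * exp (c * f x g) \<partial>gauss))"
      using int_D by (simp add: D'_def sum_distrib_right mult.assoc)
    also have "(\<Sum>j\<le>k. d j * (\<integral>g. D j (x + \<sigma> l * g) * exp (c * f x g) \<partial>gauss)) / (\<integral>g. exp (c * f x g) \<partial>gauss)
        + d l * lmean_slope c gauss (f x) = (\<Sum>j\<le>k. d j * D2 j x)"
    proof -
      have "(\<Sum>j\<le>k. d j * (if j = l then lmean_slope c gauss (f x) else 0)) = d l * lmean_slope c gauss (f x)"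
        using l by (subst sum.remove[of _ l]) auto
      then show ?thesis
        by (simp add: D2_def distrib_left sum.distrib sum_divide_distrib)
    qed
    finally have der: "((\<lambda>t. lmean (c + t * d l) gauss (u d x t)) has_real_derivative (\<Sum>j\<le>k. d j * D2 j x)) (at 0)" .
    show "((\<lambda>t. level (\<lambda>i. m i + t * d i) l x) has_real_derivative (\<Sum>j\<le>k. d j * D2 j x)) (at 0)"
      by (rule has_field_derivative_transform_within[OF der \<delta> UNIV_I])
         (simp only: dist_0_norm dist_commute[of _ 0] real_norm_def level_t[OF wd_t])
  next
    fix d and \<eta>' :: real assume \<eta>': "\<eta>' > 0"
    obtain C \<eta> \<delta> where fam: "\<And>x. lmean_family gauss c (d l) \<epsilon> \<delta> C \<eta> (u d x) (U x) (D' d x)"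
      and wd_t: "\<And>t. \<bar>t\<bar> < \<delta> \<Longrightarrow> wd (\<lambda>i. m i + t * d i)"
      and \<eta>: "3 * \<eta> \<le> \<eta>'" "4 * \<eta> * (c + \<epsilon>) \<le> 3 * \<epsilon> * \<eta>'"
      using family[OF \<eta>', of d] by fastforce
    have C: "C \<ge> 0" and \<delta>: "\<delta> > 0" and \<eta>0: "\<eta> > 0"
      using lmean_family.C[OF fam] lmean_family.\<delta>[OF fam] lmean_family.\<eta>(1)[OF fam] by auto
    define C' where "C' = (if c = 0 then \<bar>d l\<bar> / \<eta>\<^sup>2 + C
      else 2 * (\<bar>d l\<bar> / \<eta> + c * C) / c + 2 * \<bar>d l\<bar> * (c + \<epsilon>) / (c\<^sup>2 * \<eta>'))"
    have C': "C' \<ge> 0" using C \<eta>0 c \<epsilon> \<eta>' by (simp add: C'_def)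
    have "\<bar>level (\<lambda>i. m i + t * d i) l x - level m l x\<bar> \<le> \<bar>t\<bar> * (C' * exp (\<eta>' * level m' l x))"
      if t: "\<bar>t\<bar> < \<delta>" for t x
      using lmean_family.lmean_growth_zero[OF fam _ \<eta>(1) t] lmean_family.lmean_growth_pos[OF fam _ \<eta>(2) t] c
      unfolding level_t[OF wd_t[OF t]] level_0[of x d] level_m' C'_def by (cases "c = 0") auto
    then show "\<exists>C\<ge>0. \<exists>\<delta>>0. \<forall>t x. \<bar>t\<bar> < \<delta> \<longrightarrow>
        \<bar>level (\<lambda>i. m i + t * d i) l x - level m l x\<bar> \<le> \<bar>t\<bar> * (C * exp (\<eta>' * level m' l x))"
      using C' \<delta> by blast
  qed
qed

end

theorem theorem1:
  fixes k :: nat and \<Phi> \<xi> :: "real \<Rightarrow> real" and h :: real and q m n :: "nat \<Rightarrow> real"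
  assumes "k \<ge> 1"
    and "convex_on UNIV \<Phi>" and "smooth \<Phi>" and "\<And>x. \<Phi> (- x) = \<Phi> x" and "\<Phi> 0 = 0"
    and "convex_on UNIV \<xi>" and "smooth \<xi>" and "\<And>x. \<xi> (- x) = \<xi> x" and "\<xi> 0 = 0"
    and "q 0 = 0" and "\<And>l. l \<le> k \<Longrightarrow> q l \<le> q (Suc l)" and "q (Suc k) = 1"
    and "m 0 = 0" and "\<And>l. l < k \<Longrightarrow> m l \<le> m (Suc l)" and "m k = 1"
    and "n 0 = 0" and "\<And>l. l < k \<Longrightarrow> n l \<le> n (Suc l)" and "n k = 1"
    and "parisi_well_defined_near k \<Phi> \<xi> q m" and "parisi_well_defined k \<Phi> \<xi> q n"
    and "(\<forall>j\<le>k. n j \<le> m j) \<or> (\<forall>j\<le>k. n j \<ge> m j)"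
  shows "(\<forall>j\<le>k. (\<lambda>s. parisi k \<Phi> \<xi> q h (m(j := s))) differentiable (at (m j))) \<and>
    parisi k \<Phi> \<xi> q h n - parisi k \<Phi> \<xi> q h m
      \<ge> (\<Sum>j\<le>k. partial_deriv (parisi k \<Phi> \<xi> q h) j m * (n j - m j))"
proof -
  interpret parisi_functional k \<Phi> \<xi> q
  proof
    show "0 \<le> \<Phi> x" for x by (rule even_convex_nonneg) (use assms in auto)
    have "\<xi> differentiable (at x)" for x
      using assms(7) unfolding smooth_def by (metis funpow_0)
    then show "0 \<le> deriv \<xi> (q (Suc l)) - deriv \<xi> (q l)" if "l \<le> k" for l
      using convex_deriv_mono[OF assms(6)] assms(11)[OF that] by simp
  qed (rule assms)
  have nonneg: "0 \<le> p l" if "p 0 = 0" "\<And>l. l < k \<Longrightarrow> p l \<le> p (Suc l)" "l \<le> k" for p :: "nat \<Rightarrow> real" and l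
    using that(3)
  proof (induction l)
    case (Suc l)
    then show ?case using that(2)[of l] by simp
  qed (simp add: that(1))
  have m0: "0 \<le> m l" and n0: "0 \<le> n l" if "l \<le> k" for l
    using nonneg[of m] nonneg[of n] assms that by auto
  obtain e where e: "e > 0" and near: "\<And>m'. (\<And>l. l \<le> k \<Longrightarrow> \<bar>m' l - m l\<bar> < e) \<Longrightarrow> wd m'"
    using assms(19) unfolding parisi_well_defined_near_def by blast
  obtain D where D: "\<And>d x. ((\<lambda>t. level (\<lambda>i. m i + t * d i) 0 x) has_real_derivative (\<Sum>j\<le>k. d j * D j x)) (at 0)"
    using level_derivative[where m = m and e = e and \<epsilon> = "e / 2" and l = 0, OF near m0] e by auto
  have partial: "((\<lambda>s. parisi k \<Phi> \<xi> q h (m(j := s))) has_real_derivative D j h) (at (m j))" if j: "j \<le> k" for j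
  proof -
    define d where "d i = (if i = j then 1 else 0 :: real)" for i
    have "(\<Sum>i\<le>k. d i * D i h) = D j h"
      unfolding d_def using j by (subst sum.remove[of _ j]) auto
    then have "((\<lambda>t. level (\<lambda>i. m i + t * d i) 0 h) has_real_derivative D j h) (at 0)"
      using D[of d h] by simp
    moreover have "(\<lambda>i. m i + t * d i) = m(j := t + m j)" for t
      by (auto simp: d_def)
    ultimately have "((\<lambda>t. parisi k \<Phi> \<xi> q h (m(j := t + m j))) has_real_derivative D j h) (at 0)"
      by (simp add: parisi_def)
    then show ?thesis using DERIV_shift[of "\<lambda>s. parisi k \<Phi> \<xi> q h (m(j := s))" "D j h" 0 "m j"] by simp
  qed
  define \<phi> where "\<phi> t = parisi k \<Phi> \<xi> q h (\<lambda>i. m i + t * (n i - m i))" for t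
  have \<phi>': "(\<phi> has_real_derivative (\<Sum>j\<le>k. (n j - m j) * D j h)) (at 0)"
    unfolding \<phi>_def parisi_def by (rule D)
  have \<phi>0: "\<phi> 0 = parisi k \<Phi> \<xi> q h m" by (simp add: \<phi>_def)
  \<comment> \<open>The bound \<open>t < e / S\<close> places the point
    \<open>m + t * (n - m)\<close> in the neighbourhood of \<open>m\<close> where the recursion is
    known to be well defined; only such \<open>t\<close> enter the limit.\<close>
  define S where "S = 1 + (\<Sum>j\<le>k. \<bar>n j - m j\<bar>)"
  have S: "S \<ge> 1" unfolding S_def by (simp add: sum_nonneg)
  have chord: "(\<phi> t - \<phi> 0) / (t - 0) \<le> parisi k \<Phi> \<xi> q h n - parisi k \<Phi> \<xi> q h m"
    if t: "0 < t" "t < 1" "t < e / S" for t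
  proof -
    have "wd (\<lambda>i. m i + t * (n i - m i))"
    proof (rule near)
      fix l assume l: "l \<le> k"
      have "\<bar>n l - m l\<bar> \<le> (\<Sum>j\<le>k. \<bar>n j - m j\<bar>)" using l by (intro member_le_sum) auto
      then have "t * \<bar>n l - m l\<bar> \<le> t * S" using t by (intro mult_left_mono) (auto simp: S_def)
      also have "t * S < e" using t S by (simp add: pos_less_divide_eq)
      finally show "\<bar>m l + t * (n l - m l) - m l\<bar> < e" using t by (simp add: abs_mult)
    qed
    moreover have "wd m" using e by (intro near) simp
    ultimately have "level (\<lambda>i. m i + t * (n i - m i)) 0 ((1 - t) * h + t * h) \<le> (1 - t) * level m 0 h + t * level n 0 h"
      using m0 n0 t assms(20) by (intro level_comparison) (auto simp: algebra_simps)
    then have "\<phi> t \<le> (1 - t) * \<phi> 0 + t * parisi k \<Phi> \<xi> q h n"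
      unfolding \<phi>0 by (simp add: \<phi>_def parisi_def algebra_simps)
    then have "\<phi> t - \<phi> 0 \<le> (parisi k \<Phi> \<xi> q h n - \<phi> 0) * t"
      by (simp add: algebra_simps)
    then show ?thesis
      using t(1) unfolding \<phi>0[symmetric] by (simp only: pos_divide_le_eq diff_zero)
  qed
  \<comment> \<open>The chord inequality is available for \<open>t > 0\<close> only, so the
    two-sided derivative is restricted to a limit from the right.\<close>
  have "((\<lambda>t. (\<phi> t - \<phi> 0) / (t - 0)) \<longlongrightarrow> (\<Sum>j\<le>k. (n j - m j) * D j h)) (at_right 0)"
    using \<phi>' unfolding has_field_derivative_iff by (rule tendsto_mono[rotated]) (simp add: at_le)
  moreover have "eventually (\<lambda>t. t \<in> {0<..<min 1 (e / S)}) (at_right 0)"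
    using e S by (intro eventually_at_right_real) auto
  then have "eventually (\<lambda>t. (\<phi> t - \<phi> 0) / (t - 0) \<le> parisi k \<Phi> \<xi> q h n - parisi k \<Phi> \<xi> q h m) (at_right 0)"
    by eventually_elim (rule chord, auto)
  ultimately have "(\<Sum>j\<le>k. (n j - m j) * D j h) \<le> parisi k \<Phi> \<xi> q h n - parisi k \<Phi> \<xi> q h m"
    by (intro tendsto_upperbound[where F = "at_right 0"]) auto
  moreover have "(\<Sum>j\<le>k. partial_deriv (parisi k \<Phi> \<xi> q h) j m * (n j - m j)) = (\<Sum>j\<le>k. (n j - m j) * D j h)"
    using DERIV_imp_deriv[OF partial] by (intro sum.cong) (auto simp: partial_deriv_def mult.commute)
  ultimately show ?thesis
    using partial real_differentiable_def by auto
qed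

end
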